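(* There exists a universal constant $C>0$ such that for any integers $2\le k\le n$ and any $\rho_n\in(0,1]$, $$\inf_{\widehat f}\ \sup_{W_0\in\mathcal W^+[k]}\mathbb E_{W_0}\big[\delta_\square(\widehat f,f_0)\big]\ \ge\ C\min\left(\rho_n\sqrt{\frac{k}{n\log(k)}}+\sqrt{\frac{\rho_n}{n}},\ \rho_n\right),$$ where $f_0=\rho_nW_0$ and $\inf_{\widehat f}$ is the infimum over all estimators, i.e. all graphon-valued functions $\widehat f=\widehat f(\boldsymbol A)$ of the adjacency matrix $\boldsymbol A$.
   Context: $[m]=\{1,\dots,m\}$. $\mathcal W^+$ is the set of graphons, i.e. symmetric measurable functions $W:[0,1]^2\to[0,1]$. $\mathcal W^+[k]$ is the set of $k$-step graphons: those $W\in\mathcal W^+$ such that for some symmetric $\boldsymbol Q\in[0,1]^{k\times k}$ and some $\phi:[0,1]\to[k]$, $W(x,y)=\boldsymbol Q_{\phi(x),\phi(y)}$ for all $x,y\in[0,1]$. $W$-random graph model: $\xi_1,\dots,\xi_n$ are i.i.d. uniform on $[0,1]$ (unobserved); given $W_0\in\mathcal W^+$ and $\rho_n\in(0,1]$, $\boldsymbol\Theta_0$ is the symmetric $n\times n$ matrix with entries $\boldsymbol\Theta_{ij}=\rho_nW_0(\xi_i,\xi_j)$ for $i\ne j$ and $\boldsymbol\Theta_{ii}=0$. Conditionally on $\boldsymbol\Theta_0$, $\boldsymbol A$ is a symmetric $\{0,1\}$-valued $n\times n$ matrix with zero diagonal whose entries $\boldsymbol A_{ij}$, $i<j$, are independent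 Bernoulli with parameters $\boldsymbol\Theta_{ij}$. $\mathbb E_{W_0}$ is the expectation in this model. The cut norm of a bounded symmetric measurable $W$ on $[0,1]^2$ is $\|W\|_\square=\sup_{S,T\subset[0,1]}\big|\int_{S\times T}W(x,y)\,dx\,dy\big|$ (sup over measurable $S,T$). The cut distance is $\delta_\square(W_1,W_2)=\inf_{\tau}\|W_1-W_2^\tau\|_\square$, the infimum being over all measure-preserving bijections $\tau:[0,1]\to[0,1]$, with $W^\tau(x,y)=W(\tau(x),\tau(y))$. *)

theory Defs
  imports "HOL-Probability.Probability" "HOL-Probability.Product_PMF"
begin

text \<open>
  Lebesgue measure on the Borel subsets of $[0,1]$, i.e. the uniform law. Its space is $[0,1]$
  itself: functions below are total on \<^typ>\<open>real\<close>, but only their values on $[0,1]$ matter, and no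
  measurability is required of them elsewhere.
\<close>
definition unit_measure :: "real measure" where
  "unit_measure = restrict_space lborel {0..1}"

definition graphons :: "(real \<Rightarrow> real \<Rightarrow> real) set" where
  "graphons = {W. (\<lambda>(x, y). W x y) \<in> borel_measurable (unit_measure \<Otimes>\<^sub>M unit_measure) \<and>
                  (\<forall>x\<in>{0..1}. \<forall>y\<in>{0..1}. W x y \<in> {0..1} \<and> W x y = W y x)}"

definition step_graphons :: "nat \<Rightarrow> (real \<Rightarrow> real \<Rightarrow> real) set" where
  "step_graphons k = {W \<in> graphons. \<exists>(Q :: nat \<Rightarrow> nat \<Rightarrow> real) (\<phi> :: real \<Rightarrow> nat).
     (\<forall>a\<in>{1..k}. \<forall>b\<in>{1..k}. Q a b \<in> {0..1} \<and> Q a b = Q b a) \<and>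
     \<phi> \<in> {0..1} \<rightarrow> {1..k} \<and>
     (\<forall>x\<in>{0..1}. \<forall>y\<in>{0..1}. W x y = Q (\<phi> x) (\<phi> y))}"

text \<open>For bounded \<open>W\<close> the set of values is bounded, so the real supremum is the actual one.\<close>
definition cut_norm :: "(real \<Rightarrow> real \<Rightarrow> real) \<Rightarrow> real" where
  "cut_norm W = (SUP (S, T) \<in> sets unit_measure \<times> sets unit_measure.
     \<bar>LINT (x, y) : S \<times> T | unit_measure \<Otimes>\<^sub>M unit_measure. W x y\<bar>)"

definition measure_preserving_bijections :: "(real \<Rightarrow> real) set" where
  "measure_preserving_bijections =
     {\<tau>. bij_betw \<tau> {0..1} {0..1} \<and> \<tau> \<in> measurable unit_measure unit_measure \<and>
         distr unit_measure unit_measure \<tau> = unit_measure}"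

definition cut_distance :: "(real \<Rightarrow> real \<Rightarrow> real) \<Rightarrow> (real \<Rightarrow> real \<Rightarrow> real) \<Rightarrow> real" where
  "cut_distance W1 W2 =
     (INF \<tau> \<in> measure_preserving_bijections. cut_norm (\<lambda>x y. W1 x y - W2 (\<tau> x) (\<tau> y)))"

text \<open>
  An $n \times n$ matrix is a function on pairs of indices from \<^term>\<open>{1..n::nat}\<close>; adjacency matrices
  are set to zero outside that range, which makes their representation unique.
\<close>
definition adjacency_matrices :: "nat \<Rightarrow> (nat \<Rightarrow> nat \<Rightarrow> nat) set" where
  "adjacency_matrices n = {A. (\<forall>i j. A i j \<in> {0, 1}) \<and> (\<forall>i j. A i j = A j i) \<and> (\<forall>i. A i i = 0) \<and>
     (\<forall>i j. i \<notin> {1..n} \<or> j \<notin> {1..n} \<longrightarrow> A i j = 0)}"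

definition edge_probs ::
  "real \<Rightarrow> (real \<Rightarrow> real \<Rightarrow> real) \<Rightarrow> (nat \<Rightarrow> real) \<Rightarrow> nat \<Rightarrow> nat \<Rightarrow> real" where
  "edge_probs \<rho> W \<xi> i j = (if i = j then 0 else \<rho> * W (\<xi> i) (\<xi> j))"

text \<open>
  The conditional law of the adjacency matrix given the matrix \<open>\<Theta>\<close> of edge probabilities:
  independent Bernoulli entries above the diagonal, extended by symmetry.
\<close>
definition adjacency_pmf :: "nat \<Rightarrow> (nat \<Rightarrow> nat \<Rightarrow> real) \<Rightarrow> (nat \<Rightarrow> nat \<Rightarrow> nat) pmf" where
  "adjacency_pmf n \<Theta> =
     map_pmf (\<lambda>e i j. of_bool (i \<noteq> j \<and> e (min i j, max i j)))
       (Pi_pmf {(i, j). 1 \<le> i \<and> i < j \<and> j \<le> n} False (\<lambda>(i, j). bernoulli_pmf (\<Theta> i j)))"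

text \<open>
  Expectation of a function \<open>g\<close> of the adjacency matrix in the $W$-random graph model: the average,
  over i.i.d. uniform $\xi_1, \dots, \xi_n$, of the conditional expectation given $\xi$.
\<close>
definition graphon_expectation ::
  "nat \<Rightarrow> real \<Rightarrow> (real \<Rightarrow> real \<Rightarrow> real) \<Rightarrow> ((nat \<Rightarrow> nat \<Rightarrow> nat) \<Rightarrow> real) \<Rightarrow> real" where
  "graphon_expectation n \<rho> W g =
     (LINT \<xi> | Pi\<^sub>M {1..n} (\<lambda>_. unit_measure).
        measure_pmf.expectation (adjacency_pmf n (edge_probs \<rho> W \<xi>)) g)"

text \<open>
  The adjacency matrices form a finite set, so no measurability condition on estimators is needed.
\<close>
definition estimators :: "nat \<Rightarrow> ((nat \<Rightarrow> nat \<Rightarrow> nat) \<Rightarrow> real \<Rightarrow> real \<Rightarrow> real) set" where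
  "estimators n = adjacency_matrices n \<rightarrow> graphons"

end

theory Submission
  imports Defs "HOL-Real_Asymp.Real_Asymp"
begin

text \<open>
  Up to a constant the minimum is at most the sum of \<open>\<rho> sqrt (k / (n ln k))\<close> and \<open>min (sqrt (\<rho> / n)) \<rho>\<close>, and these are
  obtained from two different families.

  For the second term, a balanced two-block graphon with entries \<open>(1 \<plusminus> \<epsilon>) / 2\<close> cannot be told from the
  constant \<open>1 / 2\<close> when \<open>n \<rho> \<epsilon>\<^sup>2\<close> is small: the \<open>\<chi>\<^sup>2\<close> divergence is bounded by an exponential moment of the
  square of a sum of \<open>n\<close> random signs. This term dominates the first one as long as \<open>k\<close> is bounded.

  For the first term with \<open>k\<close> large, the block masses are unknown. About \<open>k / 2\<close> word blocks have masses
  \<open>(1 \<plusminus> \<gamma>) / (2 K)\<close> with \<open>\<gamma>\<close> of order \<open>sqrt (k / n)\<close>, and are joined to \<open>m\<close>, of order \<open>ln k\<close>, letter blocks according to a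
  binary code with linear distance. Testing the cut norm on random sets of letters shows that mass of one
  word block aligned with another one costs at least a constant times \<open>1 / sqrt m\<close>; this is the
  origin of the logarithm. Hence the hypotheses close to a given estimate are determined, up to few signs, by
  the coupling of the letters, which has only \<open>m\<^sup>2\<close> parameters, so that they form an exponentially
  small proportion of all the hypotheses.
\<close>

subsection \<open>Block graphons and the cut distance\<close>

text \<open>A small cut distance only supplies some measure-preserving alignment with the estimate,
  an object without finite description. Two aligned hypotheses interact only through the joint law
  of their labels, a coupling with \<open>(K + m)^2\<close> entries, which is still too many to
  count over. A word block, however, is incident to letters alone, so rounded letter entries already
  decide which word each word block has to match. The count then rests on exponents in
  \<open>K\<close>: a Hamming ball of radius \<open>K / 10\<close> is a fraction of at most
  \<open>exp (- K / 5)\<close> of all sign patterns, the rounding contributes at most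
  \<open>exp (K / 10)\<close> together with the polynomial factors, and observing \<open>n\<close>
  labels contributes \<open>exp (n * \<gamma>^2) = exp (K / 36)\<close>. This budget fixes \<gamma>
  and the thresholds. Once the labels are treated as observed, the edges carry no further
  information about the block masses; hence \<rho> enters this term only by scaling the
  distance.\<close>

lemma space_unit_measure [simp]: "space unit_measure = {0..1}"
  by (simp add: unit_measure_def space_restrict_space)

lemma sets_unit_measure: "A \<in> sets unit_measure \<longleftrightarrow> A \<in> sets borel \<and> A \<subseteq> {0..1}"
  by (auto simp: unit_measure_def sets_restrict_space_iff)

lemma measure_unit_measure:
  assumes "A \<subseteq> {0..1}" shows "measure unit_measure A = measure lborel A"
  unfolding unit_measure_def using assms by (intro measure_restrict_space) auto

interpretation unit: prob_space unit_measure
proof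
  have "emeasure unit_measure {0..1} = emeasure lborel {0..1::real}"
    unfolding unit_measure_def by (intro emeasure_restrict_space) auto
  then show "emeasure unit_measure (space unit_measure) = 1" by simp
qed

interpretation unit_pair: pair_prob_space unit_measure unit_measure ..

definition has_block_masses :: "nat \<Rightarrow> (nat \<Rightarrow> real) \<Rightarrow> (real \<Rightarrow> nat) \<Rightarrow> bool" where
  "has_block_masses k w \<phi> \<longleftrightarrow> \<phi> \<in> measurable unit_measure (count_space UNIV) \<and> \<phi> \<in> {0..1} \<rightarrow> {1..k} \<and>
     (\<forall>a\<in>{1..k}. measure unit_measure {x\<in>{0..1}. \<phi> x = a} = w a)"

text \<open>The labels are the generalized inverse of the partial sums of \<open>w\<close>, so that
  block \<open>a\<close> is an interval of length \<open>w a\<close>.\<close>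

lemma block_masses_exist:
  assumes w: "\<And>a. a \<in> {1..k} \<Longrightarrow> w a \<ge> 0" and s: "(\<Sum>a\<in>{1..k}. w a) = 1"
  shows "\<exists>\<phi>. has_block_masses k w \<phi>"
proof -
  define S where "S a = (\<Sum>i\<in>{1..a}. w i)" for a
  define \<phi> where "\<phi> x = (LEAST a. 1 \<le> a \<and> x \<le> S a)" for x
  have k1: "1 \<le> k" using s by (cases k) auto
  have S_mono: "S a \<le> S b" if "a \<le> b" "b \<le> k" for a b
    unfolding S_def using that w by (intro sum_mono2) auto
  have S0: "S 0 = 0" and Sk: "S k = 1" using s by (auto simp: S_def)
  have S_range: "0 \<le> S a \<and> S a \<le> 1" if "a \<le> k" for a
    using S_mono[of 0 a] S_mono[of a k] that S0 Sk by auto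
  have \<phi>_le: "\<phi> x \<le> a \<longleftrightarrow> x \<le> S a" if x: "x \<in> {0..1}" and a: "1 \<le> a" "a \<le> k" for x a
  proof
    have P: "1 \<le> \<phi> x \<and> x \<le> S (\<phi> x)"
      unfolding \<phi>_def by (rule LeastI[where k = k]) (use k1 Sk x in auto)
    assume "\<phi> x \<le> a"
    then show "x \<le> S a" using P S_mono[of "\<phi> x" a] a by auto
  next
    assume "x \<le> S a"
    then show "\<phi> x \<le> a" unfolding \<phi>_def using a by (intro Least_le) auto
  qed
  have \<phi>_pos: "1 \<le> \<phi> x" if "x \<in> {0..1}" for x
    using LeastI[of "\<lambda>a. 1 \<le> a \<and> x \<le> S a" k] k1 Sk that unfolding \<phi>_def by auto
  have range: "\<phi> \<in> {0..1} \<rightarrow> {1..k}"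
    using \<phi>_pos \<phi>_le[of _ k] k1 Sk by auto
  \<comment> \<open>The guard \<open>1 \<le> a\<close> in \<open>\<phi>\<close> puts the point 0
    into block 1, so the first interval is closed on the left.\<close>
  have lev: "{x\<in>{0..1}. \<phi> x = a} = (if a = 1 then {0..S a} else {S (a-1)<..S a})"
    if a: "a \<in> {1..k}" for a
  proof (cases "a = 1")
    case True
    have "\<phi> x = a \<longleftrightarrow> x \<le> S a" if "x \<in> {0..1}" for x
      using \<phi>_le[OF that, of a] \<phi>_pos[OF that] a True by auto
    then show ?thesis using S_range[of a] a True by auto
  next
    case False
    have "\<phi> x = a \<longleftrightarrow> x \<le> S a \<and> S (a-1) < x" if "x \<in> {0..1}" for x
    proof -
      have "1 \<le> a - 1" "a - 1 \<le> k" "1 \<le> a" "a \<le> k" using a False by auto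
      with \<phi>_le[OF that, of a] \<phi>_le[OF that, of "a-1"] show ?thesis by linarith
    qed
    then show ?thesis using S_range[of a] S_range[of "a-1"] a False by fastforce
  qed
  have ms: "measure unit_measure {x\<in>{0..1}. \<phi> x = a} = w a" if a: "a \<in> {1..k}" for a
  proof -
    have Sa: "S a = S (a-1) + w a"
    proof -
      obtain b where "a = Suc b" using a by (cases a) auto
      then show ?thesis by (simp add: S_def)
    qed
    have "measure unit_measure {x\<in>{0..1}. \<phi> x = a} = measure lborel {x\<in>{0..1}. \<phi> x = a}"
      by (intro measure_unit_measure) auto
    also have "\<dots> = w a"
      using Sa S0 S_range[of a] S_mono[of "a-1" a] a unfolding lev[OF a] by (auto split: if_splits)
    finally show ?thesis .
  qed
  have "\<phi> \<in> measurable unit_measure (count_space {1..k})"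
  proof (rule measurable_count_space_eq2[THEN iffD2], simp, safe)
    fix x :: real assume "x \<in> space unit_measure"
    then show "\<phi> x \<in> {1..k}" using range by auto
  next
    fix a assume a: "a \<in> {1..k}"
    have "\<phi> -` {a} \<inter> space unit_measure = {x\<in>{0..1}. \<phi> x = a}" by auto
    also have "\<dots> \<in> sets unit_measure"
    proof -
      have "0 \<le> S (a-1)" "S a \<le> 1" using S_range[of "a-1"] S_range[of a] a by auto
      then have "{0..S a} \<subseteq> {0..1}" "{S (a-1)<..S a} \<subseteq> {0..1}" by auto
      then show ?thesis unfolding lev[OF a] by (cases "a = 1") (simp_all only: sets_unit_measure if_True if_False atLeastAtMost_borel greaterThanAtMost_borel simp_thms)
    qed
    finally show "\<phi> -` {a} \<inter> space unit_measure \<in> sets unit_measure" .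
  qed
  then have "\<phi> \<in> measurable unit_measure (count_space UNIV)"
    by (rule measurable_compose[where g = "\<lambda>a. a"]) simp
  then show ?thesis using range ms unfolding has_block_masses_def by blast
qed

definition block_graphon :: "(nat \<Rightarrow> nat \<Rightarrow> real) \<Rightarrow> (real \<Rightarrow> nat) \<Rightarrow> real \<Rightarrow> real \<Rightarrow> real" where
  "block_graphon Q \<phi> x y = Q (\<phi> x) (\<phi> y)"

definition block_matrix :: "nat \<Rightarrow> (nat \<Rightarrow> nat \<Rightarrow> real) \<Rightarrow> bool" where
  "block_matrix k Q \<longleftrightarrow> (\<forall>a\<in>{1..k}. \<forall>b\<in>{1..k}. Q a b \<in> {0..1} \<and> Q a b = Q b a)"

lemma measurable_block_function:
  assumes [measurable]: "\<phi> \<in> measurable unit_measure (count_space (UNIV :: nat set))"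
  shows "(\<lambda>(x, y). (g :: nat \<Rightarrow> nat \<Rightarrow> real) (\<phi> x) (\<phi> y))
           \<in> borel_measurable (unit_measure \<Otimes>\<^sub>M unit_measure)"
  unfolding split_beta
proof -
  show "(\<lambda>p. g (\<phi> (fst p)) (\<phi> (snd p))) \<in> borel_measurable (unit_measure \<Otimes>\<^sub>M unit_measure)"
    by (rule measurable_compose_countable[where f = "\<lambda>a p. g a (\<phi> (snd p))"])
       (auto intro: measurable_compose_countable[where f = "\<lambda>b p. g _ b"])
qed

text \<open>The slack \<open>k \<le> k'\<close> lets families with 2 or with \<open>K + m\<close>
  blocks serve for every larger number of steps.\<close>

lemma block_graphon_in_step_graphons:
  assumes "has_block_masses k w \<phi>" "block_matrix k' Q" "k \<le> k'"
  shows "block_graphon Q \<phi> \<in> step_graphons k'"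
proof -
  have \<phi>: "\<phi> x \<in> {1..k'}" if "x \<in> {0..1}" for x
  proof -
    have "\<phi> x \<in> {1..k}" using assms(1) that unfolding has_block_masses_def by blast
    then show ?thesis using assms(3) by simp
  qed
  have "block_graphon Q \<phi> \<in> graphons"
    using measurable_block_function[of \<phi> Q] assms \<phi>
    unfolding graphons_def block_graphon_def has_block_masses_def block_matrix_def by blast
  then show ?thesis
    using assms(2) \<phi> unfolding step_graphons_def block_matrix_def block_graphon_def
    by blast
qed

lemma unit_pair_measure_Times:
  assumes "A \<in> sets unit_measure" "B \<in> sets unit_measure"
  shows "measure (unit_measure \<Otimes>\<^sub>M unit_measure) (A \<times> B) = measure unit_measure A * measure unit_measure B"
  unfolding measure_def using assms by (simp add: unit.emeasure_pair_measure_Times enn2real_mult)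

lemma label_set_in_sets:
  assumes "Z \<in> measurable unit_measure (count_space UNIV)"
  shows "{x\<in>{0..1}. Z x \<in> S} \<in> sets unit_measure" "{x\<in>{0..1}. Z x = p} \<in> sets unit_measure"
proof -
  have "Z -` S \<inter> space unit_measure = {x\<in>{0..1}. Z x \<in> S}" for S by auto
  then show *: "{x\<in>{0..1}. Z x \<in> S} \<in> sets unit_measure" for S
    using measurable_sets[OF assms, of S] by simp
  from *[of "{p}"] show "{x\<in>{0..1}. Z x = p} \<in> sets unit_measure" by simp
qed

text \<open>Labels of any countable type are allowed because the main use is with pairs of labels,
  the common refinement of two partitions.\<close>

lemma finite_label_integral:
  fixes Z :: "real \<Rightarrow> 'c::countable" and h :: "'c \<Rightarrow> 'c \<Rightarrow> real"
  assumes Z[measurable]: "Z \<in> measurable unit_measure (count_space UNIV)" and fin: "finite S" "finite T"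
  shows "(LINT (x, y) : {x\<in>{0..1}. Z x \<in> S} \<times> {y\<in>{0..1}. Z y \<in> T} | unit_measure \<Otimes>\<^sub>M unit_measure. h (Z x) (Z y))
       = (\<Sum>p\<in>S. \<Sum>q\<in>T. measure unit_measure {x\<in>{0..1}. Z x = p} * measure unit_measure {x\<in>{0..1}. Z x = q} * h p q)"
proof -
  let ?L = "\<lambda>p. {x\<in>{0..1}. Z x = p}"
  have L: "?L p \<in> sets unit_measure" for p by (rule label_set_in_sets[OF Z])
  have pw: "indicator ({x\<in>{0..1}. Z x \<in> S} \<times> {y\<in>{0..1}. Z y \<in> T}) v *\<^sub>R (case v of (x, y) \<Rightarrow> h (Z x) (Z y))
      = (\<Sum>p\<in>S. \<Sum>q\<in>T. h p q * indicator (?L p \<times> ?L q) v)"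
    if "v \<in> space (unit_measure \<Otimes>\<^sub>M unit_measure)" for v
  proof -
    obtain x y where v: "v = (x, y)" "x \<in> {0..1}" "y \<in> {0..1}"
      using \<open>v \<in> _\<close> by (auto simp: space_pair_measure)
    have "(\<Sum>p\<in>S. \<Sum>q\<in>T. h p q * indicator (?L p \<times> ?L q) v)
        = (\<Sum>p\<in>S. if p = Z x then (\<Sum>q\<in>T. if q = Z y then h p q else 0) else 0)"
      using v by (intro sum.cong refl) (auto simp: indicator_def intro!: sum.cong)
    also have "\<dots> = (if Z x \<in> S \<and> Z y \<in> T then h (Z x) (Z y) else 0)"
      using fin by (simp add: sum.delta)
    finally show ?thesis using v by (auto simp: indicator_def)
  qed
  have "(LINT (x, y) : {x\<in>{0..1}. Z x \<in> S} \<times> {y\<in>{0..1}. Z y \<in> T} | unit_measure \<Otimes>\<^sub>M unit_measure. h (Z x) (Z y))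
      = integral\<^sup>L (unit_measure \<Otimes>\<^sub>M unit_measure) (\<lambda>v. \<Sum>p\<in>S. \<Sum>q\<in>T. h p q * indicator (?L p \<times> ?L q) v)"
    unfolding set_lebesgue_integral_def using pw by (intro Bochner_Integration.integral_cong) auto
  also have "\<dots> = (\<Sum>p\<in>S. \<Sum>q\<in>T. h p q * measure (unit_measure \<Otimes>\<^sub>M unit_measure) (?L p \<times> ?L q))"
  proof -
    have int: "integrable (unit_measure \<Otimes>\<^sub>M unit_measure) (\<lambda>v. h p q * indicator (?L p \<times> ?L q) v)" for p q
      using L by (intro integrable_mult_right integrable_real_indicator)
        (simp_all add: less_top[symmetric])
    have one: "integral\<^sup>L (unit_measure \<Otimes>\<^sub>M unit_measure) (\<lambda>v. h p q * indicator (?L p \<times> ?L q) v)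
        = h p q * measure (unit_measure \<Otimes>\<^sub>M unit_measure) (?L p \<times> ?L q)" for p q
    proof -
      have "?L p \<times> ?L q \<inter> space (unit_measure \<Otimes>\<^sub>M unit_measure) = ?L p \<times> ?L q"
        by (auto simp: space_pair_measure)
      then show ?thesis by simp
    qed
    show ?thesis
      by (simp only: Bochner_Integration.integral_sum Bochner_Integration.integrable_sum int one)
  qed
  also have "\<dots> = (\<Sum>p\<in>S. \<Sum>q\<in>T. measure unit_measure (?L p) * measure unit_measure (?L q) * h p q)"
    using L by (simp add: unit_pair_measure_Times mult_ac)
  finally show ?thesis .
qed

section \<open>Integrals over rectangles and the cut norm\<close>

lemma integrable_unit_square:
  assumes "(\<lambda>(x, y). W x y) \<in> borel_measurable (unit_measure \<Otimes>\<^sub>M unit_measure)"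
    and "\<And>x y. x \<in> {0..1} \<Longrightarrow> y \<in> {0..1} \<Longrightarrow> \<bar>W x y :: real\<bar> \<le> 1"
  shows "integrable (unit_measure \<Otimes>\<^sub>M unit_measure) (\<lambda>(x, y). W x y)"
  using assms
  by (intro unit_pair.integrable_const_bound[where B = 1]) (auto simp: space_pair_measure split_beta)

lemma set_integrable_unit_square:
  assumes "(\<lambda>(x, y). W x y) \<in> borel_measurable (unit_measure \<Otimes>\<^sub>M unit_measure)"
    and "\<And>x y. x \<in> {0..1} \<Longrightarrow> y \<in> {0..1} \<Longrightarrow> \<bar>W x y :: real\<bar> \<le> 1"
    and "S \<in> sets unit_measure" "T \<in> sets unit_measure"
  shows "set_integrable (unit_measure \<Otimes>\<^sub>M unit_measure) (S \<times> T) (\<lambda>(x, y). W x y)"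
  unfolding set_integrable_def
  using integrable_unit_square[OF assms(1,2)] assms(3,4)
  by (intro integrable_mult_indicator) auto

lemma
  assumes meas: "(\<lambda>(x, y). W x y) \<in> borel_measurable (unit_measure \<Otimes>\<^sub>M unit_measure)"
    and bd: "\<And>x y. x \<in> {0..1} \<Longrightarrow> y \<in> {0..1} \<Longrightarrow> \<bar>W x y :: real\<bar> \<le> 1"
  shows abs_integral_le_cut_norm:
      "\<lbrakk>S \<in> sets unit_measure; T \<in> sets unit_measure\<rbrakk> \<Longrightarrow>
         \<bar>LINT (x, y) : S \<times> T | unit_measure \<Otimes>\<^sub>M unit_measure. W x y\<bar> \<le> cut_norm W"
    and cut_norm_nonneg: "cut_norm W \<ge> 0"
proof -
  let ?I = "\<lambda>S T. \<bar>LINT (x, y) : S \<times> T | unit_measure \<Otimes>\<^sub>M unit_measure. W x y\<bar>"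
  have le1: "?I S T \<le> 1" if "S \<in> sets unit_measure" "T \<in> sets unit_measure" for S T
  proof -
    have "?I S T \<le> integral\<^sup>L (unit_measure \<Otimes>\<^sub>M unit_measure) (\<lambda>_. 1)"
      unfolding set_lebesgue_integral_def
      using set_integrable_unit_square[OF meas bd that] unfolding set_integrable_def
      by (intro order_trans[OF integral_abs_bound] integral_mono integrable_abs)
         (auto simp: space_pair_measure indicator_def intro: bd)
    also have "\<dots> = 1" by (simp add: unit_pair.prob_space)
    finally show ?thesis .
  qed
  \<comment> \<open>Boundedness is what makes the real supremum in \<open>cut_norm\<close> dominate
    each of its values.\<close>
  have bdd: "bdd_above ((\<lambda>(S, T). ?I S T) ` (sets unit_measure \<times> sets unit_measure))"
    using le1 by (intro bdd_aboveI[where M = 1]) auto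
  show up: "?I S T \<le> cut_norm W" if "S \<in> sets unit_measure" "T \<in> sets unit_measure" for S T
    unfolding cut_norm_def using cSUP_upper[OF _ bdd, of "(S, T)"] that by auto
  show "cut_norm W \<ge> 0" using up[of "{}" "{}"] by auto
qed

section \<open>Alignments, and the coupling of two graphons aligned with the same estimate\<close>

lemma id_measure_preserving: "(\<lambda>x. x) \<in> measure_preserving_bijections"
  unfolding measure_preserving_bijections_def by (auto simp: bij_betw_def distr_id)

lemma measure_preserving_bijectionsD:
  assumes "\<tau> \<in> measure_preserving_bijections"
  shows "\<tau> \<in> measurable unit_measure unit_measure" "x \<in> {0..1} \<Longrightarrow> \<tau> x \<in> {0..1}"
    "A \<in> sets unit_measure \<Longrightarrow> measure unit_measure (\<tau> -` A \<inter> {0..1}) = measure unit_measure A"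
proof -
  show m: "\<tau> \<in> measurable unit_measure unit_measure" and "x \<in> {0..1} \<Longrightarrow> \<tau> x \<in> {0..1}"
    using assms unfolding measure_preserving_bijections_def bij_betw_def by auto
  have "distr unit_measure unit_measure \<tau> = unit_measure"
    using assms unfolding measure_preserving_bijections_def by auto
  then show "A \<in> sets unit_measure \<Longrightarrow> measure unit_measure (\<tau> -` A \<inter> {0..1}) = measure unit_measure A"
    using measure_distr[OF m, of A] by simp
qed

lemma aligned_difference_bounded:
  assumes f: "f \<in> graphons" and \<rho>: "0 \<le> \<rho>" "\<rho> \<le> 1"
    and \<phi>: "has_block_masses k w \<phi>" and Q: "block_matrix k Q" and \<tau>: "\<tau> \<in> measure_preserving_bijections"
  shows "(\<lambda>(x, y). f x y - \<rho> * block_graphon Q \<phi> (\<tau> x) (\<tau> y))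
            \<in> borel_measurable (unit_measure \<Otimes>\<^sub>M unit_measure)"
    and "(\<lambda>(x, y). \<rho> * block_graphon Q \<phi> (\<tau> x) (\<tau> y)) \<in> borel_measurable (unit_measure \<Otimes>\<^sub>M unit_measure)"
    and "x \<in> {0..1} \<Longrightarrow> y \<in> {0..1} \<Longrightarrow> \<bar>f x y - \<rho> * block_graphon Q \<phi> (\<tau> x) (\<tau> y)\<bar> \<le> 1"
proof -
  have [measurable]: "(\<lambda>x. \<phi> (\<tau> x)) \<in> measurable unit_measure (count_space UNIV)"
    using measure_preserving_bijectionsD(1)[OF \<tau>] \<phi> unfolding has_block_masses_def
    by (auto intro: measurable_compose)
  show 2: "(\<lambda>(x, y). \<rho> * block_graphon Q \<phi> (\<tau> x) (\<tau> y)) \<in> borel_measurable (unit_measure \<Otimes>\<^sub>M unit_measure)"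
    using measurable_block_function[of "\<lambda>x. \<phi> (\<tau> x)" "\<lambda>a b. \<rho> * Q a b"] by (simp add: block_graphon_def)
  have "(\<lambda>(x, y). f x y) \<in> borel_measurable (unit_measure \<Otimes>\<^sub>M unit_measure)"
    using f by (auto simp: graphons_def)
  from borel_measurable_diff[OF this 2]
  show "(\<lambda>(x, y). f x y - \<rho> * block_graphon Q \<phi> (\<tau> x) (\<tau> y))
            \<in> borel_measurable (unit_measure \<Otimes>\<^sub>M unit_measure)" by (simp add: split_beta)
  assume xy: "x \<in> {0..1}" "y \<in> {0..1}"
  have "\<phi> (\<tau> x) \<in> {1..k}" "\<phi> (\<tau> y) \<in> {1..k}"
    using \<phi> measure_preserving_bijectionsD(2)[OF \<tau>] xy unfolding has_block_masses_def by blast+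
  then have "block_graphon Q \<phi> (\<tau> x) (\<tau> y) \<in> {0..1}"
    using Q unfolding block_matrix_def block_graphon_def by blast
  then have "\<rho> * block_graphon Q \<phi> (\<tau> x) (\<tau> y) \<in> {0..1}"
    using \<rho> by (auto intro: mult_le_one)
  moreover have "f x y \<in> {0..1}" using f xy unfolding graphons_def by blast
  ultimately show "\<bar>f x y - \<rho> * block_graphon Q \<phi> (\<tau> x) (\<tau> y)\<bar> \<le> 1" by auto
qed

lemma cut_distance_block_nonneg:
  assumes "f \<in> graphons" "0 \<le> \<rho>" "\<rho> \<le> 1" "has_block_masses k w \<phi>" "block_matrix k Q"
  shows "cut_distance f (\<lambda>x y. \<rho> * block_graphon Q \<phi> x y) \<ge> 0"
  unfolding cut_distance_def using id_measure_preserving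
  by (intro cINF_greatest cut_norm_nonneg aligned_difference_bounded[OF assms]) auto

text \<open>The infimum over alignments need not be attained; a strict inequality is what yields an
  actual alignment.\<close>

lemma cut_distance_less_obtains:
  assumes "f \<in> graphons" "0 \<le> \<rho>" "\<rho> \<le> 1" "has_block_masses k w \<phi>" "block_matrix k Q"
    and "cut_distance f (\<lambda>x y. \<rho> * block_graphon Q \<phi> x y) < s"
  obtains \<tau> where "\<tau> \<in> measure_preserving_bijections"
    "cut_norm (\<lambda>x y. f x y - \<rho> * block_graphon Q \<phi> (\<tau> x) (\<tau> y)) < s"
proof -
  have "\<exists>z \<in> (\<lambda>\<tau>. cut_norm (\<lambda>x y. f x y - \<rho> * block_graphon Q \<phi> (\<tau> x) (\<tau> y))) ` measure_preserving_bijections. z < s"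
    using id_measure_preserving assms(6) unfolding cut_distance_def
    by (intro cInf_lessD) auto
  then show ?thesis using that by blast
qed

text \<open>The coupling records how the blocks overlap after both graphons have been aligned with \<open>f\<close>.\<close>
lemma close_block_graphons_coupling:
  assumes f: "f \<in> graphons" and \<rho>: "0 \<le> \<rho>" "\<rho> \<le> 1"
    and \<phi>: "has_block_masses k w \<phi>" "block_matrix k Q"
    and \<phi>': "has_block_masses k w' \<phi>'" "block_matrix k Q'"
    and d: "cut_distance f (\<lambda>x y. \<rho> * block_graphon Q \<phi> x y) < s"
    and d': "cut_distance f (\<lambda>x y. \<rho> * block_graphon Q' \<phi>' x y) < s'"
  obtains P :: "nat \<times> nat \<Rightarrow> real" where
    "\<And>p. P p \<ge> 0"
    "\<And>a. a \<in> {1..k} \<Longrightarrow> (\<Sum>b\<in>{1..k}. P (a, b)) = w a"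
    "\<And>b. b \<in> {1..k} \<Longrightarrow> (\<Sum>a\<in>{1..k}. P (a, b)) = w' b"
    "\<And>S T. finite S \<Longrightarrow> finite T \<Longrightarrow>
       \<rho> * \<bar>\<Sum>p\<in>S. \<Sum>q\<in>T. P p * P q * (Q (fst p) (fst q) - Q' (snd p) (snd q))\<bar> \<le> s + s'"
proof -
  obtain \<tau> where \<tau>: "\<tau> \<in> measure_preserving_bijections"
    "cut_norm (\<lambda>x y. f x y - \<rho> * block_graphon Q \<phi> (\<tau> x) (\<tau> y)) < s"
    using cut_distance_less_obtains[OF f \<rho> \<phi> d] .
  obtain \<tau>' where \<tau>': "\<tau>' \<in> measure_preserving_bijections"
    "cut_norm (\<lambda>x y. f x y - \<rho> * block_graphon Q' \<phi>' (\<tau>' x) (\<tau>' y)) < s'"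
    using cut_distance_less_obtains[OF f \<rho> \<phi>' d'] .
  define Z where "Z x = (\<phi> (\<tau> x), \<phi>' (\<tau>' x))" for x
  have m: "(\<lambda>x. \<phi> (\<tau> x)) \<in> measurable unit_measure (count_space UNIV)"
          "(\<lambda>x. \<phi>' (\<tau>' x)) \<in> measurable unit_measure (count_space UNIV)"
    using measure_preserving_bijectionsD(1)[OF \<tau>(1)] measure_preserving_bijectionsD(1)[OF \<tau>'(1)]
      \<phi> \<phi>' unfolding has_block_masses_def
    by (auto intro: measurable_compose)
  have Zm: "Z \<in> measurable unit_measure (count_space UNIV)"
  proof -
    have "Z \<in> measurable unit_measure (count_space UNIV \<Otimes>\<^sub>M count_space UNIV)"
      unfolding Z_def using m by (intro measurable_Pair) auto
    then show ?thesis by (simp add: pair_measure_countable)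
  qed
  let ?L = "\<lambda>p. {x\<in>{0..1}. Z x = p}"
  define P where "P p = measure unit_measure (?L p)" for p
  note L = label_set_in_sets(2,1)[OF Zm]
  have rng: "\<phi> (\<tau> x) \<in> {1..k}" "\<phi>' (\<tau>' x) \<in> {1..k}" if "x \<in> {0..1}" for x
    using \<phi>(1) \<phi>'(1) measure_preserving_bijectionsD(2)[OF \<tau>(1) that]
      measure_preserving_bijectionsD(2)[OF \<tau>'(1) that] unfolding has_block_masses_def by blast+
  show ?thesis
  proof
    show "P p \<ge> 0" for p by (simp add: P_def)
    show "(\<Sum>b\<in>{1..k}. P (a, b)) = w a" if "a \<in> {1..k}" for a
    proof -
      have "(\<Sum>b\<in>{1..k}. P (a, b)) = measure unit_measure (\<Union>b\<in>{1..k}. ?L (a, b))"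
        unfolding P_def using L
        by (intro measure_finite_Union[symmetric]) (auto simp: disjoint_family_on_def less_top)
      also have "(\<Union>b\<in>{1..k}. ?L (a, b)) = \<tau> -` {x\<in>{0..1}. \<phi> x = a} \<inter> {0..1}"
        using rng measure_preserving_bijectionsD(2)[OF \<tau>(1)] unfolding Z_def by auto
      also have "measure unit_measure \<dots> = measure unit_measure {x\<in>{0..1}. \<phi> x = a}"
        using \<phi>(1) unfolding has_block_masses_def
        by (intro measure_preserving_bijectionsD(3)[OF \<tau>(1)] label_set_in_sets(2)) auto
      also have "\<dots> = w a" using \<phi>(1) that unfolding has_block_masses_def by auto
      finally show ?thesis .
    qed
    show "(\<Sum>a\<in>{1..k}. P (a, b)) = w' b" if "b \<in> {1..k}" for b
    proof -
      have "(\<Sum>a\<in>{1..k}. P (a, b)) = measure unit_measure (\<Union>a\<in>{1..k}. ?L (a, b))"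
        unfolding P_def using L
        by (intro measure_finite_Union[symmetric]) (auto simp: disjoint_family_on_def less_top)
      also have "(\<Union>a\<in>{1..k}. ?L (a, b)) = \<tau>' -` {x\<in>{0..1}. \<phi>' x = b} \<inter> {0..1}"
        using rng measure_preserving_bijectionsD(2)[OF \<tau>'(1)] unfolding Z_def by auto
      also have "measure unit_measure \<dots> = measure unit_measure {x\<in>{0..1}. \<phi>' x = b}"
        using \<phi>'(1) unfolding has_block_masses_def
        by (intro measure_preserving_bijectionsD(3)[OF \<tau>'(1)] label_set_in_sets(2)) auto
      also have "\<dots> = w' b" using \<phi>'(1) that unfolding has_block_masses_def by auto
      finally show ?thesis .
    qed
    show "\<rho> * \<bar>\<Sum>p\<in>S. \<Sum>q\<in>T. P p * P q * (Q (fst p) (fst q) - Q' (snd p) (snd q))\<bar> \<le> s + s'"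
      if fin: "finite S" "finite T" for S T
    proof -
      let ?S = "{x\<in>{0..1}. Z x \<in> S}" and ?T = "{x\<in>{0..1}. Z x \<in> T}"
      let ?D = "\<lambda>x y. f x y - \<rho> * block_graphon Q \<phi> (\<tau> x) (\<tau> y)"
      let ?D' = "\<lambda>x y. f x y - \<rho> * block_graphon Q' \<phi>' (\<tau>' x) (\<tau>' y)"
      let ?h = "\<lambda>p q. \<rho> * (Q (fst p) (fst q) - Q' (snd p) (snd q))"
      note D = aligned_difference_bounded[OF f \<rho> \<phi> \<tau>(1)]
      note D' = aligned_difference_bounded[OF f \<rho> \<phi>' \<tau>'(1)]
      have i: "\<bar>LINT (x, y) : ?S \<times> ?T | unit_measure \<Otimes>\<^sub>M unit_measure. ?D x y\<bar> \<le> s"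
        using abs_integral_le_cut_norm[OF D(1,3) L(2) L(2), of S T] \<tau>(2) by linarith
      have i': "\<bar>LINT (x, y) : ?S \<times> ?T | unit_measure \<Otimes>\<^sub>M unit_measure. ?D' x y\<bar> \<le> s'"
        using abs_integral_le_cut_norm[OF D'(1,3) L(2) L(2), of S T] \<tau>'(2) by linarith
      \<comment> \<open>Subtracting the two aligned differences cancels \<open>f\<close>; what
        remains is a function of the pair labels and integrates to a finite sum.\<close>
      have "(LINT (x, y) : ?S \<times> ?T | unit_measure \<Otimes>\<^sub>M unit_measure. ?h (Z x) (Z y))
          = (LINT v : ?S \<times> ?T | unit_measure \<Otimes>\<^sub>M unit_measure. (case v of (x, y) \<Rightarrow> ?D' x y) - (case v of (x, y) \<Rightarrow> ?D x y))"
        by (intro arg_cong[where f = "set_lebesgue_integral _ _"])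
           (auto simp: Z_def block_graphon_def algebra_simps)
      also have "\<dots> = (LINT (x, y) : ?S \<times> ?T | unit_measure \<Otimes>\<^sub>M unit_measure. ?D' x y)
                     - (LINT (x, y) : ?S \<times> ?T | unit_measure \<Otimes>\<^sub>M unit_measure. ?D x y)"
        by (intro set_integral_diff set_integrable_unit_square D D' L)
      finally have "\<bar>LINT (x, y) : ?S \<times> ?T | unit_measure \<Otimes>\<^sub>M unit_measure. ?h (Z x) (Z y)\<bar> \<le> s + s'"
        using i i' by linarith
      also have "(LINT (x, y) : ?S \<times> ?T | unit_measure \<Otimes>\<^sub>M unit_measure. ?h (Z x) (Z y))
          = (\<Sum>p\<in>S. \<Sum>q\<in>T. P p * P q * ?h p q)"
        unfolding P_def by (rule finite_label_integral[OF Zm fin])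
      also have "\<dots> = \<rho> * (\<Sum>p\<in>S. \<Sum>q\<in>T. P p * P q * (Q (fst p) (fst q) - Q' (snd p) (snd q)))"
        by (simp add: sum_distrib_left mult_ac)
      finally show ?thesis using \<rho> by (simp add: abs_mult)
    qed
  qed
qed

subsection \<open>The random graph of a block graphon\<close>

definition edge_set :: "nat \<Rightarrow> (nat \<times> nat) set" where
  "edge_set n = {(i, j). 1 \<le> i \<and> i < j \<and> j \<le> n}"

text \<open>The graph before symmetrization: a product measure, so that likelihoods factor over the
  pairs \<open>i < j\<close>.\<close>

definition edge_pmf :: "nat \<Rightarrow> (nat \<Rightarrow> nat \<Rightarrow> real) \<Rightarrow> (nat \<times> nat \<Rightarrow> bool) pmf" where
  "edge_pmf n \<Theta> = Pi_pmf (edge_set n) False (\<lambda>(i, j). bernoulli_pmf (\<Theta> i j))"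

definition edge_adjacency :: "(nat \<times> nat \<Rightarrow> bool) \<Rightarrow> nat \<Rightarrow> nat \<Rightarrow> nat" where
  "edge_adjacency e i j = of_bool (i \<noteq> j \<and> e (min i j, max i j))"

lemma adjacency_pmf_edges: "adjacency_pmf n \<Theta> = map_pmf edge_adjacency (edge_pmf n \<Theta>)"
  unfolding adjacency_pmf_def edge_pmf_def edge_set_def edge_adjacency_def[abs_def] ..

lemma finite_edge_set [simp]: "finite (edge_set n)"
  by (rule finite_subset[of _ "{1..n} \<times> {1..n}"]) (auto simp: edge_set_def)

lemma edge_pmf_cong:
  assumes "\<And>i j. (i, j) \<in> edge_set n \<Longrightarrow> \<Theta> i j = \<Theta>' i j"
  shows "edge_pmf n \<Theta> = edge_pmf n \<Theta>'"
  unfolding edge_pmf_def using assms by (intro Pi_pmf_cong) auto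

lemma set_edge_pmf_subset: "set_pmf (edge_pmf n \<Theta>) \<subseteq> PiE_dflt (edge_set n) False (\<lambda>_. UNIV)"
  using set_Pi_pmf_subset[of "edge_set n" False "\<lambda>(i, j). bernoulli_pmf (\<Theta> i j)"]
  unfolding edge_pmf_def PiE_dflt_def by auto

lemma finite_set_edge_pmf: "finite (set_pmf (edge_pmf n \<Theta>))"
  by (rule finite_subset[OF set_edge_pmf_subset]) auto

lemma edge_adjacency_in_adjacency_matrices:
  assumes "e \<in> PiE_dflt (edge_set n) False (\<lambda>_. UNIV)"
  shows "edge_adjacency e \<in> adjacency_matrices n"
proof -
  have e: "\<not> e (i, j)" if "(i, j) \<notin> edge_set n" for i j
    using assms that unfolding PiE_dflt_def by auto
  have "\<not> e (min i j, max i j)" if "i \<notin> {1..n} \<or> j \<notin> {1..n}" "i \<noteq> j" for i j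
    using that by (intro e) (auto simp: edge_set_def min_def max_def split: if_splits)
  then show ?thesis
    unfolding adjacency_matrices_def edge_adjacency_def by (auto simp: min.commute max.commute)
qed

text \<open>No case for the diagonal is made, unlike in \<open>edge_probs\<close>: the law of the
  edges only reads pairs \<open>i < j\<close>.\<close>

definition block_probs :: "real \<Rightarrow> (nat \<Rightarrow> nat \<Rightarrow> real) \<Rightarrow> (nat \<Rightarrow> nat) \<Rightarrow> nat \<Rightarrow> nat \<Rightarrow> real" where
  "block_probs \<rho> Q z i j = \<rho> * Q (z i) (z j)"

text \<open>Given the labels of the \<xi>'s the law of the graph is fixed, so the integral over the
  cube is a finite mixture over label vectors with product weights. All later probability is
  finite.\<close>

lemma graphon_expectation_block:
  assumes \<phi>: "has_block_masses k w \<phi>"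
  shows "graphon_expectation n \<rho> (block_graphon Q \<phi>) g
     = (\<Sum>z\<in>PiE {1..n} (\<lambda>_. {1..k}). (\<Prod>i\<in>{1..n}. w (z i)) *
          measure_pmf.expectation (edge_pmf n (block_probs \<rho> Q z)) (\<lambda>e. g (edge_adjacency e)))"
proof -
  interpret unit_power: finite_product_prob_space "\<lambda>_. unit_measure" "{1..n}"
    by standard auto
  let ?M = "Pi\<^sub>M {1..n} (\<lambda>_. unit_measure)"
  let ?Z = "PiE {1..n} (\<lambda>_. {1..k})"
  let ?h = "\<lambda>z. measure_pmf.expectation (edge_pmf n (block_probs \<rho> Q z)) (\<lambda>e. g (edge_adjacency e))"
  let ?B = "\<lambda>z. PiE {1..n} (\<lambda>i. {x\<in>{0..1}. \<phi> x = z i})"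
  have finZ: "finite ?Z" by (intro finite_PiE) auto
  have \<phi>m: "\<phi> \<in> measurable unit_measure (count_space UNIV)" and rng: "\<And>x. x \<in> {0..1} \<Longrightarrow> \<phi> x \<in> {1..k}"
    using \<phi> unfolding has_block_masses_def by auto
  have L: "{x\<in>{0..1}. \<phi> x = a} \<in> sets unit_measure" for a
  proof -
    have "\<phi> -` {a} \<inter> space unit_measure = {x\<in>{0..1}. \<phi> x = a}" by auto
    then show ?thesis using measurable_sets[OF \<phi>m, of "{a}"] by simp
  qed
  have B: "?B z \<in> sets ?M" for z using L by (intro sets_PiM_I_finite) auto
  have pw: "measure_pmf.expectation (adjacency_pmf n (edge_probs \<rho> (block_graphon Q \<phi>) \<xi>)) g
      = (\<Sum>z\<in>?Z. ?h z * indicator (?B z) \<xi>)" if "\<xi> \<in> space ?M" for \<xi>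
  proof -
    have \<xi>: "\<xi> \<in> PiE {1..n} (\<lambda>_. {0..1})" using that by (simp add: space_PiM)
    define z0 where "z0 = restrict (\<lambda>i. \<phi> (\<xi> i)) {1..n}"
    have z0: "z0 \<in> ?Z" unfolding z0_def using \<xi> rng by (intro restrict_PiE_iff[THEN iffD2]) (auto simp: PiE_def Pi_def)
    have iff: "\<xi> \<in> ?B z \<longleftrightarrow> z = z0" if "z \<in> ?Z" for z
    proof
      assume "\<xi> \<in> ?B z"
      then have "z i = z0 i" if "i \<in> {1..n}" for i using that by (auto simp: z0_def PiE_def Pi_def)
      then show "z = z0" using PiE_ext[OF \<open>z \<in> ?Z\<close> z0] by blast
    next
      assume "z = z0"
      then show "\<xi> \<in> ?B z" using \<xi> unfolding z0_def PiE_def Pi_def by auto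
    qed
    have "(\<Sum>z\<in>?Z. ?h z * indicator (?B z) \<xi>) = (\<Sum>z\<in>?Z. if z = z0 then ?h z else 0)"
      using iff by (intro sum.cong refl) (simp add: indicator_def)
    also have "\<dots> = ?h z0" using finZ z0 by simp
    also have "edge_pmf n (block_probs \<rho> Q z0) = edge_pmf n (edge_probs \<rho> (block_graphon Q \<phi>) \<xi>)"
      by (intro edge_pmf_cong)
         (auto simp: block_probs_def edge_probs_def block_graphon_def z0_def edge_set_def)
    finally show ?thesis by (simp add: adjacency_pmf_edges)
  qed
  have int: "integrable ?M (\<lambda>\<xi>. ?h z * indicator (?B z) \<xi>)" for z
    using B unit_power.emeasure_finite
    by (intro integrable_mult_right integrable_real_indicator) (simp_all add: less_top[symmetric] del: One_nat_def)
  have one: "integral\<^sup>L ?M (\<lambda>\<xi>. ?h z * indicator (?B z) \<xi>) = (\<Prod>i\<in>{1..n}. w (z i)) * ?h z" if z: "z \<in> ?Z" for z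
  proof -
    have "?B z \<inter> space ?M = ?B z" using sets.sets_into_space[OF B[of z]] by blast
    then have "integral\<^sup>L ?M (\<lambda>\<xi>. ?h z * indicator (?B z) \<xi>) = ?h z * measure ?M (?B z)" by simp
    also have "measure ?M (?B z) = (\<Prod>i\<in>{1..n}. measure unit_measure {x\<in>{0..1}. \<phi> x = z i})"
      using L by (intro unit_power.prob_times) auto
    also have "\<dots> = (\<Prod>i\<in>{1..n}. w (z i))"
      using \<phi> z unfolding has_block_masses_def by (intro prod.cong) (auto simp: PiE_def Pi_def)
    finally show ?thesis by simp
  qed
  have "graphon_expectation n \<rho> (block_graphon Q \<phi>) g = integral\<^sup>L ?M (\<lambda>\<xi>. \<Sum>z\<in>?Z. ?h z * indicator (?B z) \<xi>)"
    unfolding graphon_expectation_def by (intro Bochner_Integration.integral_cong pw refl)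
  also have "\<dots> = (\<Sum>z\<in>?Z. integral\<^sup>L ?M (\<lambda>\<xi>. ?h z * indicator (?B z) \<xi>))"
    by (intro Bochner_Integration.integral_sum int)
  also have "\<dots> = (\<Sum>z\<in>?Z. (\<Prod>i\<in>{1..n}. w (z i)) * ?h z)"
    by (intro sum.cong refl one)
  finally show ?thesis .
qed

lemma sum_PiE_prod:
  fixes w :: "nat \<Rightarrow> real"
  shows "(\<Sum>z\<in>PiE {1..n::nat} (\<lambda>_. {1..k}). \<Prod>i\<in>{1..n}. w (z i)) = (\<Sum>a\<in>{1..k}. w a) ^ n"
  using prod.distrib prod_sum_PiE[of "{1..n}" "\<lambda>_. {1..k}" "\<lambda>_. w"] by simp

subsection \<open>Two blocks\<close>

definition block_sign :: "nat \<Rightarrow> real" where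
  "block_sign a = (if a = 1 then 1 else -1)"

text \<open>Termwise comparison of the power series, from
  \<open>2^n * fact n \<le> fact (2 * n)\<close>.\<close>

lemma cosh_le_exp_square: "exp y + exp (- y) \<le> 2 * exp (y ^ 2 / 2)" for y :: real
proof -
  have "(\<lambda>n. if even n then y ^ n /\<^sub>R fact n else 0) sums cosh y" by (rule cosh_converges)
  moreover have "(if even n then y ^ n /\<^sub>R fact n else 0) = 0" if "n \<notin> range (\<lambda>n. 2 * n)" for n
    using that by (auto elim!: evenE)
  ultimately have c: "(\<lambda>n. y ^ (2 * n) /\<^sub>R fact (2 * n)) sums cosh y"
    using sums_mono_reindex[of "\<lambda>n. 2 * n" "\<lambda>n. if even n then y ^ n /\<^sub>R fact n else 0" "cosh y"]
    by (simp add: strict_mono_def)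
  have "y ^ (2 * n) /\<^sub>R fact (2 * n) \<le> (y ^ 2 / 2) ^ n /\<^sub>R fact n" for n
  proof -
    have "2 ^ n * fact n \<le> (fact (2 * n) :: real)"
    proof (induction n)
      case (Suc n)
      have "2 ^ Suc n * fact (Suc n) = (2 * (real n + 1)) * (2 ^ n * fact n)" by (simp add: algebra_simps)
      also have "\<dots> \<le> ((2 * real n + 2) * (2 * real n + 1)) * fact (2 * n)"
        using Suc by (intro mult_mono) (auto simp: algebra_simps)
      also have "\<dots> = fact (2 * Suc n)" by (simp add: algebra_simps)
      finally show ?case .
    qed simp
    then have "y ^ (2 * n) / fact (2 * n) \<le> y ^ (2 * n) / (2 ^ n * fact n)"
      by (intro divide_left_mono) auto
    moreover have "(y ^ 2 / 2) ^ n /\<^sub>R fact n = y ^ (2 * n) / (2 ^ n * fact n)"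
      unfolding power_mult power_divide by (simp add: divide_inverse)
    moreover have "y ^ (2 * n) /\<^sub>R fact (2 * n) = y ^ (2 * n) / fact (2 * n)" by (simp add: divide_inverse)
    ultimately show ?thesis by simp
  qed
  from sums_le[OF this c exp_converges] have "cosh y \<le> exp (y ^ 2 / 2)" .
  then show ?thesis by (simp add: cosh_def field_simps)
qed

lemma sum_PiE_insert:
  assumes "finite I" "a \<notin> I"
  shows "(\<Sum>z\<in>PiE (insert a I) B. f z) = (\<Sum>z\<in>PiE I B. \<Sum>y\<in>B a. f (z(a := y)))"
  unfolding PiE_insert_eq sum.reindex[OF inj_combinator[OF assms(2)]]
  by (subst sum.swap) (simp add: sum.cartesian_product split_beta)

text \<open>Adding one sign turns \<open>l\<close> into at most \<open>l + 2 l\<^sup>2\<close>, by \<open>cosh y \<le> exp (y\<^sup>2 / 2)\<close>;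
  the budget \<open>\<mu>\<close> dominates all the values of \<open>l\<close> met along the way.\<close>
lemma sum_exp_sign_sum_square:
  assumes "finite I" "\<And>i. i \<in> I \<Longrightarrow> x i = 1 \<or> x i = -1" "0 \<le> l" "l + 2 * real (card I) * \<mu> ^ 2 \<le> \<mu>"
  shows "(\<Sum>z\<in>PiE I (\<lambda>_. {1..2}). exp (l * (\<Sum>i\<in>I. x i * block_sign (z i)) ^ 2))
           \<le> 2 ^ card I * exp (real (card I) * \<mu>)"
  using assms
proof (induction I arbitrary: l)
  case (insert a I)
  have l: "l \<le> \<mu>" using insert.prems(3)
    by (smt (verit) mult_nonneg_nonneg of_nat_0_le_iff zero_le_power2)
  have l2: "l ^ 2 \<le> \<mu> ^ 2" using l insert.prems by (intro power_mono) auto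
  have IH: "(\<Sum>z\<in>PiE I (\<lambda>_. {1..2}). exp ((l + 2 * l ^ 2) * (\<Sum>i\<in>I. x i * block_sign (z i)) ^ 2))
           \<le> 2 ^ card I * exp (real (card I) * \<mu>)"
    using insert.prems insert.hyps l2 by (intro insert.IH) (auto simp: algebra_simps)
  have step: "(\<Sum>y\<in>{1..2}. exp (l * (\<Sum>i\<in>insert a I. x i * block_sign ((z(a := y)) i)) ^ 2))
      \<le> 2 * exp \<mu> * exp ((l + 2 * l ^ 2) * (\<Sum>i\<in>I. x i * block_sign (z i)) ^ 2)" for z
  proof -
    let ?S = "\<Sum>i\<in>I. x i * block_sign (z i)"
    have S: "(\<Sum>i\<in>insert a I. x i * block_sign ((z(a := y)) i)) = x a * block_sign y + ?S" for y
      using insert.hyps by (subst sum.insert) (auto intro!: sum.cong)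
    have two: "{1..2::nat} = {1, 2}" by auto
    have "(\<Sum>y\<in>{1..2}. exp (l * (\<Sum>i\<in>insert a I. x i * block_sign ((z(a := y)) i)) ^ 2))
        = exp (l * (1 + ?S) ^ 2) + exp (l * (-1 + ?S) ^ 2)"
    proof -
      have "x a = 1 \<or> x a = -1" using insert.prems(1)[of a] by simp
      moreover have "block_sign 1 = 1" "block_sign 2 = -1" by (simp_all add: block_sign_def)
      ultimately show ?thesis unfolding S two by (elim disjE) (simp_all add: add.commute)
    qed
    also have "\<dots> = exp (l + l * ?S ^ 2) * (exp (2 * l * ?S) + exp (- (2 * l * ?S)))"
      by (simp add: power2_eq_square algebra_simps flip: exp_add)
    also have "\<dots> \<le> exp (l + l * ?S ^ 2) * (2 * exp ((2 * l * ?S) ^ 2 / 2))"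
      by (intro mult_left_mono cosh_le_exp_square) auto
    also have "\<dots> = 2 * exp l * exp ((l + 2 * l ^ 2) * ?S ^ 2)"
      by (simp add: power2_eq_square algebra_simps flip: exp_add)
    also have "\<dots> \<le> 2 * exp \<mu> * exp ((l + 2 * l ^ 2) * ?S ^ 2)" using l by simp
    finally show ?thesis .
  qed
  have "(\<Sum>z\<in>PiE (insert a I) (\<lambda>_. {1..2}). exp (l * (\<Sum>i\<in>insert a I. x i * block_sign (z i)) ^ 2))
     = (\<Sum>z\<in>PiE I (\<lambda>_. {1..2}). \<Sum>y\<in>{1..2}. exp (l * (\<Sum>i\<in>insert a I. x i * block_sign ((z(a := y)) i)) ^ 2))"
    by (rule sum_PiE_insert[OF insert.hyps])
  also have "\<dots> \<le> (\<Sum>z\<in>PiE I (\<lambda>_. {1..2}). 2 * exp \<mu> * exp ((l + 2 * l ^ 2) * (\<Sum>i\<in>I. x i * block_sign (z i)) ^ 2))"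
    by (intro sum_mono step)
  also have "\<dots> \<le> 2 * exp \<mu> * (2 ^ card I * exp (real (card I) * \<mu>))"
    unfolding sum_distrib_left[symmetric] by (intro mult_left_mono IH) auto
  also have "\<dots> = 2 ^ card (insert a I) * exp (real (card (insert a I)) * \<mu>)"
    using insert.hyps by (simp add: algebra_simps exp_add)
  finally show ?case .
qed simp

lemma sum_edge_set:
  "(\<Sum>(i, j)\<in>edge_set n. t i * t j) = ((\<Sum>i\<in>{1..n}. t i) ^ 2 - (\<Sum>i\<in>{1..n}. t i ^ 2)) / (2 :: real)"
proof (induction n)
  case 0
  then show ?case by (auto simp: edge_set_def intro!: sum.neutral)
next
  case (Suc n)
  have e: "edge_set (Suc n) = edge_set n \<union> (\<lambda>i. (i, Suc n)) ` {1..n}"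
    by (auto simp: edge_set_def)
  have "(\<Sum>(i, j)\<in>edge_set (Suc n). t i * t j)
      = (\<Sum>(i, j)\<in>edge_set n. t i * t j) + (\<Sum>(i, j)\<in>(\<lambda>i. (i, Suc n)) ` {1..n}. t i * t j)"
    unfolding e by (intro sum.union_disjoint finite_edge_set) (auto simp: edge_set_def)
  also have "(\<Sum>(i, j)\<in>(\<lambda>i. (i, Suc n)) ` {1..n}. t i * t j) = (\<Sum>i\<in>{1..n}. t i) * t (Suc n)"
    by (subst sum.reindex) (auto simp: inj_on_def sum_distrib_right)
  finally show ?case by (simp add: Suc.IH power2_eq_square field_simps)
qed

section \<open>Likelihood ratios against the homogeneous random graph\<close>

lemma integrable_edge_pmf [simp]: "integrable (measure_pmf (edge_pmf n \<Theta>)) (g :: _ \<Rightarrow> real)"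
  by (intro integrable_measure_pmf_finite finite_set_edge_pmf)

definition likelihood_ratio ::
  "nat \<Rightarrow> real \<Rightarrow> (nat \<Rightarrow> nat \<Rightarrow> real) \<Rightarrow> (nat \<times> nat \<Rightarrow> bool) \<Rightarrow> real" where
  "likelihood_ratio n \<theta> \<Theta> e =
     (\<Prod>(i, j)\<in>edge_set n. if e (i, j) then \<Theta> i j / \<theta> else (1 - \<Theta> i j) / (1 - \<theta>))"

lemma likelihood_ratio_nonneg:
  assumes "0 < \<theta>" "\<theta> < 1" "\<And>i j. (i, j) \<in> edge_set n \<Longrightarrow> \<Theta> i j \<in> {0..1}"
  shows "likelihood_ratio n \<theta> \<Theta> e \<ge> 0"
  unfolding likelihood_ratio_def using assms by (intro prod_nonneg) auto

lemma expectation_likelihood_ratio: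
  assumes \<theta>: "0 < \<theta>" "\<theta> < 1" and \<Theta>: "\<And>i j. (i, j) \<in> edge_set n \<Longrightarrow> \<Theta> i j \<in> {0..1}"
  shows "measure_pmf.expectation (edge_pmf n \<Theta>) g
       = measure_pmf.expectation (edge_pmf n (\<lambda>_ _. \<theta>)) (\<lambda>e. likelihood_ratio n \<theta> \<Theta> e * g e)"
proof -
  let ?E = "PiE_dflt (edge_set n) False (\<lambda>_. UNIV :: bool set)"
  have fin: "finite ?E" by auto
  have "pmf (edge_pmf n \<Theta>) e = pmf (edge_pmf n (\<lambda>_ _. \<theta>)) e * likelihood_ratio n \<theta> \<Theta> e" if "e \<in> ?E" for e
  proof -
    have out: "\<And>x. x \<notin> edge_set n \<Longrightarrow> e x = False" using that by (auto simp: PiE_dflt_def)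
    show ?thesis
      unfolding edge_pmf_def likelihood_ratio_def
      by (subst (1 2) pmf_Pi'; (rule finite_edge_set out)?)
         (use \<theta> \<Theta> in \<open>auto simp: split_beta prod.distrib[symmetric] intro!: prod.cong\<close>)
  qed
  then show ?thesis
    using set_edge_pmf_subset
    by (subst (1 2) integral_measure_pmf[OF fin]) (auto intro!: sum.cong)
qed

text \<open>By independence the expectation factors over the edges. These products are the cross
  terms in the second moment of a mixture of likelihoods.\<close>

lemma expectation_likelihood_ratio_product:
  assumes \<theta>: "0 < \<theta>" "\<theta> < 1"
    and \<Theta>: "\<And>i j. (i, j) \<in> edge_set n \<Longrightarrow> \<Theta> i j \<in> {0..1}" "\<And>i j. (i, j) \<in> edge_set n \<Longrightarrow> \<Theta>' i j \<in> {0..1}"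
  shows "measure_pmf.expectation (edge_pmf n (\<lambda>_ _. \<theta>)) (\<lambda>e. likelihood_ratio n \<theta> \<Theta> e * likelihood_ratio n \<theta> \<Theta>' e)
       = (\<Prod>(i, j)\<in>edge_set n. 1 + (\<Theta> i j - \<theta>) * (\<Theta>' i j - \<theta>) / (\<theta> * (1 - \<theta>)))"
proof -
  let ?r = "\<lambda>x b. (if b then \<Theta> (fst x) (snd x) / \<theta> else (1 - \<Theta> (fst x) (snd x)) / (1 - \<theta>))
                 * (if b then \<Theta>' (fst x) (snd x) / \<theta> else (1 - \<Theta>' (fst x) (snd x)) / (1 - \<theta>))"
  have "measure_pmf.expectation (edge_pmf n (\<lambda>_ _. \<theta>)) (\<lambda>e. likelihood_ratio n \<theta> \<Theta> e * likelihood_ratio n \<theta> \<Theta>' e)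
      = measure_pmf.expectation (Pi_pmf (edge_set n) False (\<lambda>_. bernoulli_pmf \<theta>)) (\<lambda>e. \<Prod>x\<in>edge_set n. ?r x (e x))"
    by (simp only: edge_pmf_def likelihood_ratio_def case_prod_beta' prod.distrib prod.collapse)
  also have "\<dots> = (\<Prod>x\<in>edge_set n. measure_pmf.expectation (bernoulli_pmf \<theta>) (?r x))"
  proof (rule expectation_prod_Pi_pmf)
    show "integrable (measure_pmf (bernoulli_pmf \<theta>)) (?r x)" for x
      by (rule integrable_measure_pmf_finite) simp
    show "0 \<le> ?r x b" if "x \<in> edge_set n" for x b
      using \<theta> \<Theta>[of "fst x" "snd x"] that by simp
  qed simp
  also have "\<dots> = (\<Prod>(i, j)\<in>edge_set n. 1 + (\<Theta> i j - \<theta>) * (\<Theta>' i j - \<theta>) / (\<theta> * (1 - \<theta>)))"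
  proof (intro prod.cong refl, clarify)
    fix i j
    have "\<theta> * (\<Theta> i j / \<theta> * (\<Theta>' i j / \<theta>)) + (1 - \<theta>) * ((1 - \<Theta> i j) / (1 - \<theta>) * ((1 - \<Theta>' i j) / (1 - \<theta>)))
        = \<Theta> i j * \<Theta>' i j / \<theta> + (1 - \<Theta> i j) * (1 - \<Theta>' i j) / (1 - \<theta>)"
      using \<theta> by simp
    also have "\<dots> = 1 + (\<Theta> i j - \<theta>) * (\<Theta>' i j - \<theta>) / (\<theta> * (1 - \<theta>))"
      using \<theta> by (simp add: divide_simps) (simp add: algebra_simps)
    finally show "measure_pmf.expectation (bernoulli_pmf \<theta>) (?r (i, j)) = 1 + (\<Theta> i j - \<theta>) * (\<Theta>' i j - \<theta>) / (\<theta> * (1 - \<theta>))"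
      using \<theta> by simp
  qed
  finally show ?thesis .
qed

text \<open>The squared mixture is expanded over pairs of label vectors. A pair matters only through
  the signs \<open>t i\<close> that record agreement of the two labels, and the sum of
  \<open>t i * t j\<close> over edges is at most half the square of the sum of the
  \<open>t i\<close>, to which \<open>sum_exp_sign_sum_square\<close> applies.\<close>

lemma two_block_chi_square:
  assumes n: "1 \<le> n" and \<theta>: "0 < \<theta>" "\<theta> \<le> 1/2" and \<epsilon>: "0 \<le> \<epsilon>" "\<epsilon> \<le> 1" "8 * real n * \<theta> * \<epsilon> ^ 2 \<le> 1"
  defines "\<Theta> \<equiv> \<lambda>z i j. \<theta> * (1 + \<epsilon> * (block_sign (z i) * block_sign (z j)))"
  shows "measure_pmf.expectation (edge_pmf n (\<lambda>_ _. \<theta>))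
           (\<lambda>e. (\<Sum>z\<in>PiE {1..n} (\<lambda>_. {1..2}). likelihood_ratio n \<theta> (\<Theta> z) e / 2 ^ n) ^ 2) \<le> 3 / 2"
proof -
  let ?Z = "PiE {1..n} (\<lambda>_. {1..2::nat})"
  let ?E = "measure_pmf.expectation (edge_pmf n (\<lambda>_ _. \<theta>))"
  let ?L = "\<lambda>z. likelihood_ratio n \<theta> (\<Theta> z)"
  define l where "l = \<theta> * \<epsilon> ^ 2 / (1 - \<theta>)"
  have \<theta>': "\<theta> < 1" using \<theta> by simp
  have s: "block_sign a = 1 \<or> block_sign a = -1" for a by (auto simp: block_sign_def)
  have \<Theta>: "\<Theta> z i j \<in> {0..1}" for z i j
  proof -
    have "block_sign (z i) * block_sign (z j) \<in> {-1, 1}" using s[of "z i"] s[of "z j"] by auto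
    then have "1 + \<epsilon> * (block_sign (z i) * block_sign (z j)) \<in> {0..2}" using \<epsilon> by auto
    then have "0 \<le> \<Theta> z i j" "\<Theta> z i j \<le> \<theta> * 2" unfolding \<Theta>_def using \<theta>
      by (auto intro!: mult_nonneg_nonneg mult_left_mono simp del: mult_le_cancel_left_pos)
    then show ?thesis using \<theta> by auto
  qed
  have l0: "0 \<le> l" unfolding l_def using \<theta> by auto
  have l1: "l \<le> 1 / (4 * real n)"
  proof -
    have "l \<le> \<theta> * \<epsilon> ^ 2 / (1/2)" unfolding l_def using \<theta> by (intro divide_left_mono) auto
    also have "\<dots> \<le> 1 / (4 * real n)" using \<epsilon>(3) n by (simp add: field_simps)
    finally show ?thesis .
  qed
  have l2: "l \<le> 1"
  proof -
    have "1 / (4 * real n) \<le> 1" using n by simp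
    then show ?thesis using l1 by linarith
  qed
  have pair: "?E (\<lambda>e. ?L z e * ?L z' e) \<le> exp (l / 2 * (\<Sum>i\<in>{1..n}. block_sign (z' i) * block_sign (z i)) ^ 2)" for z z'
  proof -
    define t where "t i = block_sign (z' i) * block_sign (z i)" for i
    have t: "t i = 1 \<or> t i = -1" for i unfolding t_def using s[of "z i"] s[of "z' i"] by auto
    have tt: "t i * t j = 1 \<or> t i * t j = -1" for i j using t[of i] t[of j] by auto
    have "?E (\<lambda>e. ?L z e * ?L z' e)
        = (\<Prod>(i, j)\<in>edge_set n. 1 + (\<Theta> z i j - \<theta>) * (\<Theta> z' i j - \<theta>) / (\<theta> * (1 - \<theta>)))"
      by (rule expectation_likelihood_ratio_product[OF \<theta>(1) \<theta>' \<Theta> \<Theta>])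
    also have "\<dots> = (\<Prod>(i, j)\<in>edge_set n. 1 + l * (t i * t j))"
    proof (intro prod.cong refl, clarify)
      fix i j
      have "(\<Theta> z i j - \<theta>) * (\<Theta> z' i j - \<theta>) = \<theta> * (\<theta> * \<epsilon> ^ 2 * (t i * t j))"
        unfolding \<Theta>_def t_def by (simp add: power2_eq_square algebra_simps)
      then show "1 + (\<Theta> z i j - \<theta>) * (\<Theta> z' i j - \<theta>) / (\<theta> * (1 - \<theta>)) = 1 + l * (t i * t j)"
        using \<theta> by (simp add: l_def)
    qed
    also have "\<dots> \<le> (\<Prod>(i, j)\<in>edge_set n. exp (l * (t i * t j)))"
    proof (intro prod_mono, clarify)
      fix i j
      have "-1 \<le> l * (t i * t j)" using tt[of i j] l0 l2 by auto
      then show "0 \<le> 1 + l * (t i * t j) \<and> 1 + l * (t i * t j) \<le> exp (l * (t i * t j))"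
        using exp_ge_add_one_self[of "l * (t i * t j)"] by simp
    qed
    also have "\<dots> = exp (l * (\<Sum>(i, j)\<in>edge_set n. t i * t j))"
      by (simp add: exp_sum[symmetric] split_beta sum_distrib_left)
    also have "\<dots> \<le> exp (l / 2 * (\<Sum>i\<in>{1..n}. t i) ^ 2)"
      using l0 by (simp add: sum_edge_set mult_left_mono sum_nonneg field_simps)
    finally show ?thesis by (simp add: t_def)
  qed
  have row: "(\<Sum>z'\<in>?Z. exp (l / 2 * (\<Sum>i\<in>{1..n}. block_sign (z' i) * block_sign (z i)) ^ 2)) \<le> 2 ^ n * (3 / 2)" for z
  proof -
    \<comment> \<open>The budget \<open>\<mu> = 1 / (4 * n)\<close> is used up by two shares of
      \<open>1 / (8 * n)\<close>, and leaves the factor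
      \<open>exp (n * \<mu>) = exp (1 / 4)\<close>.\<close>
    have "l / 2 + 2 * real (card {1..n}) * (1 / (4 * real n)) ^ 2 \<le> 1 / (4 * real n)"
      using l1 n by (simp add: field_simps power2_eq_square)
    then have "(\<Sum>z'\<in>?Z. exp (l / 2 * (\<Sum>i\<in>{1..n}. block_sign (z i) * block_sign (z' i)) ^ 2))
        \<le> 2 ^ card {1..n} * exp (real (card {1..n}) * (1 / (4 * real n)))"
      using l0 s by (intro sum_exp_sign_sum_square) auto
    also have "\<dots> = 2 ^ n * exp (1 / 4)" using n by simp
    also have "exp (1 / 4 :: real) \<le> 3 / 2"
    proof (rule power_le_imp_le_base[of _ 3])
      have "exp (1 / 4 :: real) ^ Suc 3 = exp 1" by (simp add: exp_of_nat_mult[symmetric])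
      also have "\<dots> \<le> (3 / 2) ^ Suc 3" using exp_le by (simp add: power_numeral_reduce)
      finally show "exp (1 / 4 :: real) ^ Suc 3 \<le> (3 / 2) ^ Suc 3" .
    qed simp
    finally show ?thesis by (simp add: mult.commute)
  qed
  have "?E (\<lambda>e. (\<Sum>z\<in>?Z. ?L z e / 2 ^ n) ^ 2)
      = ?E (\<lambda>e. \<Sum>z\<in>?Z. \<Sum>z'\<in>?Z. ?L z e * ?L z' e / 4 ^ n)"
  proof -
    have "2 ^ n * 2 ^ n = (4 ^ n :: real)" by (simp flip: power_mult_distrib)
    then show ?thesis by (simp add: power2_eq_square sum_product)
  qed
  also have "\<dots> = (\<Sum>z\<in>?Z. \<Sum>z'\<in>?Z. ?E (\<lambda>e. ?L z e * ?L z' e) / 4 ^ n)"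
    by (simp add: Bochner_Integration.integral_sum)
  also have "\<dots> \<le> (\<Sum>z\<in>?Z. \<Sum>z'\<in>?Z. exp (l / 2 * (\<Sum>i\<in>{1..n}. block_sign (z' i) * block_sign (z i)) ^ 2) / 4 ^ n)"
    by (intro sum_mono divide_right_mono pair) auto
  also have "\<dots> \<le> (\<Sum>z\<in>?Z. 2 ^ n * (3 / 2) / 4 ^ n)"
    unfolding sum_divide_distrib[symmetric] by (intro divide_right_mono sum_mono row) auto
  also have "\<dots> = 3 / 2"
  proof -
    have "2 ^ n * 2 ^ n = (4 ^ n :: real)" by (simp flip: power_mult_distrib)
    then show ?thesis by (simp add: card_PiE field_simps)
  qed
  finally show ?thesis .
qed

text \<open>Le Cam's method for two hypotheses, where the alternative is a mixture over the hidden
  labels and the null hypothesis is the homogeneous graph itself.\<close>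

lemma two_block_lower_bound:
  assumes k: "2 \<le> k" and n: "1 \<le> n" and \<rho>: "0 < \<rho>" "\<rho> \<le> 1" and f: "f \<in> estimators n"
  shows "\<exists>W\<in>step_graphons k. min (sqrt (\<rho> / real n)) \<rho> / 128
           \<le> graphon_expectation n \<rho> W (\<lambda>A. cut_distance (f A) (\<lambda>x y. \<rho> * W x y))"
proof -
  \<comment> \<open>The largest value up to 1 that satisfies
    \<open>8 * n * \<theta> * \<epsilon>^2 \<le> 1\<close> for
    \<open>\<theta> = \<rho> / 2\<close>.\<close>
  define \<epsilon> where "\<epsilon> = min (1 / (2 * sqrt (real n * \<rho>))) 1"
  define \<theta> where "\<theta> = \<rho> / 2"
  define Q :: "nat \<Rightarrow> nat \<Rightarrow> real" where "Q a b = (1 + \<epsilon> * (block_sign a * block_sign b)) / 2" for a b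
  define Q0 :: "nat \<Rightarrow> nat \<Rightarrow> real" where "Q0 a b = 1 / 2" for a b
  have n\<rho>: "0 < real n * \<rho>" using n \<rho> by simp
  have \<epsilon>: "0 < \<epsilon>" "\<epsilon> \<le> 1" using n\<rho> by (auto simp: \<epsilon>_def)
  have "\<epsilon> ^ 2 \<le> (1 / (2 * sqrt (real n * \<rho>))) ^ 2"
    using \<epsilon> by (intro power_mono) (auto simp: \<epsilon>_def)
  also have "\<dots> = 1 / (4 * (real n * \<rho>))" using n\<rho> by (simp add: power_divide power_mult_distrib)
  finally have \<epsilon>2: "8 * real n * \<theta> * \<epsilon> ^ 2 \<le> 1" using n\<rho> by (simp add: \<theta>_def field_simps)
  have \<theta>: "0 < \<theta>" "\<theta> \<le> 1 / 2" "\<theta> < 1" using \<rho> by (auto simp: \<theta>_def)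
  have s: "block_sign a = 1 \<or> block_sign a = -1" for a by (auto simp: block_sign_def)
  have Q: "Q a b \<in> {0..1}" "Q a b = Q b a" for a b
  proof -
    have "block_sign a * block_sign b \<in> {-1, 1}" using s[of a] s[of b] by auto
    then show "Q a b \<in> {0..1}" using \<epsilon> by (auto simp: Q_def)
  qed (simp add: Q_def mult.commute)
  have bm: "block_matrix k Q" "block_matrix k Q0" for k
    using Q unfolding block_matrix_def Q0_def by auto
  obtain \<phi> where \<phi>: "has_block_masses 2 (\<lambda>_. 1/2) \<phi>"
    using block_masses_exist[of 2 "\<lambda>_. 1/2"] by (auto simp: numeral_2_eq_2)
  let ?W = "block_graphon Q \<phi>" and ?V = "block_graphon Q0 \<phi>"
  let ?d = "\<lambda>A. cut_distance (f A) (\<lambda>x y. \<rho> * ?W x y)"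
  let ?c = "\<lambda>A. cut_distance (f A) (\<lambda>x y. \<rho> * ?V x y)"
  let ?Z = "PiE {1..n} (\<lambda>_. {1..2::nat})"
  let ?E = "measure_pmf.expectation (edge_pmf n (\<lambda>_ _. \<theta>))"
  define L where "L e = (\<Sum>z\<in>?Z. likelihood_ratio n \<theta> (\<lambda>i j. \<theta> * (1 + \<epsilon> * (block_sign (z i) * block_sign (z j)))) e / 2 ^ n)" for e
  have probs: "block_probs \<rho> Q z = (\<lambda>i j. \<theta> * (1 + \<epsilon> * (block_sign (z i) * block_sign (z j))))" for z
    by (intro ext) (simp add: block_probs_def Q_def \<theta>_def)
  have probs_range: "block_probs \<rho> Q z i j \<in> {0..1}" for z i j
    using Q(1)[of "z i" "z j"] \<rho> unfolding block_probs_def by (auto intro: mult_le_one)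
  have W: "graphon_expectation n \<rho> ?W g = ?E (\<lambda>e. L e * g (edge_adjacency e))" for g
  proof -
    have "graphon_expectation n \<rho> ?W g
        = (\<Sum>z\<in>?Z. ?E (\<lambda>e. likelihood_ratio n \<theta> (block_probs \<rho> Q z) e / 2 ^ n * g (edge_adjacency e)))"
      unfolding graphon_expectation_block[OF \<phi>]
      using expectation_likelihood_ratio[OF \<theta>(1,3) probs_range, where g = "\<lambda>e. g (edge_adjacency e)"]
      by (intro sum.cong refl) (simp add: power_one_over field_simps)
    also have "\<dots> = ?E (\<lambda>e. L e * g (edge_adjacency e))"
      unfolding L_def sum_distrib_right probs by (simp add: Bochner_Integration.integral_sum)
    finally show ?thesis .
  qed
  have W0: "graphon_expectation n \<rho> ?V g = ?E (\<lambda>e. g (edge_adjacency e))" for g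
  proof -
    have "block_probs \<rho> Q0 z = (\<lambda>_ _. \<theta>)" for z by (intro ext) (simp add: block_probs_def Q0_def \<theta>_def)
    then have "graphon_expectation n \<rho> ?V g = (\<Sum>z\<in>?Z. (\<Prod>i\<in>{1..n}. 1/2) * ?E (\<lambda>e. g (edge_adjacency e)))"
      unfolding graphon_expectation_block[OF \<phi>] by simp
    also have "\<dots> = ?E (\<lambda>e. g (edge_adjacency e))"
      by (simp add: card_PiE power_one_over)
    finally show ?thesis .
  qed
  have L0: "L e \<ge> 0" for e
    unfolding L_def probs[symmetric]
    using likelihood_ratio_nonneg[OF \<theta>(1,3) probs_range] by (intro sum_nonneg divide_nonneg_pos) auto
  have EL: "?E L = 1"
    using W[of "\<lambda>_. 1"] unfolding graphon_expectation_block[OF \<phi>]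
    by (simp add: card_PiE power_one_over)
  have EL2: "?E (\<lambda>e. L e ^ 2) \<le> 3 / 2"
    unfolding L_def using two_block_chi_square[OF n \<theta>(1,2) _ \<epsilon>(2) \<epsilon>2] \<epsilon> by simp
  have sep: "\<rho> * \<epsilon> / 8 \<le> ?d A + ?c A" if A: "f A \<in> graphons" for A
  proof (rule ccontr)
    assume neg: "\<not> ?thesis"
    \<comment> \<open>A third of the gap: each of the two distances is enlarged by \<delta> to get a
      strict inequality, and a contradiction has to remain.\<close>
    define \<delta> where "\<delta> = (\<rho> * \<epsilon> / 8 - ?d A - ?c A) / 3"
    have \<delta>: "\<delta> > 0" using neg by (simp add: \<delta>_def)
    have c: "?c A < ?c A + \<delta>" and d: "?d A < ?d A + \<delta>" using \<delta> by auto
    obtain P :: "nat \<times> nat \<Rightarrow> real" where P: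
      "\<And>b. b \<in> {1..2} \<Longrightarrow> (\<Sum>a\<in>{1..2}. P (a, b)) = 1 / 2"
      "\<And>S T. finite S \<Longrightarrow> finite T \<Longrightarrow>
       \<rho> * \<bar>\<Sum>p\<in>S. \<Sum>q\<in>T. P p * P q * (Q0 (fst p) (fst q) - Q (snd p) (snd q))\<bar> \<le> ?c A + \<delta> + (?d A + \<delta>)"
      by (rule close_block_graphons_coupling[OF A less_imp_le[OF \<rho>(1)] \<rho>(2) \<phi> bm(2) \<phi> bm(1) c d], rule that)
    \<comment> \<open>The points that \<open>W\<close> labels 1, of mass 1/2 under every coupling.
      On their square the two matrices differ by the constant \<open>\<epsilon> / 2\<close>, so no
      alignment can hide the difference.\<close>
    let ?S = "{1..2} \<times> {1::nat}"
    have h: "(\<Sum>p\<in>?S. P p) = 1/2"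
      using P(1)[of 1] by (simp add: sum.cartesian_product')
    have "(\<Sum>p\<in>?S. \<Sum>q\<in>?S. P p * P q * (Q0 (fst p) (fst q) - Q (snd p) (snd q)))
        = (\<Sum>p\<in>?S. \<Sum>q\<in>?S. P p * P q * (- \<epsilon> / 2))"
      by (intro sum.cong refl) (auto simp: Q0_def Q_def block_sign_def field_simps)
    also have "\<dots> = (\<Sum>p\<in>?S. P p) * (\<Sum>q\<in>?S. P q) * (- \<epsilon> / 2)"
      by (subst sum_product) (simp only: sum_distrib_right)
    also have "\<dots> = - \<epsilon> / 8" unfolding h by simp
    finally have "\<rho> * (\<epsilon> / 8) \<le> ?c A + \<delta> + (?d A + \<delta>)" using P(2)[of ?S ?S] \<epsilon> by simp
    then show False using \<delta> by (simp add: \<delta>_def field_simps)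
  qed
  \<comment> \<open>The overlap of the two laws is the expectation of \<open>min 1 L\<close>. Its
    minorant \<open>L - L^2 / 2\<close> involves only the known moments and has expectation at least
    \<open>1 - 3 / 4\<close>.\<close>
  have "\<rho> * \<epsilon> / 32 \<le> \<rho> * \<epsilon> / 8 * (1 - ?E (\<lambda>e. L e ^ 2) / 2)"
  proof -
    have "\<rho> * \<epsilon> / 8 * (1 / 4) \<le> \<rho> * \<epsilon> / 8 * (1 - ?E (\<lambda>e. L e ^ 2) / 2)"
      using EL2 \<rho> \<epsilon> by (intro mult_left_mono) auto
    then show ?thesis by simp
  qed
  also have "\<dots> = ?E (\<lambda>e. \<rho> * \<epsilon> / 8 * (L e - L e ^ 2 / 2))"
    by (simp add: EL)
  also have "\<dots> \<le> ?E (\<lambda>e. ?c (edge_adjacency e) + L e * ?d (edge_adjacency e))"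
  proof (intro integral_mono_AE AE_pmfI)
    fix e assume "e \<in> set_pmf (edge_pmf n (\<lambda>_ _. \<theta>))"
    then have A: "f (edge_adjacency e) \<in> graphons"
      using f edge_adjacency_in_adjacency_matrices set_edge_pmf_subset unfolding estimators_def by blast
    define d d0 where "d = ?d (edge_adjacency e)" and "d0 = ?c (edge_adjacency e)"
    have d: "0 \<le> d" "0 \<le> d0" unfolding d_def d0_def
      using cut_distance_block_nonneg[OF A less_imp_le[OF \<rho>(1)] \<rho>(2) \<phi> bm(1)]
        cut_distance_block_nonneg[OF A less_imp_le[OF \<rho>(1)] \<rho>(2) \<phi> bm(2)] by auto
    have le: "\<rho> * \<epsilon> / 8 \<le> d + d0" using sep[OF A] by (simp add: d_def d0_def)
    have m: "L e - L e ^ 2 / 2 \<le> min 1 (L e)"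
    proof -
      have "L e - L e ^ 2 / 2 = 1/2 - (L e - 1) ^ 2 / 2" by (simp add: power2_eq_square field_simps)
      also have "\<dots> \<le> 1" by (smt (verit) divide_nonneg_pos zero_le_power2 field_sum_of_halves)
      finally show ?thesis using L0[of e] by simp
    qed
    have "\<rho> * \<epsilon> / 8 * (L e - L e ^ 2 / 2) \<le> \<rho> * \<epsilon> / 8 * min 1 (L e)"
      using m \<rho> \<epsilon> by (intro mult_left_mono) auto
    also have "\<dots> \<le> (d + d0) * min 1 (L e)" using le L0[of e] by (intro mult_right_mono) auto
    also have "\<dots> = d0 * min 1 (L e) + d * min 1 (L e)" by (simp add: algebra_simps)
    also have "\<dots> \<le> d0 * 1 + d * L e" using d by (intro add_mono mult_left_mono) auto
    finally show "\<rho> * \<epsilon> / 8 * (L e - L e ^ 2 / 2) \<le> ?c (edge_adjacency e) + L e * ?d (edge_adjacency e)"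
      by (simp add: d_def d0_def mult.commute)
  qed auto
  also have "\<dots> = graphon_expectation n \<rho> ?V ?c + graphon_expectation n \<rho> ?W ?d"
    unfolding W W0 by simp
  finally have "\<rho> * \<epsilon> / 64 \<le> graphon_expectation n \<rho> ?V ?c \<or> \<rho> * \<epsilon> / 64 \<le> graphon_expectation n \<rho> ?W ?d"
    by linarith
  moreover have "min (sqrt (\<rho> / real n)) \<rho> / 128 \<le> \<rho> * \<epsilon> / 64"
  proof -
    have "\<rho> / sqrt (real n * \<rho>) = sqrt (\<rho> / real n)"
    proof -
      have "\<rho> / sqrt (real n * \<rho>) = (\<rho> / sqrt \<rho>) / sqrt (real n)" by (simp add: real_sqrt_mult)
      then show ?thesis using \<rho> by (simp only: real_div_sqrt real_sqrt_divide less_imp_le)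
    qed
    then have "\<rho> * \<epsilon> = min (sqrt (\<rho> / real n) / 2) \<rho>"
      using \<rho> unfolding \<epsilon>_def by (simp add: min_mult_distrib_left)
    also have "\<dots> \<ge> min (sqrt (\<rho> / real n)) \<rho> / 2" using \<rho> by auto
    finally show ?thesis by simp
  qed
  moreover have "?W \<in> step_graphons k" "?V \<in> step_graphons k"
    using block_graphon_in_step_graphons[OF \<phi> bm(1) k] block_graphon_in_step_graphons[OF \<phi> bm(2) k] .
  ultimately show ?thesis by (meson order_trans)
qed

subsection \<open>Random signs and codes\<close>

lemma sum_Pow_insert:
  assumes "finite A" "x \<notin> A"
  shows "(\<Sum>T\<in>Pow (insert x A). f T) = (\<Sum>T\<in>Pow A. f T + f (insert x T))"
proof -
  have "inj_on (insert x) (Pow A)"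
    using assms by (intro inj_onI) (metis Diff_insert_absorb PowD subsetD)
  moreover have "Pow A \<inter> insert x ` Pow A = {}" using assms by blast
  ultimately show ?thesis
    using assms by (simp add: Pow_insert sum.union_disjoint sum.reindex sum.distrib)
qed

text \<open>A Rademacher sum with the plus signs at \<open>T\<close>; summing over
  \<open>Pow A\<close> amounts to taking expectations up to \<open>2 ^ card A\<close>.\<close>

definition sign_sum :: "('a \<Rightarrow> real) \<Rightarrow> 'a set \<Rightarrow> 'a set \<Rightarrow> real" where
  "sign_sum x A T = (\<Sum>i\<in>A. if i \<in> T then x i else - x i)"

lemma sign_sum_insert:
  assumes "finite A" "a \<notin> A" "T \<subseteq> A"
  shows "sign_sum x (insert a A) T = sign_sum x A T - x a"
    and "sign_sum x (insert a A) (insert a T) = sign_sum x A T + x a"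
proof -
  show "sign_sum x (insert a A) T = sign_sum x A T - x a"
    unfolding sign_sum_def using assms by auto
  have "(\<Sum>i\<in>A. if i \<in> insert a T then x i else - x i) = (\<Sum>i\<in>A. if i \<in> T then x i else - x i)"
    using assms by (intro sum.cong) auto
  then show "sign_sum x (insert a A) (insert a T) = sign_sum x A T + x a"
    unfolding sign_sum_def using assms by auto
qed

lemma sum_sign_sum_square:
  assumes "finite A"
  shows "(\<Sum>T\<in>Pow A. sign_sum x A T ^ 2) = 2 ^ card A * (\<Sum>i\<in>A. x i ^ 2)"
  using assms
proof (induction A)
  case empty
  then show ?case by (simp add: sign_sum_def)
next
  case (insert a A)
  have "(\<Sum>T\<in>Pow (insert a A). sign_sum x (insert a A) T ^ 2)
      = (\<Sum>T\<in>Pow A. (sign_sum x A T - x a)^2 + (sign_sum x A T + x a)^2)"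
    using insert by (simp add: sum_Pow_insert sign_sum_insert)
  also have "\<dots> = (\<Sum>T\<in>Pow A. 2 * sign_sum x A T ^ 2 + 2 * x a ^ 2)"
    by (intro sum.cong) (auto simp: power2_eq_square algebra_simps)
  also have "\<dots> = 2 ^ card (insert a A) * (\<Sum>i\<in>insert a A. x i ^ 2)"
    using insert
    by (simp add: sum.distrib sum_distrib_left[symmetric] card_Pow algebra_simps)
  finally show ?case .
qed

text \<open>Adding a sign cancels the odd powers, as for the second moment. The constant 3 is that
  of a Gaussian variable.\<close>

lemma sum_sign_sum_fourth:
  assumes "finite A"
  shows "(\<Sum>T\<in>Pow A. sign_sum x A T ^ 4) \<le> 3 * 2 ^ card A * (\<Sum>i\<in>A. x i ^ 2) ^ 2"
  using assms
proof (induction A)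
  case empty
  then show ?case by (simp add: sign_sum_def)
next
  case (insert a A)
  let ?X = "\<Sum>i\<in>A. x i ^ 2"
  have "(\<Sum>T\<in>Pow (insert a A). sign_sum x (insert a A) T ^ 4)
      = (\<Sum>T\<in>Pow A. (sign_sum x A T - x a)^4 + (sign_sum x A T + x a)^4)"
    using insert by (simp add: sum_Pow_insert sign_sum_insert)
  also have "\<dots> = (\<Sum>T\<in>Pow A. 2 * sign_sum x A T ^ 4 + 12 * x a ^ 2 * sign_sum x A T ^ 2 + 2 * x a ^ 4)"
    by (intro sum.cong) (auto simp: power2_eq_square power4_eq_xxxx algebra_simps)
  also have "\<dots> = 2 * (\<Sum>T\<in>Pow A. sign_sum x A T ^ 4) + 12 * x a ^ 2 * (2 ^ card A * ?X)
                   + 2 * 2 ^ card A * x a ^ 4"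
    using insert
    by (simp add: sum.distrib sum_distrib_left[symmetric] card_Pow sum_sign_sum_square)
  \<comment> \<open>The coefficient 2 of \<open>x a ^ 4\<close> is raised to 6 to complete the
    square.\<close>
  also have "\<dots> \<le> 2 * (3 * 2 ^ card A * ?X ^ 2) + 12 * x a ^ 2 * (2 ^ card A * ?X)
                   + 6 * 2 ^ card A * x a ^ 4"
    using insert.IH by (intro add_mono mult_left_mono) (auto intro!: mult_right_mono)
  also have "\<dots> = 3 * 2 ^ card (insert a A) * (\<Sum>i\<in>insert a A. x i ^ 2) ^ 2"
    using insert by (simp add: power2_eq_square power4_eq_xxxx algebra_simps)
  finally show ?case .
qed

text \<open>The absolute value is minorized by an even polynomial, which after scaling is
  \<open>t^2 - t^4 / 4 \<le> t\<close>. Its mean is controlled by the second and fourth moments: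
  three quarters of the variance are lost, one quarter remains.\<close>

lemma Khintchine_L1:
  assumes A: "finite A"
  shows "(\<Sum>T\<in>Pow A. \<bar>sign_sum x A T\<bar>) \<ge> 2 ^ card A * sqrt (\<Sum>i\<in>A. x i ^ 2) / 4"
proof (cases "(\<Sum>i\<in>A. x i ^ 2) = 0")
  case True
  then show ?thesis by (simp add: sum_nonneg)
next
  case False
  define X where "X = (\<Sum>i\<in>A. x i ^ 2)"
  define s where "s = sqrt X"
  have "X \<ge> 0" unfolding X_def by (intro sum_nonneg) auto
  then have X: "X > 0" using False X_def by linarith
  have s: "s > 0" "s ^ 2 = X" using X by (auto simp: s_def)
  have pw: "s * \<bar>y\<bar> \<ge> y ^ 2 - y ^ 4 / (4 * X)" for y :: real
  proof -
    define t where "t = \<bar>y\<bar> / s"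
    have t: "t \<ge> 0" "\<bar>y\<bar> = t * s" using s by (auto simp: t_def)
    have "4 + t ^ 3 - 4 * t \<ge> 0"
    proof -
      have "4 + t ^ 3 - 4 * t = t * (t - 2)^2 + 4 * (t - 1)^2"
        by (simp add: power2_eq_square power3_eq_cube algebra_simps)
      then show ?thesis using t by (smt (verit) mult_nonneg_nonneg zero_le_power2)
    qed
    then have "t * (4 + t ^ 3 - 4 * t) \<ge> 0" using t by simp
    then have "t ^ 2 - t ^ 4 / 4 \<le> t"
      by (simp add: power2_eq_square power3_eq_cube power4_eq_xxxx field_simps)
    then have "X * (t ^ 2 - t ^ 4 / 4) \<le> X * t" using X by simp
    moreover have "y ^ 2 = t ^ 2 * X"
      using t(2) s(2) by (metis power2_abs power_mult_distrib)
    moreover have "y ^ 4 = t ^ 4 * X ^ 2"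
    proof -
      have "y ^ 4 = (y ^ 2) ^ 2" by simp
      also have "\<dots> = t ^ 4 * X ^ 2" by (simp add: \<open>y ^ 2 = t ^ 2 * X\<close> power_mult_distrib)
      finally show ?thesis .
    qed
    moreover have "s * \<bar>y\<bar> = X * t" using t(2) s(2) by (simp add: power2_eq_square algebra_simps)
    ultimately show ?thesis using X by (simp add: field_simps power2_eq_square)
  qed
  have "(\<Sum>T\<in>Pow A. sign_sum x A T ^ 4) / (4 * X) \<le> (3 * 2 ^ card A * X ^ 2) / (4 * X)"
    using sum_sign_sum_fourth[OF A, of x] X unfolding X_def by (intro divide_right_mono) auto
  also have "\<dots> = 2 ^ card A * X * (3/4)"
    using X by (simp add: power2_eq_square)
  finally have fourth: "(\<Sum>T\<in>Pow A. sign_sum x A T ^ 4) / (4 * X) \<le> 2 ^ card A * X * (3/4)" .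
  have "s * (2 ^ card A * s / 4) = 2 ^ card A * X - 2 ^ card A * X * (3/4)"
    using s(2) by (simp add: power2_eq_square algebra_simps)
  also have "\<dots> \<le> 2 ^ card A * X - (\<Sum>T\<in>Pow A. sign_sum x A T ^ 4) / (4 * X)"
    using fourth by linarith
  also have "\<dots> = (\<Sum>T\<in>Pow A. sign_sum x A T ^ 2 - sign_sum x A T ^ 4 / (4 * X))"
    using sum_sign_sum_square[OF A, of x]
    by (simp add: sum_subtractf sum_divide_distrib X_def)
  also have "\<dots> \<le> s * (\<Sum>T\<in>Pow A. \<bar>sign_sum x A T\<bar>)"
    unfolding sum_distrib_left by (intro sum_mono pw)
  finally have "s * (2 ^ card A * s / 4) \<le> s * (\<Sum>T\<in>Pow A. \<bar>sign_sum x A T\<bar>)" .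
  then show ?thesis using mult_le_cancel_left_pos[OF s(1)] unfolding s_def X_def by blast
qed

text \<open>The mean over a uniformly random test set \<open>T\<close>. The cut norm tests sets
  rather than signs, so this is the form in which Khintchine's inequality meets it.\<close>

definition avg_subset_sum :: "'a set \<Rightarrow> ('a \<Rightarrow> real) \<Rightarrow> real" where
  "avg_subset_sum A x = (\<Sum>T\<in>Pow A. \<bar>\<Sum>i\<in>T. x i\<bar>) / 2 ^ card A"

lemma avg_subset_sum_triangle:
  "avg_subset_sum A (\<lambda>i. x i - z i) \<le> avg_subset_sum A (\<lambda>i. x i - y i) + avg_subset_sum A (\<lambda>i. y i - z i)"
proof -
  have "\<bar>\<Sum>i\<in>T. x i - z i\<bar> \<le> \<bar>\<Sum>i\<in>T. x i - y i\<bar> + \<bar>\<Sum>i\<in>T. y i - z i\<bar>" for T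
    by (simp add: sum_subtractf)
  then show ?thesis unfolding avg_subset_sum_def
    by (simp add: add_divide_distrib[symmetric] sum.distrib[symmetric] divide_right_mono sum_mono)
qed

lemma avg_subset_sum_commute:
  "avg_subset_sum A (\<lambda>i. x i - y i) = avg_subset_sum A (\<lambda>i. y i - x i)"
  unfolding avg_subset_sum_def by (simp add: sum_subtractf abs_minus_commute)

lemma avg_subset_sum_nonneg: "avg_subset_sum A x \<ge> 0"
  unfolding avg_subset_sum_def by (intro divide_nonneg_pos sum_nonneg) auto

lemma avg_subset_sum_le:
  assumes "finite A" "\<And>i. i \<in> A \<Longrightarrow> \<bar>x i\<bar> \<le> c" "c \<ge> 0"
  shows "avg_subset_sum A x \<le> real (card A) * c"
proof -
  have "\<bar>\<Sum>i\<in>T. x i\<bar> \<le> real (card A) * c" if "T \<in> Pow A" for T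
  proof -
    have "\<bar>\<Sum>i\<in>T. x i\<bar> \<le> (\<Sum>i\<in>T. \<bar>x i\<bar>)" by (rule sum_abs)
    also have "\<dots> \<le> (\<Sum>i\<in>T. c)" using that assms by (intro sum_mono) auto
    also have "\<dots> \<le> real (card A) * c"
      using that assms by (auto intro!: mult_right_mono card_mono)
    finally show ?thesis .
  qed
  then have "(\<Sum>T\<in>Pow A. \<bar>\<Sum>i\<in>T. x i\<bar>) \<le> (\<Sum>T\<in>Pow A. real (card A) * c)" by (intro sum_mono)
  then show ?thesis using assms by (simp add: avg_subset_sum_def card_Pow field_simps)
qed

text \<open>A sign sum is the difference of the sums over \<open>T\<close> and over its complement.
  Both have the same average, so the constant of \<open>Khintchine_L1\<close> is halved.\<close>

lemma avg_subset_sum_ge: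
  assumes A: "finite A"
  shows "avg_subset_sum A x \<ge> sqrt (\<Sum>i\<in>A. x i ^ 2) / 8"
proof -
  have flip: "(\<Sum>T\<in>Pow A. \<bar>\<Sum>i\<in>A - T. x i\<bar>) = (\<Sum>T\<in>Pow A. \<bar>\<Sum>i\<in>T. x i\<bar>)"
    by (rule sum.reindex_bij_witness[where i = "\<lambda>T. A - T" and j = "\<lambda>T. A - T"]) auto
  have "2 ^ card A * sqrt (\<Sum>i\<in>A. x i ^ 2) / 4 \<le> (\<Sum>T\<in>Pow A. \<bar>sign_sum x A T\<bar>)"
    by (rule Khintchine_L1[OF A])
  also have "\<dots> \<le> (\<Sum>T\<in>Pow A. \<bar>\<Sum>i\<in>T. x i\<bar> + \<bar>\<Sum>i\<in>A - T. x i\<bar>)"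
  proof (intro sum_mono)
    fix T assume T: "T \<in> Pow A"
    have "sign_sum x A T = (\<Sum>i\<in>A - T. - x i) + (\<Sum>i\<in>T. x i)"
      unfolding sign_sum_def using T A
      by (subst sum.subset_diff[of T A]) (auto intro!: arg_cong2[where f = plus] sum.cong)
    then show "\<bar>sign_sum x A T\<bar> \<le> \<bar>\<Sum>i\<in>T. x i\<bar> + \<bar>\<Sum>i\<in>A - T. x i\<bar>"
      by (simp add: sum_negf)
  qed
  also have "\<dots> = 2 * (\<Sum>T\<in>Pow A. \<bar>\<Sum>i\<in>T. x i\<bar>)" by (simp add: sum.distrib flip)
  finally show ?thesis unfolding avg_subset_sum_def by (simp add: field_simps)
qed

text \<open>Chernoff's bound: weigh each set by exp of minus its distance to the centre; the total
  weight factors over the elements of \<open>U\<close>.\<close>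

lemma card_Hamming_ball:
  assumes U: "finite U" and T: "T0 \<subseteq> U"
  shows "real (card {T \<in> Pow U. real (card (sym_diff T0 T)) \<le> r}) \<le> exp r * (1 + exp (-1)) ^ card U"
proof -
  have gen: "(\<Sum>T\<in>Pow U. exp (- real (card (sym_diff T0 T)))) = (1 + exp (-1)) ^ card U"
    using U T
  proof (induction U arbitrary: T0)
    case (insert u U)
    let ?T = "T0 - {u}"
    have sub: "?T \<subseteq> U" using insert by auto
    have ind: "exp (- real (card (sym_diff T0 T))) + exp (- real (card (sym_diff T0 (insert u T))))
       = exp (- real (card (sym_diff ?T T))) * (1 + exp (-1))" if "T \<in> Pow U" for T
    proof -
      have fin: "finite (sym_diff ?T T)" using that sub insert by (auto intro: finite_subset)
      have uT: "u \<notin> T" using that insert by auto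
      show ?thesis
      proof (cases "u \<in> T0")
        case True
        then have "sym_diff T0 T = insert u (sym_diff ?T T)" "sym_diff T0 (insert u T) = sym_diff ?T T"
          using uT by auto
        then show ?thesis using fin uT by (simp add: algebra_simps flip: exp_add)
      next
        case False
        then have "sym_diff T0 T = sym_diff ?T T" "sym_diff T0 (insert u T) = insert u (sym_diff ?T T)"
          using uT by auto
        then show ?thesis using fin uT False by (simp add: algebra_simps flip: exp_add)
      qed
    qed
    show ?case
      using insert.hyps insert.IH[OF sub] ind
      by (simp add: sum_Pow_insert flip: sum_distrib_right)
  qed simp
  let ?B = "{T \<in> Pow U. real (card (sym_diff T0 T)) \<le> r}"
  have "real (card ?B) = (\<Sum>T\<in>?B. 1)" by simp
  also have "\<dots> \<le> (\<Sum>T\<in>?B. exp r * exp (- real (card (sym_diff T0 T))))"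
    by (intro sum_mono) (simp flip: exp_add)
  also have "\<dots> \<le> (\<Sum>T\<in>Pow U. exp r * exp (- real (card (sym_diff T0 T))))"
    using U by (intro sum_mono2) auto
  finally show ?thesis by (simp add: gen flip: sum_distrib_left)
qed

text \<open>The Gilbert--Varshamov argument.\<close>
lemma separated_subsets_exist:
  assumes U: "finite U" and N: "real N * (exp r * (1 + exp (-1)) ^ card U) < 2 ^ card U"
  shows "\<exists>c :: nat \<Rightarrow> 'a set. c 0 = {} \<and> (\<forall>a\<le>N. c a \<subseteq> U) \<and>
           (\<forall>a\<le>N. \<forall>b\<le>N. a \<noteq> b \<longrightarrow> real (card (sym_diff (c a) (c b))) > r)"
  using N
proof (induction N)
  case 0
  show ?case by (intro exI[of _ "\<lambda>_. {}"]) auto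
next
  case (Suc N)
  let ?V = "exp r * (1 + exp (-1)) ^ card U"
  have "real N * ?V \<le> real (Suc N) * ?V" by (intro mult_right_mono) (auto intro!: mult_nonneg_nonneg add_nonneg_nonneg)
  then have "real N * ?V < 2 ^ card U" using Suc.prems by linarith
  then obtain c :: "nat \<Rightarrow> 'a set" where c: "c 0 = {}" "\<forall>a\<le>N. c a \<subseteq> U"
    "\<forall>a\<le>N. \<forall>b\<le>N. a \<noteq> b \<longrightarrow> real (card (sym_diff (c a) (c b))) > r" using Suc.IH by blast
  let ?B = "\<lambda>a. {T \<in> Pow U. real (card (sym_diff (c a) T)) \<le> r}"
  have "real (card (\<Union>a\<in>{..N}. ?B a)) \<le> real (\<Sum>a\<in>{..N}. card (?B a))"
    using U by (intro of_nat_mono card_UN_le) auto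
  also have "\<dots> = (\<Sum>a\<in>{..N}. real (card (?B a)))" by simp
  also have "\<dots> \<le> (\<Sum>a\<in>{..N}. ?V)" using c by (intro sum_mono card_Hamming_ball U) auto
  also have "\<dots> = real (Suc N) * ?V" by simp
  also have "\<dots> < real (card (Pow U))" using Suc.prems U by (simp add: card_Pow)
  finally have "card (\<Union>a\<in>{..N}. ?B a) < card (Pow U)" by simp
  then have "\<not> Pow U \<subseteq> (\<Union>a\<in>{..N}. ?B a)"
    using U card_mono[of "\<Union>a\<in>{..N}. ?B a" "Pow U"] by fastforce
  then obtain T where T': "T \<in> Pow U" "T \<notin> (\<Union>a\<in>{..N}. ?B a)" by blast
  have TU: "T \<subseteq> U" using T' by auto
  have T: "real (card (sym_diff (c a) T)) > r" if "a \<le> N" for a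
    using T' that by (auto simp: not_le)
  have comm: "sym_diff A B = sym_diff B A" for A B :: "'a set" by auto
  show ?case
  proof (intro exI[of _ "c(Suc N := T)"] conjI allI impI)
    fix a b assume "a \<le> Suc N" "b \<le> Suc N" "a \<noteq> b"
    then show "real (card (sym_diff ((c(Suc N := T)) a) ((c(Suc N := T)) b))) > r"
      using c T T[unfolded comm[of _ T]] by (cases "a = Suc N"; cases "b = Suc N") (auto simp: le_Suc_eq)
  qed (use c TU in \<open>auto simp: le_Suc_eq\<close>)
qed

subsection \<open>Alignments of code graphons\<close>

text \<open>
  Blocks \<open>1, \<dots>, K\<close> carry codewords and have mass \<open>(1 \<plusminus> \<gamma>) / (2 K)\<close>, the sign being the unknown parameter; blocks
  \<open>K + 1, \<dots>, K + m\<close> have mass \<open>1 / (2 m)\<close> and are the letters of the code. The matrix is the incidence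
  matrix of letters and words, with zero diagonal blocks.
\<close>
locale code_blocks =
  fixes K m :: nat and cw :: "nat \<Rightarrow> nat set" and \<gamma> :: real
  assumes m_pos: "1 \<le> m" and K_large: "4 * m \<le> K" and K_even: "even K"
    and cw_0: "cw 0 = {}" and cw_subset: "a \<le> K \<Longrightarrow> cw a \<subseteq> {K+1..K+m}"
    and cw_separated: "a \<le> K \<Longrightarrow> b \<le> K \<Longrightarrow> a \<noteq> b \<Longrightarrow> real (card (sym_diff (cw a) (cw b))) > real m / 10"
    and \<gamma>_pos: "0 < \<gamma>" and \<gamma>_le: "\<gamma> \<le> 1 / 6"
begin

definition mass :: "nat set \<Rightarrow> nat \<Rightarrow> real" where
  "mass E a = (if a \<le> K then (1 + \<gamma> * (if a \<in> E then 1 else -1)) / (2 * real K) else 1 / (2 * real m))"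

definition code_matrix :: "nat \<Rightarrow> nat \<Rightarrow> real" where
  "code_matrix a b = of_bool ((a \<le> K \<and> b \<in> cw a) \<or> (b \<le> K \<and> a \<in> cw b))"

text \<open>The letter blocks do not meet each other, so each of them looks like the empty codeword \<open>cw 0\<close>.\<close>
definition word :: "nat \<Rightarrow> nat" where
  "word a = (if a \<le> K then a else 0)"

text \<open>The factor is the mass of a letter block, so sums over letters are integrals of a row of
  the code graphon.\<close>

definition word_vector :: "nat \<Rightarrow> nat \<Rightarrow> real" where
  "word_vector c i = of_bool (i \<in> cw c) / (2 * real m)"

text \<open>What the codeword of block \<open>b\<close> becomes when the letters are mixed according to the coupling \<open>P\<close>.\<close>
definition code_blur :: "(nat \<times> nat \<Rightarrow> real) \<Rightarrow> nat \<Rightarrow> nat \<Rightarrow> real" where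
  "code_blur P b i = (\<Sum>j\<in>{1..K+m}. P (i, j) * code_matrix b j)"

abbreviation code_dist :: "(nat \<Rightarrow> real) \<Rightarrow> (nat \<Rightarrow> real) \<Rightarrow> real" where
  "code_dist x y \<equiv> avg_subset_sum {K+1..K+m} (\<lambda>i. x i - y i)"

text \<open>A lower bound for half the distance between two codewords, from the Khintchine inequality.\<close>
abbreviation \<eta> :: real where "\<eta> \<equiv> 1 / (104 * sqrt (real m))"

lemma K_pos: "K > 0" using m_pos K_large by simp

lemma mass_bounds:
  assumes "a \<le> K" shows "(1 - \<gamma>) / (2 * real K) \<le> mass E a" "mass E a \<le> (1 + \<gamma>) / (2 * real K)"
  using assms \<gamma>_pos K_pos by (auto simp: mass_def divide_right_mono)

lemma mass_nonneg: "mass E a \<ge> 0"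
  using \<gamma>_le \<gamma>_pos by (auto simp: mass_def)

lemma block_matrix_code_matrix: "block_matrix k code_matrix"
  unfolding block_matrix_def code_matrix_def by auto

lemma code_matrix_column:
  assumes "a \<in> {1..K+m}" "i \<in> {K+1..K+m}"
  shows "code_matrix a i / (2 * real m) = word_vector (word a) i"
  using assms cw_subset[of i] by (auto simp: code_matrix_def word_vector_def word_def cw_0)

lemma code_matrix_zero: "b \<in> {1..K} \<Longrightarrow> j \<in> {1..K} \<Longrightarrow> code_matrix b j = 0"
  using cw_subset[of b] cw_subset[of j] by (fastforce simp: code_matrix_def)

lemma word_vectors_separated:
  assumes "a \<le> K" "b \<le> K" "a \<noteq> b"
  shows "code_dist (word_vector a) (word_vector b) \<ge> 2 * \<eta>"
proof -
  let ?D = "sym_diff (cw a) (cw b)"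
  have D: "?D \<subseteq> {K+1..K+m}" using cw_subset assms by blast
  have "(\<Sum>i\<in>{K+1..K+m}. (word_vector a i - word_vector b i) ^ 2)
      = (\<Sum>i\<in>{K+1..K+m}. if i \<in> ?D then (1 / (2 * real m)) ^ 2 else 0)"
    by (intro sum.cong refl) (auto simp: word_vector_def)
  also have "\<dots> = real (card ?D) * (1 / (2 * real m)) ^ 2"
    using D by (subst sum.inter_restrict[symmetric]) (auto simp: Int_absorb1)
  also have "\<dots> \<ge> (real m / 10) * (1 / (2 * real m)) ^ 2"
    using cw_separated[OF assms] by (intro mult_right_mono) auto
  finally have "(\<Sum>i\<in>{K+1..K+m}. (word_vector a i - word_vector b i) ^ 2) \<ge> (real m / 10) * (1 / (2 * real m)) ^ 2" .
  \<comment> \<open>Here \<open>(4 / 26)^2 = 16 / 676\<close> is just below \<open>1 / 40\<close>.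
    Dividing \<open>4 / 26\<close> by the 8 of \<open>avg_subset_sum_ge\<close> gives
    \<open>2 / 104\<close>, the source of the constant in \<open>\<eta>\<close>.\<close>
  moreover have "(4 / (26 * sqrt (real m))) ^ 2 \<le> (real m / 10) * (1 / (2 * real m)) ^ 2"
  proof -
    have "(4 / (26 * sqrt (real m))) ^ 2 = 16 / (676 * real m)"
      by (simp add: power_divide power_mult_distrib)
    moreover have "(real m / 10) * (1 / (2 * real m)) ^ 2 = 1 / (40 * real m)"
      by (simp add: power2_eq_square)
    ultimately show ?thesis using m_pos by (simp add: field_simps)
  qed
  ultimately have "(4 / (26 * sqrt (real m))) ^ 2 \<le> (\<Sum>i\<in>{K+1..K+m}. (word_vector a i - word_vector b i) ^ 2)"
    by linarith
  then have "4 / (26 * sqrt (real m)) \<le> sqrt (\<Sum>i\<in>{K+1..K+m}. (word_vector a i - word_vector b i) ^ 2)"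
    by (rule real_le_rsqrt)
  then have "4 / (26 * sqrt (real m)) / 8 \<le> code_dist (word_vector a) (word_vector b)"
    by (intro order_trans[OF _ avg_subset_sum_ge]) auto
  then show ?thesis by simp
qed

text \<open>Words are \<open>2 * \<eta>\<close> apart, so at most one of them is closer than
  \<open>\<eta>\<close> to \<open>u\<close>; if there is none, any \<open>c\<close> will do.\<close>

lemma nearest_word:
  "\<exists>c\<le>K. \<forall>a\<le>K. a \<noteq> c \<longrightarrow> \<eta> \<le> code_dist (word_vector a) u"
proof (cases "\<exists>c\<le>K. code_dist (word_vector c) u < \<eta>")
  case True
  then obtain c where c: "c \<le> K" "code_dist (word_vector c) u < \<eta>" by blast
  have "\<eta> \<le> code_dist (word_vector a) u" if "a \<le> K" "a \<noteq> c" for a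
  proof -
    have "2 * \<eta> \<le> code_dist (word_vector a) (word_vector c)"
      using word_vectors_separated c that by blast
    also have "\<dots> \<le> code_dist (word_vector a) u + code_dist u (word_vector c)"
      by (rule avg_subset_sum_triangle)
    also have "code_dist u (word_vector c) = code_dist (word_vector c) u"
      by (rule avg_subset_sum_commute)
    finally show ?thesis using c by linarith
  qed
  then show ?thesis using c by blast
next
  case False
  then show ?thesis by (intro exI[of _ 0]) auto
qed

text \<open>One test set consists of the points lying in the letters \<open>T\<close> of the first
  graphon. Integration over it turns a row of the first graphon into its word and a row of the
  second into a blurred word. The other test set selects the sign of the difference, at the cost of
  the factor 2, and averaging over \<open>T\<close> produces \<open>code_dist\<close>.\<close>

lemma coupling_code_dist:
  fixes P :: "nat \<times> nat \<Rightarrow> real"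
  assumes P: "\<And>p. P p \<ge> 0"
    and row: "\<And>a. a \<in> {1..K+m} \<Longrightarrow> (\<Sum>b\<in>{1..K+m}. P (a, b)) = mass E a"
    and cut: "\<And>S T. finite S \<Longrightarrow> finite T \<Longrightarrow>
       \<bar>\<Sum>p\<in>S. \<Sum>q\<in>T. P p * P q * (code_matrix (fst p) (fst q) - code_matrix (snd p) (snd q))\<bar> \<le> \<sigma>"
  shows "(\<Sum>p\<in>{1..K+m}\<times>{1..K+m}. P p * code_dist (word_vector (word (fst p))) (code_blur P (snd p))) \<le> 2 * \<sigma>"
proof -
  let ?V = "{1..K+m}" and ?F = "{K+1..K+m}"
  define g where "g p i = word_vector (word (fst p)) i - code_blur P (snd p) i" for p i
  have inner: "(\<Sum>q\<in>T\<times>?V. P q * (code_matrix (fst p) (fst q) - code_matrix (snd p) (snd q))) = (\<Sum>i\<in>T. g p i)"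
    if T: "T \<subseteq> ?F" and p: "p \<in> ?V \<times> ?V" for T p
  proof -
    have "(\<Sum>q\<in>T\<times>?V. P q * (code_matrix (fst p) (fst q) - code_matrix (snd p) (snd q)))
        = (\<Sum>i\<in>T. \<Sum>j\<in>?V. P (i, j) * (code_matrix (fst p) i - code_matrix (snd p) j))"
      by (simp add: sum.cartesian_product')
    also have "\<dots> = (\<Sum>i\<in>T. g p i)"
    proof (intro sum.cong refl)
      fix i assume i: "i \<in> T"
      have "(\<Sum>j\<in>?V. P (i, j) * (code_matrix (fst p) i - code_matrix (snd p) j))
          = (\<Sum>j\<in>?V. P (i, j)) * code_matrix (fst p) i - code_blur P (snd p) i"
        by (simp add: code_blur_def algebra_simps sum_subtractf sum_distrib_left)
      also have "(\<Sum>j\<in>?V. P (i, j)) = 1 / (2 * real m)"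
        using row[of i] i T by (auto simp: mass_def)
      also have "1 / (2 * real m) * code_matrix (fst p) i = word_vector (word (fst p)) i"
        using code_matrix_column[of "fst p" i] i T p by auto
      finally show "(\<Sum>j\<in>?V. P (i, j) * (code_matrix (fst p) i - code_matrix (snd p) j)) = g p i"
        by (simp add: g_def)
    qed
    finally show ?thesis .
  qed
  have one: "(\<Sum>p\<in>?V\<times>?V. P p * \<bar>\<Sum>i\<in>T. g p i\<bar>) \<le> 2 * \<sigma>" if T: "T \<in> Pow ?F" for T
  proof -
    have finT: "finite T" using T by (auto intro: finite_subset)
    have part: "\<bar>\<Sum>p\<in>S. P p * (\<Sum>i\<in>T. g p i)\<bar> \<le> \<sigma>" if S: "S \<subseteq> ?V \<times> ?V" for S
    proof -
      have "(\<Sum>p\<in>S. \<Sum>q\<in>T\<times>?V. P p * P q * (code_matrix (fst p) (fst q) - code_matrix (snd p) (snd q)))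
          = (\<Sum>p\<in>S. P p * (\<Sum>i\<in>T. g p i))"
        using S T by (intro sum.cong refl) (subst inner[symmetric], auto simp: sum_distrib_left mult_ac)
      moreover have "finite S" using S by (rule finite_subset) simp
      ultimately show ?thesis using cut[of S "T \<times> ?V"] finT by simp
    qed
    let ?A = "{p \<in> ?V\<times>?V. (\<Sum>i\<in>T. g p i) \<ge> 0}" and ?B = "{p \<in> ?V\<times>?V. \<not> (\<Sum>i\<in>T. g p i) \<ge> 0}"
    have "(\<Sum>p\<in>?V\<times>?V. P p * \<bar>\<Sum>i\<in>T. g p i\<bar>)
        = (\<Sum>p\<in>?A \<union> ?B. P p * \<bar>\<Sum>i\<in>T. g p i\<bar>)"
      by (intro sum.cong) auto
    also have "\<dots> = (\<Sum>p\<in>?A. P p * \<bar>\<Sum>i\<in>T. g p i\<bar>) + (\<Sum>p\<in>?B. P p * \<bar>\<Sum>i\<in>T. g p i\<bar>)"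
      by (intro sum.union_disjoint) auto
    also have "(\<Sum>p\<in>?A. P p * \<bar>\<Sum>i\<in>T. g p i\<bar>) = (\<Sum>p\<in>?A. P p * (\<Sum>i\<in>T. g p i))"
      by (intro sum.cong) auto
    also have "(\<Sum>p\<in>?B. P p * \<bar>\<Sum>i\<in>T. g p i\<bar>) = - (\<Sum>p\<in>?B. P p * (\<Sum>i\<in>T. g p i))"
      unfolding sum_negf[symmetric] by (intro sum.cong) auto
    finally show ?thesis using part[of ?A] part[of ?B] by fastforce
  qed
  have "(\<Sum>p\<in>?V\<times>?V. P p * code_dist (word_vector (word (fst p))) (code_blur P (snd p)))
      = (\<Sum>p\<in>?V\<times>?V. \<Sum>T\<in>Pow ?F. P p * \<bar>\<Sum>i\<in>T. g p i\<bar>) / 2 ^ m"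
    unfolding avg_subset_sum_def g_def by (simp add: sum_distrib_left sum_divide_distrib)
  also have "(\<Sum>p\<in>?V\<times>?V. \<Sum>T\<in>Pow ?F. P p * \<bar>\<Sum>i\<in>T. g p i\<bar>)
      = (\<Sum>T\<in>Pow ?F. \<Sum>p\<in>?V\<times>?V. P p * \<bar>\<Sum>i\<in>T. g p i\<bar>)" by (rule sum.swap)
  also have "\<dots> \<le> (\<Sum>T\<in>Pow ?F. 2 * \<sigma>)" by (intro sum_mono one)
  also have "\<dots> = 2 ^ m * (2 * \<sigma>)" by (simp add: card_Pow)
  finally show ?thesis by (simp add: divide_right_mono)
qed

text \<open>\<open>\<pi>\<close> assigns to each block of the second graphon the only codeword that may stay close to it;
  the mass coupled against \<open>\<pi>\<close> is paid for in the cut norm.\<close>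
lemma coupling_mismatch:
  fixes P :: "nat \<times> nat \<Rightarrow> real"
  assumes P: "\<And>p. P p \<ge> 0"
    and row: "\<And>a. a \<in> {1..K+m} \<Longrightarrow> (\<Sum>b\<in>{1..K+m}. P (a, b)) = mass E a"
    and cut: "\<And>S T. finite S \<Longrightarrow> finite T \<Longrightarrow>
       \<bar>\<Sum>p\<in>S. \<Sum>q\<in>T. P p * P q * (code_matrix (fst p) (fst q) - code_matrix (snd p) (snd q))\<bar> \<le> \<sigma>"
    and far: "\<And>b a. b \<in> {1..K+m} \<Longrightarrow> a \<le> K \<Longrightarrow> a \<noteq> \<pi> b \<Longrightarrow> \<eta> / 2 \<le> code_dist (word_vector a) (code_blur P b)"
  shows "(\<Sum>b\<in>{1..K+m}. \<Sum>a\<in>{a\<in>{1..K+m}. word a \<noteq> \<pi> b}. P (a, b)) \<le> 4 * \<sigma> / \<eta>"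
proof -
  let ?V = "{1..K+m}"
  have \<eta>: "\<eta> > 0" using m_pos by simp
  have wK: "word a \<le> K" for a by (simp add: word_def)
  have "\<eta> / 2 * (\<Sum>b\<in>?V. \<Sum>a\<in>{a\<in>?V. word a \<noteq> \<pi> b}. P (a, b))
      = (\<Sum>b\<in>?V. \<Sum>a\<in>{a\<in>?V. word a \<noteq> \<pi> b}. P (a, b) * (\<eta> / 2))"
    by (simp add: sum_distrib_left mult.commute)
  also have "\<dots> \<le> (\<Sum>b\<in>?V. \<Sum>a\<in>{a\<in>?V. word a \<noteq> \<pi> b}. P (a, b) * code_dist (word_vector (word a)) (code_blur P b))"
    using far wK P by (intro sum_mono mult_left_mono) auto
  also have "\<dots> \<le> (\<Sum>b\<in>?V. \<Sum>a\<in>?V. P (a, b) * code_dist (word_vector (word a)) (code_blur P b))"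
    using P avg_subset_sum_nonneg by (intro sum_mono sum_mono2) (auto intro!: mult_nonneg_nonneg)
  also have "\<dots> = (\<Sum>p\<in>?V\<times>?V. P p * code_dist (word_vector (word (fst p))) (code_blur P (snd p)))"
    by (subst sum.swap) (simp add: sum.cartesian_product')
  also have "\<dots> \<le> 2 * \<sigma>" by (rule coupling_code_dist[OF P row cut])
  finally have "\<eta> / 2 * (\<Sum>b\<in>?V. \<Sum>a\<in>{a\<in>?V. word a \<noteq> \<pi> b}. P (a, b)) \<le> 2 * \<sigma>" .
  then show ?thesis using \<eta> m_pos by (simp add: field_simps)
qed

text \<open>Up to mass \<open>t\<close> every block lies in its partner under \<open>\<pi>\<close>,
  so the fibre of \<open>a\<close> has about the mass of \<open>a\<close>. The errors are the
  mismatched masses \<open>M b\<close> and the mass that word blocks lose to letter blocks; each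
  \<open>M b\<close> is charged at most twice.\<close>

lemma matched_masses:
  fixes P :: "nat \<times> nat \<Rightarrow> real"
  assumes P: "\<And>p. P p \<ge> 0"
    and row: "\<And>a. a \<in> {1..K+m} \<Longrightarrow> (\<Sum>b\<in>{1..K+m}. P (a, b)) = mass E a"
    and col: "\<And>b. b \<in> {1..K+m} \<Longrightarrow> (\<Sum>a\<in>{1..K+m}. P (a, b)) = mass E' b"
    and \<pi>: "\<And>b. b \<in> {1..K+m} \<Longrightarrow> \<pi> b \<le> K"
    and mis: "(\<Sum>b\<in>{1..K+m}. \<Sum>a\<in>{a\<in>{1..K+m}. word a \<noteq> \<pi> b}. P (a, b)) \<le> t"
  shows "(\<Sum>a\<in>{1..K}. \<bar>mass E a - (\<Sum>b\<in>{b\<in>{1..K}. \<pi> b = a}. mass E' b)\<bar>) \<le> 2 * t"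
proof -
  let ?V = "{1..K+m}" and ?K = "{1..K}" and ?F = "{K+1..K+m}"
  define M where "M b = (\<Sum>a\<in>{a\<in>?V. word a \<noteq> \<pi> b}. P (a, b))" for b
  have V: "?V = ?K \<union> ?F" "?K \<inter> ?F = {}" by auto
  have split_V: "(\<Sum>x\<in>?V. h x) = (\<Sum>x\<in>?K. h x) + (\<Sum>x\<in>?F. h x)" for h :: "nat \<Rightarrow> real"
    unfolding V(1) by (rule sum.union_disjoint) auto
  have M0: "M b \<ge> 0" for b unfolding M_def using P by (intro sum_nonneg) auto
  have Kb: "(\<Sum>a\<in>{a\<in>?K. a \<noteq> \<pi> b}. P (a, b)) \<le> M b" for b
    unfolding M_def using P by (intro sum_mono2) (auto simp: word_def)
  have col_split: "(\<Sum>a\<in>?V. P (a, b)) = P (\<pi> b, b) + M b" if "\<pi> b \<in> ?K" for b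
  proof -
    have eq: "{a\<in>?V. word a \<noteq> \<pi> b} = ?V - {\<pi> b}" using that by (auto simp: word_def)
    show ?thesis unfolding M_def eq using that by (intro sum.remove) auto
  qed
  have F: "(\<Sum>a\<in>?K. P (a, b)) \<le> 2 * M b" if b: "b \<in> ?F" for b
  proof (cases "\<pi> b = 0")
    case True
    then have "{a\<in>?K. a \<noteq> \<pi> b} = ?K" by auto
    then show ?thesis using Kb[of b] M0[of b] by simp
  next
    case False
    then have pb: "\<pi> b \<in> ?K" using \<pi>[of b] b by auto
    have "P (\<pi> b, b) \<le> (\<Sum>x\<in>?V. P (\<pi> b, x))"
      using member_le_sum[of b ?V "\<lambda>x. P (\<pi> b, x)"] P b by auto
    also have "\<dots> = mass E (\<pi> b)" using row[of "\<pi> b"] pb by simp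
    also have "\<dots> \<le> (1 + \<gamma>) / (2 * real K)" using mass_bounds pb by simp
    also have "\<dots> \<le> 1 / real K" using \<gamma>_le K_pos by (simp add: field_simps)
    finally have le: "P (\<pi> b, b) \<le> 1 / real K" .
    \<comment> \<open>A letter block weighs at least \<open>2 / K\<close> and a word block at most
      \<open>1 / K\<close>, so a letter block matched with a word is at least half
      mismatched.\<close>
    have "2 / real K \<le> 1 / (2 * real m)" using K_large m_pos K_pos by (simp add: field_simps)
    also have "\<dots> = P (\<pi> b, b) + M b" using col[of b] col_split[OF pb] b by (simp add: mass_def)
    finally have "P (\<pi> b, b) \<le> M b" using le by simp
    moreover have "(\<Sum>a\<in>?K. P (a, b)) = P (\<pi> b, b) + (\<Sum>a\<in>{a\<in>?K. a \<noteq> \<pi> b}. P (a, b))"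
    proof -
      have eq: "{a\<in>?K. a \<noteq> \<pi> b} = ?K - {\<pi> b}" by auto
      show ?thesis unfolding eq using pb by (intro sum.remove) auto
    qed
    ultimately show ?thesis using Kb[of b] by linarith
  qed
  have pointwise: "\<bar>mass E a - (\<Sum>b\<in>{b\<in>?K. \<pi> b = a}. mass E' b)\<bar>
     \<le> (\<Sum>b\<in>?F. P (a, b)) + (\<Sum>b\<in>{b\<in>?K. \<pi> b \<noteq> a}. P (a, b)) + (\<Sum>b\<in>{b\<in>?K. \<pi> b = a}. M b)"
    if a: "a \<in> ?K" for a
  proof -
    have "(\<Sum>b\<in>?K. P (a, b)) = (\<Sum>b\<in>{b\<in>?K. \<pi> b = a} \<union> {b\<in>?K. \<pi> b \<noteq> a}. P (a, b))"
      by (intro sum.cong) auto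
    also have "\<dots> = (\<Sum>b\<in>{b\<in>?K. \<pi> b = a}. P (a, b)) + (\<Sum>b\<in>{b\<in>?K. \<pi> b \<noteq> a}. P (a, b))"
      by (intro sum.union_disjoint) auto
    finally have "mass E a = (\<Sum>b\<in>?F. P (a, b)) + (\<Sum>b\<in>{b\<in>?K. \<pi> b = a}. P (a, b)) + (\<Sum>b\<in>{b\<in>?K. \<pi> b \<noteq> a}. P (a, b))"
      using row[of a] a split_V[of "\<lambda>b. P (a, b)"] by simp
    moreover have "(\<Sum>b\<in>{b\<in>?K. \<pi> b = a}. mass E' b) = (\<Sum>b\<in>{b\<in>?K. \<pi> b = a}. P (a, b) + M b)"
    proof (intro sum.cong refl)
      fix b assume "b \<in> {b\<in>?K. \<pi> b = a}"
      then show "mass E' b = P (a, b) + M b" using col[of b] col_split[of b] a by auto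
    qed
    moreover have "0 \<le> (\<Sum>b\<in>?F. P (a, b))" "0 \<le> (\<Sum>b\<in>{b\<in>?K. \<pi> b \<noteq> a}. P (a, b))"
      "0 \<le> (\<Sum>b\<in>{b\<in>?K. \<pi> b = a}. M b)"
      using P M0 by (auto intro!: sum_nonneg)
    ultimately show ?thesis by (simp add: sum.distrib)
  qed
  have "(\<Sum>a\<in>?K. \<bar>mass E a - (\<Sum>b\<in>{b\<in>?K. \<pi> b = a}. mass E' b)\<bar>)
      \<le> (\<Sum>a\<in>?K. (\<Sum>b\<in>?F. P (a, b)) + (\<Sum>b\<in>{b\<in>?K. \<pi> b \<noteq> a}. P (a, b)) + (\<Sum>b\<in>{b\<in>?K. \<pi> b = a}. M b))"
    by (intro sum_mono pointwise)
  also have "\<dots> = (\<Sum>a\<in>?K. \<Sum>b\<in>?F. P (a, b)) + (\<Sum>a\<in>?K. \<Sum>b\<in>{b\<in>?K. \<pi> b \<noteq> a}. P (a, b))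
                   + (\<Sum>a\<in>?K. \<Sum>b\<in>{b\<in>?K. \<pi> b = a}. M b)"
    by (simp add: sum.distrib)
  finally have total: "(\<Sum>a\<in>?K. \<bar>mass E a - (\<Sum>b\<in>{b\<in>?K. \<pi> b = a}. mass E' b)\<bar>)
      \<le> (\<Sum>a\<in>?K. \<Sum>b\<in>?F. P (a, b)) + (\<Sum>a\<in>?K. \<Sum>b\<in>{b\<in>?K. \<pi> b \<noteq> a}. P (a, b))
                   + (\<Sum>a\<in>?K. \<Sum>b\<in>{b\<in>?K. \<pi> b = a}. M b)" .
  have 1: "(\<Sum>a\<in>?K. \<Sum>b\<in>?F. P (a, b)) \<le> (\<Sum>b\<in>?F. 2 * M b)"
    by (subst sum.swap) (intro sum_mono F)
  have "(\<Sum>a\<in>?K. \<Sum>b\<in>{b\<in>?K. \<pi> b \<noteq> a}. P (a, b)) = (\<Sum>b\<in>?K. \<Sum>a\<in>{a\<in>?K. \<pi> b \<noteq> a}. P (a, b))"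
    by (rule sum.swap_restrict) auto
  also have "\<dots> \<le> (\<Sum>b\<in>?K. M b)"
  proof (intro sum_mono)
    fix b
    have "{a\<in>?K. \<pi> b \<noteq> a} = {a\<in>?K. a \<noteq> \<pi> b}" by auto
    then show "(\<Sum>a\<in>{a\<in>?K. \<pi> b \<noteq> a}. P (a, b)) \<le> M b" using Kb[of b] by simp
  qed
  finally have 2: "(\<Sum>a\<in>?K. \<Sum>b\<in>{b\<in>?K. \<pi> b \<noteq> a}. P (a, b)) \<le> (\<Sum>b\<in>?K. M b)" .
  have "(\<Sum>a\<in>?K. \<Sum>b\<in>{b\<in>?K. \<pi> b = a}. M b) = (\<Sum>b\<in>?K. \<Sum>a\<in>{a\<in>?K. \<pi> b = a}. M b)"
    by (rule sum.swap_restrict) auto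
  also have "\<dots> \<le> (\<Sum>b\<in>?K. M b)"
  proof (intro sum_mono)
    fix b
    have eq: "{a\<in>?K. \<pi> b = a} = (if \<pi> b \<in> ?K then {\<pi> b} else {})" by auto
    show "(\<Sum>a\<in>{a\<in>?K. \<pi> b = a}. M b) \<le> M b" unfolding eq using M0[of b] by simp
  qed
  finally have 3: "(\<Sum>a\<in>?K. \<Sum>b\<in>{b\<in>?K. \<pi> b = a}. M b) \<le> (\<Sum>b\<in>?K. M b)" .
  have "(\<Sum>b\<in>?F. 2 * M b) + (\<Sum>b\<in>?K. M b) + (\<Sum>b\<in>?K. M b) = 2 * (\<Sum>b\<in>?V. M b)"
    using split_V[of M] by (simp add: sum_distrib_left)
  also have "\<dots> \<le> 2 * t" using mis by (simp add: M_def)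
  finally show ?thesis using total 1 2 3 by linarith
qed

text \<open>With \<open>w\<close> and \<open>\<pi>\<close> shared, the couplings have disappeared.
  Where the fibre of \<open>a\<close> is a single block, \<open>w a\<close> approximates the mass of
  that block for both hypotheses, so different signs cost \<open>\<gamma> / K\<close>. Every other
  fibre misses \<open>w a\<close> by \<open>1 / (4 * K)\<close> already, so such fibres are
  few.\<close>

lemma close_masses_Hamming:
  assumes close: "(\<Sum>a\<in>{1..K}. \<bar>w a - (\<Sum>b\<in>{b\<in>{1..K}. \<pi> b = a}. mass E b)\<bar>) \<le> 2 * t"
    and close': "(\<Sum>a\<in>{1..K}. \<bar>w a - (\<Sum>b\<in>{b\<in>{1..K}. \<pi> b = a}. mass E' b)\<bar>) \<le> 2 * t"
    and w: "\<And>a. a \<in> {1..K} \<Longrightarrow> (1 - \<gamma>) / (2 * real K) \<le> w a \<and> w a \<le> (1 + \<gamma>) / (2 * real K)"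
    and E: "E \<subseteq> {1..K}" "E' \<subseteq> {1..K}" and t: "t \<ge> 0"
  shows "real (card (sym_diff E E')) \<le> 12 * real K * t / \<gamma>"
proof -
  let ?K = "{1..K}"
  define B where "B a = {b\<in>?K. \<pi> b = a}" for a
  define d where "d a = \<bar>w a - (\<Sum>b\<in>B a. mass E b)\<bar>" for a
  define d' where "d' a = \<bar>w a - (\<Sum>b\<in>B a. mass E' b)\<bar>" for a
  define Good where "Good = {a\<in>?K. card (B a) = 1}"
  define Diff where "Diff = {a\<in>Good. B a \<inter> sym_diff E E' \<noteq> {}}"
  have finB: "finite (B a)" for a by (simp add: B_def)
  have d0: "d a \<ge> 0" "d' a \<ge> 0" for a by (auto simp: d_def d'_def)
  have K0: "real K > 0" using K_pos by simp
  have bad: "1 / (4 * real K) \<le> d a" if a: "a \<in> ?K - Good" for a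
  proof (cases "B a = {}")
    case True
    then have "d a \<ge> (1 - \<gamma>) / (2 * real K)" using w[of a] a by (auto simp: d_def)
    moreover have "1 / (4 * real K) \<le> (1 - \<gamma>) / (2 * real K)" using \<gamma>_le K0 by (simp add: field_simps)
    ultimately show ?thesis by linarith
  next
    case False
    then have "card (B a) \<noteq> 0" using finB by simp
    moreover have "card (B a) \<noteq> 1" using a by (auto simp: Good_def)
    ultimately have c2: "real (card (B a)) \<ge> 2" by linarith
    have g1: "0 \<le> (1 - \<gamma>) / (2 * real K)" using \<gamma>_le K0 by simp
    have "2 * ((1 - \<gamma>) / (2 * real K)) \<le> real (card (B a)) * ((1 - \<gamma>) / (2 * real K))"
      using c2 g1 by (rule mult_right_mono)
    also have "\<dots> = (\<Sum>b\<in>B a. (1 - \<gamma>) / (2 * real K))" by simp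
    also have "\<dots> \<le> (\<Sum>b\<in>B a. mass E b)" by (intro sum_mono mass_bounds) (auto simp: B_def)
    finally have "2 * ((1 - \<gamma>) / (2 * real K)) - (1 + \<gamma>) / (2 * real K) \<le> d a"
      using w[of a] a unfolding d_def by auto
    \<comment> \<open>Two light blocks exceed a heavy one by
      \<open>(1 - 3 * \<gamma>) / (2 * K)\<close>; this is what \<open>\<gamma> \<le> 1 / 6\<close>
      is made for.\<close>
    moreover have "1 / (4 * real K) \<le> 2 * ((1 - \<gamma>) / (2 * real K)) - (1 + \<gamma>) / (2 * real K)"
      using \<gamma>_le K0 by (simp add: field_simps)
    ultimately show ?thesis by linarith
  qed
  have diff: "\<gamma> / real K \<le> d a + d' a" if a: "a \<in> Diff" for a
  proof -
    obtain b where b: "B a = {b}" using a by (auto simp: Diff_def Good_def card_1_singleton_iff)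
    have bK: "b \<in> ?K" using b by (auto simp: B_def)
    have "b \<in> sym_diff E E'" using a b by (auto simp: Diff_def)
    then have "\<bar>mass E b - mass E' b\<bar> = \<gamma> / real K"
      using bK \<gamma>_pos K0 by (auto simp: mass_def field_simps abs_if)
    then show ?thesis unfolding d_def d'_def b by simp
  qed
  have "real (card (?K - Good)) * (1 / (4 * real K)) = (\<Sum>a\<in>?K - Good. 1 / (4 * real K))" by simp
  also have "\<dots> \<le> (\<Sum>a\<in>?K - Good. d a)" by (intro sum_mono bad)
  also have "\<dots> \<le> (\<Sum>a\<in>?K. d a)" using d0 by (intro sum_mono2) auto
  also have "\<dots> \<le> 2 * t" using close by (simp add: d_def B_def)
  finally have nbad: "real (card (?K - Good)) \<le> 8 * real K * t" using K0 by (simp add: field_simps)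
  have "real (card Diff) * (\<gamma> / real K) = (\<Sum>a\<in>Diff. \<gamma> / real K)" by simp
  also have "\<dots> \<le> (\<Sum>a\<in>Diff. d a + d' a)" by (intro sum_mono diff)
  also have "\<dots> \<le> (\<Sum>a\<in>?K. d a + d' a)" using d0 by (intro sum_mono2) (auto simp: Diff_def Good_def)
  also have "\<dots> \<le> 4 * t" using close close' by (simp add: d_def d'_def B_def sum.distrib)
  finally have ndiff: "real (card Diff) \<le> 4 * real K * t / \<gamma>" using K0 \<gamma>_pos by (simp add: field_simps)
  have finG: "finite Good" "finite Diff" by (auto simp: Good_def Diff_def)
  have disj: "disjoint_family_on B Good" by (auto simp: disjoint_family_on_def B_def)
  have "card (\<Union>a\<in>Good. B a) = (\<Sum>a\<in>Good. card (B a))"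
    using disj finG finB by (intro card_UN_disjoint) (auto simp: disjoint_family_on_def)
  also have "\<dots> = card Good" by (simp add: Good_def)
  finally have cU: "card (\<Union>a\<in>Good. B a) = card Good" .
  \<comment> \<open>Blocks and targets are equally many and a good fibre uses up one of each, so few
    bad targets leave few blocks outside the good fibres, including those that \<open>\<pi>\<close>
    sends to 0.\<close>
  have rest: "card (?K - (\<Union>a\<in>Good. B a)) = card (?K - Good)"
  proof -
    have "card (?K - (\<Union>a\<in>Good. B a)) = card ?K - card (\<Union>a\<in>Good. B a)"
      using finG finB by (intro card_Diff_subset) (auto simp: B_def)
    also have "\<dots> = card (?K - Good)"
      unfolding cU using finG by (intro card_Diff_subset[symmetric]) (auto simp: Good_def)
    finally show ?thesis .
  qed
  have sub: "sym_diff E E' \<subseteq> (?K - (\<Union>a\<in>Good. B a)) \<union> (\<Union>a\<in>Diff. B a)"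
    using E by (auto simp: Diff_def)
  have cD: "card (\<Union>a\<in>Diff. B a) \<le> card Diff"
  proof -
    have "card (\<Union>a\<in>Diff. B a) \<le> (\<Sum>a\<in>Diff. card (B a))" by (intro card_UN_le finG)
    also have "\<dots> = card Diff" by (simp add: Diff_def Good_def)
    finally show ?thesis .
  qed
  have "card (sym_diff E E') \<le> card ((?K - (\<Union>a\<in>Good. B a)) \<union> (\<Union>a\<in>Diff. B a))"
    using finG finB by (intro card_mono sub) auto
  also have "\<dots> \<le> card (?K - (\<Union>a\<in>Good. B a)) + card (\<Union>a\<in>Diff. B a)" by (rule card_Un_le)
  also have "\<dots> \<le> card (?K - Good) + card Diff" using rest cD by simp
  finally have "real (card (sym_diff E E')) \<le> 8 * real K * t + 4 * real K * t / \<gamma>"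
    using nbad ndiff by linarith
  also have "8 * real K * t \<le> 8 * real K * t / \<gamma>"
  proof -
    have "\<gamma> * (8 * real K * t) \<le> 1 * (8 * real K * t)"
      using \<gamma>_le t by (intro mult_right_mono) auto
    then show ?thesis using \<gamma>_pos by (simp add: pos_le_divide_eq mult.commute)
  qed
  also have "8 * real K * t / \<gamma> + 4 * real K * t / \<gamma> = 12 * real K * t / \<gamma>"
    by (simp add: add_divide_distrib[symmetric])
  finally show ?thesis by simp
qed

end

section \<open>Rounding the coupling of the letters\<close>

context code_blocks
begin

text \<open>
  Only the coupling of letters with letters matters for the codewords as seen from the word blocks. Rounding
  it to multiples of \<open>1 / resolution\<close> moves these codewords by at most \<open>\<eta> / 2\<close>, and leaves only
  \<open>(resolution + 1) ^ (m * m)\<close> cases, which is subexponential in \<open>K\<close> when \<open>m\<close> is logarithmic in \<open>K\<close>.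
\<close>
definition resolution :: nat where "resolution = 208 * m ^ 3"

text \<open>With this constant the mismatched mass is at most
  \<open>t = 832 * \<gamma> / 100000\<close>, and the Hamming bound
  \<open>12 * K * t / \<gamma>\<close> stays below \<open>K / 10\<close>, since
  \<open>12 * 832 = 9984\<close>.\<close>

abbreviation separation :: "real \<Rightarrow> real" where
  "separation \<rho> \<equiv> \<rho> * \<gamma> / (100000 * sqrt (real m))"

text \<open>The cut bound is the one for \<rho> = 1: the factor \<rho> occurs on both sides and
  cancels, so the count does not depend on it.\<close>

definition good_coupling :: "nat set \<Rightarrow> nat set \<Rightarrow> (nat \<times> nat \<Rightarrow> real) \<Rightarrow> bool" where
  "good_coupling E E' P \<longleftrightarrow> (\<forall>p. P p \<ge> 0) \<and>
     (\<forall>a\<in>{1..K+m}. (\<Sum>b\<in>{1..K+m}. P (a, b)) = mass E a) \<and>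
     (\<forall>b\<in>{1..K+m}. (\<Sum>a\<in>{1..K+m}. P (a, b)) = mass E' b) \<and>
     (\<forall>S T. finite S \<longrightarrow> finite T \<longrightarrow>
       \<bar>\<Sum>p\<in>S. \<Sum>q\<in>T. P p * P q * (code_matrix (fst p) (fst q) - code_matrix (snd p) (snd q))\<bar> \<le> 2 * separation 1)"

text \<open>A word block meets only letters, so its blur involves no other entries of the coupling.
  With \<open>m\<close> letters, each off by at most \<open>m / resolution\<close>, the error is
  \<open>1 / (208 * m)\<close>, against \<open>\<eta> / 2 = 1 / (208 * sqrt m)\<close>.\<close>

lemma code_blur_close:
  assumes "\<And>i j. i \<in> {K+1..K+m} \<Longrightarrow> j \<in> {K+1..K+m} \<Longrightarrow> \<bar>P (i, j) - P' (i, j)\<bar> \<le> 1 / real resolution"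
    and b: "b \<in> {1..K}"
  shows "code_dist (code_blur P b) (code_blur P' b) \<le> \<eta> / 2"
proof -
  have "\<bar>code_blur P b i - code_blur P' b i\<bar> \<le> real m * (1 / real resolution)" if i: "i \<in> {K+1..K+m}" for i
  proof -
    have "\<bar>code_blur P b i - code_blur P' b i\<bar> = \<bar>\<Sum>j\<in>{1..K+m}. (P (i, j) - P' (i, j)) * code_matrix b j\<bar>"
      by (simp add: code_blur_def sum_subtractf algebra_simps)
    also have "(\<Sum>j\<in>{1..K+m}. (P (i, j) - P' (i, j)) * code_matrix b j)
        = (\<Sum>j\<in>{K+1..K+m}. (P (i, j) - P' (i, j)) * code_matrix b j)"
      using code_matrix_zero[OF b] by (intro sum.mono_neutral_right) auto
    also have "\<bar>\<dots>\<bar> \<le> (\<Sum>j\<in>{K+1..K+m}. \<bar>(P (i, j) - P' (i, j)) * code_matrix b j\<bar>)" by (rule sum_abs)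
    also have "\<dots> \<le> (\<Sum>j\<in>{K+1..K+m}. 1 / real resolution)"
    proof (intro sum_mono)
      fix j assume j: "j \<in> {K+1..K+m}"
      have "\<bar>(P (i, j) - P' (i, j)) * code_matrix b j\<bar> \<le> \<bar>P (i, j) - P' (i, j)\<bar>"
        by (auto simp: code_matrix_def)
      then show "\<bar>(P (i, j) - P' (i, j)) * code_matrix b j\<bar> \<le> 1 / real resolution"
        using assms(1)[OF i j] by linarith
    qed
    finally show ?thesis by simp
  qed
  then have "code_dist (code_blur P b) (code_blur P' b) \<le> real (card {K+1..K+m}) * (real m * (1 / real resolution))"
    by (intro avg_subset_sum_le) auto
  also have "\<dots> = 1 / (208 * real m)"
    using m_pos by (simp add: resolution_def power3_eq_cube)
  also have "\<dots> \<le> \<eta> / 2"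
  proof -
    have "sqrt (real m) \<le> real m" using m_pos by (simp add: real_le_lsqrt power2_eq_square)
    then show ?thesis using m_pos by (simp add: divide_simps)
  qed
  finally show ?thesis .
qed

text \<open>Both hypotheses are coupled with the same \<open>E\<close>, whose masses serve as the
  common \<open>w\<close>; similar letter couplings allow the same \<open>\<pi>\<close> on the word
  blocks.\<close>

lemma good_couplings_Hamming:
  assumes P: "good_coupling E E1 P" and P': "good_coupling E E2 P'"
    and close: "\<And>i j. i \<in> {K+1..K+m} \<Longrightarrow> j \<in> {K+1..K+m} \<Longrightarrow> \<bar>P' (i, j) - P (i, j)\<bar> \<le> 1 / real resolution"
    and E: "E1 \<subseteq> {1..K}" "E2 \<subseteq> {1..K}"
  shows "real (card (sym_diff E1 E2)) \<le> real K / 10"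
proof -
  have ex: "\<exists>\<pi>. \<forall>b. \<pi> b \<le> K \<and> (\<forall>a\<le>K. a \<noteq> \<pi> b \<longrightarrow> \<eta> \<le> code_dist (word_vector a) (code_blur P b))" for P
    using nearest_word by (intro choice allI) blast
  obtain \<pi> where \<pi>: "\<And>b. \<pi> b \<le> K" "\<And>a b. a \<le> K \<Longrightarrow> a \<noteq> \<pi> b \<Longrightarrow> \<eta> \<le> code_dist (word_vector a) (code_blur P b)"
    using ex[of P] by blast
  obtain \<pi>' where \<pi>': "\<And>b. \<pi>' b \<le> K" "\<And>a b. a \<le> K \<Longrightarrow> a \<noteq> \<pi>' b \<Longrightarrow> \<eta> \<le> code_dist (word_vector a) (code_blur P' b)"
    using ex[of P'] by blast
  \<comment> \<open>Blurs of letter blocks involve entries that are not assumed close, so there the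
    map of \<open>P'\<close> is kept. The conclusion of \<open>matched_masses\<close> reads the map
    on word blocks only.\<close>
  define \<pi>2 where "\<pi>2 b = (if b \<le> K then \<pi> b else \<pi>' b)" for b
  have \<eta>: "\<eta> > 0" using m_pos by simp
  have "a / 2 \<le> a" if "0 < a" for a :: real using that by simp
  note half = this[OF \<eta>]
  have rest: "a / 2 \<le> x" if "a \<le> x + y" "y \<le> a / 2" for a x y :: real
    using that by linarith
  have far: "\<eta> / 2 \<le> code_dist (word_vector a) (code_blur P b)" if "a \<le> K" "a \<noteq> \<pi> b" for a b
    by (rule order_trans[OF half \<pi>(2)[OF that]])
  have far2: "\<eta> / 2 \<le> code_dist (word_vector a) (code_blur P' b)"
    if b: "b \<in> {1..K+m}" and a: "a \<le> K" "a \<noteq> \<pi>2 b" for a b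
  proof (cases "b \<le> K")
    case True
    have "\<eta> \<le> code_dist (word_vector a) (code_blur P b)" using \<pi>(2) a True by (simp add: \<pi>2_def)
    also have "\<dots> \<le> code_dist (word_vector a) (code_blur P' b) + code_dist (code_blur P' b) (code_blur P b)"
      by (rule avg_subset_sum_triangle)
    finally show ?thesis using code_blur_close[of P' P b, OF close] b True by (intro rest) auto
  next
    case False
    then show ?thesis using a by (intro order_trans[OF half \<pi>'(2)[of a b]]) (simp_all add: \<pi>2_def)
  qed
  define t where "t = 4 * (2 * separation 1) / \<eta>"
  have t: "t = 832 * \<gamma> / 100000" using m_pos by (simp add: t_def field_simps)
  have mis: "(\<Sum>b\<in>{1..K+m}. \<Sum>a\<in>{a\<in>{1..K+m}. word a \<noteq> \<pi> b}. P (a, b)) \<le> t"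
    unfolding t_def using P far unfolding good_coupling_def by (intro coupling_mismatch[where E = E]) blast+
  have mis2: "(\<Sum>b\<in>{1..K+m}. \<Sum>a\<in>{a\<in>{1..K+m}. word a \<noteq> \<pi>2 b}. P' (a, b)) \<le> t"
    unfolding t_def using P' far2 unfolding good_coupling_def by (intro coupling_mismatch[where E = E]) blast+
  have "(\<Sum>a\<in>{1..K}. \<bar>mass E a - (\<Sum>b\<in>{b\<in>{1..K}. \<pi> b = a}. mass E1 b)\<bar>) \<le> 2 * t"
    using P \<pi>(1) mis unfolding good_coupling_def by (intro matched_masses[where P = P]) blast+
  moreover have "(\<Sum>a\<in>{1..K}. \<bar>mass E a - (\<Sum>b\<in>{b\<in>{1..K}. \<pi> b = a}. mass E2 b)\<bar>) \<le> 2 * t"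
  proof -
    have "(\<Sum>a\<in>{1..K}. \<bar>mass E a - (\<Sum>b\<in>{b\<in>{1..K}. \<pi>2 b = a}. mass E2 b)\<bar>) \<le> 2 * t"
    proof (rule matched_masses[where P = P'])
      show "\<pi>2 b \<le> K" for b using \<pi>(1) \<pi>'(1) by (simp add: \<pi>2_def)
    qed (use P' mis2 in \<open>auto simp: good_coupling_def\<close>)
    moreover have "{b\<in>{1..K}. \<pi>2 b = a} = {b\<in>{1..K}. \<pi> b = a}" for a by (auto simp: \<pi>2_def)
    ultimately show ?thesis by simp
  qed
  ultimately have "real (card (sym_diff E1 E2)) \<le> 12 * real K * t / \<gamma>"
    using mass_bounds E \<gamma>_pos by (intro close_masses_Hamming[where w = "mass E" and \<pi> = \<pi>]) (auto simp: t)
  also have "\<dots> \<le> real K / 10" using \<gamma>_pos by (simp add: t)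
  finally show ?thesis .
qed

section \<open>The hypotheses, and how many of them are near an estimate\<close>

lemma sum_mass:
  assumes E: "E \<subseteq> {1..K}" "2 * card E = K"
  shows "(\<Sum>a\<in>{1..K+m}. mass E a) = 1"
proof -
  have "(\<Sum>a\<in>{1..K+m}. mass E a) = (\<Sum>a\<in>{1..K} \<union> {K+1..K+m}. mass E a)"
    by (intro sum.cong) auto
  also have "\<dots> = (\<Sum>a\<in>{1..K}. mass E a) + (\<Sum>a\<in>{K+1..K+m}. mass E a)"
    by (intro sum.union_disjoint) auto
  also have "(\<Sum>a\<in>{K+1..K+m}. mass E a) = (\<Sum>a\<in>{K+1..K+m}. 1 / (2 * real m))"
    by (intro sum.cong) (auto simp: mass_def)
  also have "\<dots> = 1 / 2" using m_pos by simp
  also have "(\<Sum>a\<in>{1..K}. mass E a)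
      = (\<Sum>a\<in>{1..K}. (1 - \<gamma>) / (2 * real K) + (if a \<in> E then \<gamma> / real K else 0))"
    by (intro sum.cong) (auto simp: mass_def field_simps)
  also have "\<dots> = (1 - \<gamma>) / 2 + real (card E) * (\<gamma> / real K)"
  proof -
    have "(\<Sum>a\<in>{1..K}. if a \<in> E then \<gamma> / real K else 0) = (\<Sum>a\<in>E. \<gamma> / real K)"
      using E(1) by (subst sum.inter_restrict[symmetric]) (auto simp: Int_absorb1)
    then show ?thesis using K_pos by (simp add: sum.distrib)
  qed
  also have "real (card E) = real K / 2" using E(2) by linarith
  finally show ?thesis using K_pos by (simp add: field_simps)
qed

definition labels :: "nat set \<Rightarrow> real \<Rightarrow> nat" where
  "labels E = (SOME \<phi>. has_block_masses (K + m) (mass E) \<phi>)"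

text \<open>As many signs of each kind, so that the word masses add up to 1/2 for every
  \<gamma>.\<close>

definition balanced :: "nat set set" where
  "balanced = {E. E \<subseteq> {1..K} \<and> card E = K div 2}"

lemma balancedD: "E \<in> balanced \<Longrightarrow> E \<subseteq> {1..K}" "E \<in> balanced \<Longrightarrow> 2 * card E = K"
  using K_even by (auto simp: balanced_def)

lemma finite_balanced: "finite balanced"
  by (rule finite_subset[of _ "Pow {1..K}"]) (auto simp: balanced_def)

lemma card_balanced: "2 ^ K / real K \<le> real (card balanced)"
proof -
  obtain L where L: "K = 2 * L" using K_even by (elim evenE)
  have "4 ^ L / (2 * real L) \<le> real ((2 * L) choose L)"
    using K_pos L by (intro central_binomial_lower_bound) simp
  moreover have "card balanced = K choose (K div 2)" by (simp add: balanced_def n_subsets)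
  ultimately show ?thesis using L by (simp add: power_mult)
qed

lemma has_block_masses_labels:
  assumes "E \<in> balanced" shows "has_block_masses (K + m) (mass E) (labels E)"
  using block_masses_exist[of "K + m" "mass E", OF mass_nonneg sum_mass[OF assms[THEN balancedD(1)] assms[THEN balancedD(2)]]]
  unfolding labels_def by (rule someI_ex)

definition hard_graphon :: "nat set \<Rightarrow> real \<Rightarrow> real \<Rightarrow> real" where
  "hard_graphon E = block_graphon code_matrix (labels E)"

definition near :: "real \<Rightarrow> (real \<Rightarrow> real \<Rightarrow> real) \<Rightarrow> nat set set" where
  "near \<rho> f = {E \<in> balanced. cut_distance f (\<lambda>x y. \<rho> * hard_graphon E x y) < separation \<rho>}"

text \<open>The number of rounded letter couplings times the Chernoff bound for a Hamming ball of
  radius \<open>K / 10\<close>.\<close>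

abbreviation near_bound :: real where
  "near_bound \<equiv> real ((resolution + 1) ^ (m * m)) * (exp (real K / 10) * (1 + exp (-1)) ^ K)"

lemma near_good_coupling:
  assumes f: "f \<in> graphons" and \<rho>: "0 < \<rho>" "\<rho> \<le> 1" and E: "E \<in> near \<rho> f" "E' \<in> near \<rho> f"
  shows "\<exists>P. good_coupling E E' P"
proof -
  have b: "E \<in> balanced" "E' \<in> balanced"
    and d: "cut_distance f (\<lambda>x y. \<rho> * block_graphon code_matrix (labels E) x y) < separation \<rho>"
           "cut_distance f (\<lambda>x y. \<rho> * block_graphon code_matrix (labels E') x y) < separation \<rho>"
    using E unfolding near_def hard_graphon_def by auto
  obtain P :: "nat \<times> nat \<Rightarrow> real" where P:
    "\<And>p. P p \<ge> 0"
    "\<And>a. a \<in> {1..K+m} \<Longrightarrow> (\<Sum>b\<in>{1..K+m}. P (a, b)) = mass E a"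
    "\<And>b. b \<in> {1..K+m} \<Longrightarrow> (\<Sum>a\<in>{1..K+m}. P (a, b)) = mass E' b"
    "\<And>S T. finite S \<Longrightarrow> finite T \<Longrightarrow>
       \<rho> * \<bar>\<Sum>p\<in>S. \<Sum>q\<in>T. P p * P q * (code_matrix (fst p) (fst q) - code_matrix (snd p) (snd q))\<bar>
         \<le> separation \<rho> + separation \<rho>"
    by (rule close_block_graphons_coupling[OF f less_imp_le[OF \<rho>(1)] \<rho>(2)
          has_block_masses_labels[OF b(1)] block_matrix_code_matrix
          has_block_masses_labels[OF b(2)] block_matrix_code_matrix d], rule that)
  have "\<bar>\<Sum>p\<in>S. \<Sum>q\<in>T. P p * P q * (code_matrix (fst p) (fst q) - code_matrix (snd p) (snd q))\<bar> \<le> 2 * separation 1"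
    if "finite S" "finite T" for S T
  proof -
    have "\<rho> * \<bar>\<Sum>p\<in>S. \<Sum>q\<in>T. P p * P q * (code_matrix (fst p) (fst q) - code_matrix (snd p) (snd q))\<bar>
        \<le> \<rho> * (2 * separation 1)" using P(4)[OF that] by (simp add: mult.commute[of \<gamma> \<rho>])
    then show ?thesis using \<rho>(1) by (simp only: mult_le_cancel_left_pos)
  qed
  then show ?thesis using P(1-3) unfolding good_coupling_def by blast
qed

text \<open>The estimate is eliminated by comparing every near hypothesis with one fixed near
  hypothesis \<open>E\<close>. Hypotheses whose letter couplings with \<open>E\<close> round to the
  same cell lie in one Hamming ball.\<close>

lemma card_near:
  assumes f: "f \<in> graphons" and \<rho>: "0 < \<rho>" "\<rho> \<le> 1"
  shows "real (card (near \<rho> f)) \<le> near_bound"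
proof (cases "near \<rho> f = {}")
  case True
  then show ?thesis by (simp add: add_nonneg_nonneg)
next
  case False
  then obtain E where E: "E \<in> near \<rho> f" by blast
  define P where "P E' = (SOME P. good_coupling E E' P)" for E'
  have P: "good_coupling E E' (P E')" if "E' \<in> near \<rho> f" for E'
    unfolding P_def using near_good_coupling[OF f \<rho> E that] by (rule someI_ex)
  let ?FF = "{K+1..K+m} \<times> {K+1..K+m}"
  let ?h = "real resolution"
  have h: "?h > 0" using m_pos by (simp add: resolution_def)
  define cell where "cell E' = restrict (\<lambda>p. nat \<lfloor>P E' p * ?h\<rfloor>) ?FF" for E'
  let ?C = "PiE ?FF (\<lambda>_. {0..resolution})"
  have finC: "finite ?C" by (intro finite_PiE) auto
  have cell: "cell E' \<in> ?C" if E': "E' \<in> near \<rho> f" for E'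
  proof -
    have "P E' p \<le> 1" if p: "p \<in> ?FF" for p
    proof -
      have "P E' (fst p, snd p) \<le> (\<Sum>b\<in>{1..K+m}. P E' (fst p, b))"
        using P[OF E'] p unfolding good_coupling_def by (intro member_le_sum) auto
      also have "\<dots> = mass E (fst p)" using P[OF E'] p unfolding good_coupling_def by auto
      also have "\<dots> = 1 / (2 * real m)" using p by (auto simp: mass_def)
      also have "\<dots> \<le> 1" using m_pos by simp
      finally show ?thesis by simp
    qed
    then have "nat \<lfloor>P E' p * ?h\<rfloor> \<le> resolution" if "p \<in> ?FF" for p
      using that h by (smt (verit, best) floor_of_nat floor_mono mult_left_le_one_le mult_right_mono nat_int nat_mono)
    then show ?thesis by (auto simp: cell_def PiE_def Pi_def)
  qed
  have fibre: "card {E' \<in> near \<rho> f. cell E' = q} \<le> near_bound / real ((resolution + 1) ^ (m * m))" for q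
  proof (cases "{E' \<in> near \<rho> f. cell E' = q} = {}")
    case True
    then show ?thesis by (simp only: card.empty) (simp add: add_nonneg_nonneg)
  next
    case False
    then obtain E1 where E1: "E1 \<in> near \<rho> f" "cell E1 = q" by blast
    have sub: "{E' \<in> near \<rho> f. cell E' = q} \<subseteq> {T \<in> Pow {1..K}. real (card (sym_diff E1 T)) \<le> real K / 10}"
    proof safe
      fix E2 assume E2: "E2 \<in> near \<rho> f" "q = cell E2"
      have b: "E1 \<subseteq> {1..K}" "E2 \<subseteq> {1..K}" using E1 E2 balancedD(1) unfolding near_def by blast+
      then show "x \<in> E2 \<Longrightarrow> x \<in> {1..K}" for x by blast
      show "real (card (sym_diff E1 E2)) \<le> real K / 10"
      proof (rule good_couplings_Hamming[OF P[OF E1(1)] P[OF E2(1)] _ b])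
        fix i j assume ij: "i \<in> {K+1..K+m}" "j \<in> {K+1..K+m}"
        have "cell E1 (i, j) = cell E2 (i, j)" using E1 E2 by simp
        then have "nat \<lfloor>P E1 (i, j) * ?h\<rfloor> = nat \<lfloor>P E2 (i, j) * ?h\<rfloor>" using ij by (simp add: cell_def)
        moreover have "0 \<le> P E1 (i, j) * ?h" "0 \<le> P E2 (i, j) * ?h"
          using P[OF E1(1)] P[OF E2(1)] unfolding good_coupling_def by auto
        ultimately have "\<lfloor>P E1 (i, j) * ?h\<rfloor> = \<lfloor>P E2 (i, j) * ?h\<rfloor>" by (simp add: eq_nat_nat_iff)
        then have "\<bar>P E2 (i, j) * ?h - P E1 (i, j) * ?h\<bar> \<le> 1" by linarith
        then have "\<bar>P E2 (i, j) - P E1 (i, j)\<bar> * ?h \<le> 1"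
          using h by (simp add: abs_mult flip: left_diff_distrib)
        then show "\<bar>P E2 (i, j) - P E1 (i, j)\<bar> \<le> 1 / ?h" using h by (simp add: pos_le_divide_eq)
      qed
    qed
    have "real (card {E' \<in> near \<rho> f. cell E' = q})
        \<le> real (card {T \<in> Pow {1..K}. real (card (sym_diff E1 T)) \<le> real K / 10})"
      by (intro of_nat_mono card_mono sub) auto
    also have "\<dots> \<le> exp (real K / 10) * (1 + exp (-1)) ^ card {1..K}"
      using E1 balancedD(1) unfolding near_def by (intro card_Hamming_ball) auto
    finally show ?thesis by simp
  qed
  have fin: "finite (near \<rho> f)" using finite_balanced by (auto simp: near_def)
  have "near \<rho> f = (\<Union>q\<in>?C. {E' \<in> near \<rho> f. cell E' = q})" using cell by blast
  then have "card (near \<rho> f) \<le> (\<Sum>q\<in>?C. card {E' \<in> near \<rho> f. cell E' = q})"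
    using card_UN_le[OF finC, of "\<lambda>q. {E' \<in> near \<rho> f. cell E' = q}"] by simp
  then have "real (card (near \<rho> f)) \<le> real (\<Sum>q\<in>?C. card {E' \<in> near \<rho> f. cell E' = q})"
    by (rule of_nat_mono)
  also have "\<dots> = (\<Sum>q\<in>?C. real (card {E' \<in> near \<rho> f. cell E' = q}))" by simp
  also have "\<dots> \<le> (\<Sum>q\<in>?C. near_bound / real ((resolution + 1) ^ (m * m)))" by (intro sum_mono fibre)
  also have "\<dots> = near_bound" by (simp add: card_PiE)
  finally show ?thesis .
qed

end

subsection \<open>Few hypotheses are close to an estimate\<close>

lemma sum_squared_over_reference:
  fixes w v :: "nat \<Rightarrow> real"
  shows "(\<Sum>z\<in>PiE {1..n::nat} (\<lambda>_. {1..k}). (\<Prod>i\<in>{1..n}. w (z i)) ^ 2 / (\<Prod>i\<in>{1..n}. v (z i)))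
     = (\<Sum>a\<in>{1..k}. w a ^ 2 / v a) ^ n"
  unfolding sum_PiE_prod[symmetric] by (simp add: prod_power_distrib prod_dividef)

context code_blocks
begin

text \<open>The masses at \<gamma> = 0, the centre of the family, as reference for the chi-square
  divergence.\<close>

definition base_mass :: "nat \<Rightarrow> real" where
  "base_mass a = (if a \<le> K then 1 / (2 * real K) else 1 / (2 * real m))"

lemma base_mass_pos: "base_mass a > 0"
  using K_pos m_pos by (simp add: base_mass_def)

lemma sum_base_mass: "(\<Sum>a\<in>{1..K+m}. base_mass a) = 1"
proof -
  have "(\<Sum>a\<in>{1..K+m}. base_mass a) = (\<Sum>a\<in>{1..K} \<union> {K+1..K+m}. base_mass a)"
    by (intro sum.cong) auto
  also have "\<dots> = (\<Sum>a\<in>{1..K}. base_mass a) + (\<Sum>a\<in>{K+1..K+m}. base_mass a)"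
    by (intro sum.union_disjoint) auto
  also have "(\<Sum>a\<in>{1..K}. base_mass a) = (\<Sum>a\<in>{1..K}. 1 / (2 * real K))"
    by (intro sum.cong) (auto simp: base_mass_def)
  also have "(\<Sum>a\<in>{K+1..K+m}. base_mass a) = (\<Sum>a\<in>{K+1..K+m}. 1 / (2 * real m))"
    by (intro sum.cong) (auto simp: base_mass_def)
  finally show ?thesis using K_pos m_pos by simp
qed

text \<open>Masses deviate from the base by a factor \<open>1 \<plusminus> \<gamma>\<close> on word
  blocks and not at all on letters.\<close>

lemma mass_chi_square:
  assumes E: "E \<in> balanced"
  shows "(\<Sum>a\<in>{1..K+m}. mass E a ^ 2 / base_mass a) \<le> 1 + \<gamma> ^ 2"
proof -
  have "mass E a ^ 2 / base_mass a \<le> 2 * mass E a - base_mass a + \<gamma> ^ 2 * base_mass a" for a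
  proof -
    have "(mass E a - base_mass a) ^ 2 \<le> (\<gamma> * base_mass a) ^ 2"
      unfolding power2_le_iff_abs_le[OF mult_nonneg_nonneg[OF less_imp_le[OF \<gamma>_pos] less_imp_le[OF base_mass_pos]]]
      using K_pos \<gamma>_pos m_pos by (auto simp: mass_def base_mass_def abs_if field_simps)
    then have "mass E a ^ 2 \<le> (2 * mass E a - base_mass a + \<gamma> ^ 2 * base_mass a) * base_mass a"
      by (simp add: power2_eq_square algebra_simps)
    then show ?thesis using base_mass_pos[of a] by (simp add: pos_divide_le_eq)
  qed
  then have "(\<Sum>a\<in>{1..K+m}. mass E a ^ 2 / base_mass a)
      \<le> (\<Sum>a\<in>{1..K+m}. 2 * mass E a - base_mass a + \<gamma> ^ 2 * base_mass a)" by (intro sum_mono)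
  also have "\<dots> = 2 * (\<Sum>a\<in>{1..K+m}. mass E a) - (\<Sum>a\<in>{1..K+m}. base_mass a) + \<gamma> ^ 2 * (\<Sum>a\<in>{1..K+m}. base_mass a)"
    by (simp add: sum.distrib sum_subtractf sum_distrib_left)
  also have "\<dots> = 1 + \<gamma> ^ 2" using sum_base_mass sum_mass E balancedD by simp
  finally show ?thesis .
qed

definition label_law :: "nat \<Rightarrow> nat set \<Rightarrow> (nat \<Rightarrow> nat) \<Rightarrow> real" where
  "label_law n E z = (\<Prod>i\<in>{1..n}. mass E (z i))"

definition base_law :: "nat \<Rightarrow> (nat \<Rightarrow> nat) \<Rightarrow> real" where
  "base_law n z = (\<Prod>i\<in>{1..n}. base_mass (z i))"

lemma label_law_nonneg: "label_law n E z \<ge> 0"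
  unfolding label_law_def using mass_nonneg by (intro prod_nonneg) auto

lemma base_law_pos: "base_law n z > 0"
  unfolding base_law_def using base_mass_pos by (intro prod_pos) auto

lemma label_law_chi_square:
  assumes "E \<in> balanced"
  shows "(\<Sum>z\<in>PiE {1..n} (\<lambda>_. {1..K+m}). label_law n E z ^ 2 / base_law n z) \<le> exp (real n * \<gamma> ^ 2)"
proof -
  have "(\<Sum>z\<in>PiE {1..n} (\<lambda>_. {1..K+m}). label_law n E z ^ 2 / base_law n z)
      = (\<Sum>a\<in>{1..K+m}. mass E a ^ 2 / base_mass a) ^ n"
    unfolding label_law_def base_law_def by (rule sum_squared_over_reference)
  also have "\<dots> \<le> (1 + \<gamma> ^ 2) ^ n"
    using mass_chi_square[OF assms] base_mass_pos by (intro power_mono sum_nonneg) (auto intro!: divide_nonneg_pos)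
  also have "\<dots> \<le> exp (\<gamma> ^ 2) ^ n"
    using exp_ge_add_one_self[of "\<gamma> ^ 2"] by (intro power_mono) auto
  also have "\<dots> = exp (real n * \<gamma> ^ 2)" by (simp add: exp_of_nat_mult)
  finally show ?thesis .
qed

text \<open>A Bayesian argument with the uniform prior on \<^term>\<open>balanced\<close>: an estimate can be close to few
  hypotheses only, and by the arithmetic--geometric inequality few hypotheses carry little of the total
  likelihood unless some \<open>\<chi>\<^sup>2\<close> divergence from the base law is large. The labels are treated as observed.\<close>
lemma hard_graphon_exists:
  assumes f: "f \<in> estimators n" and \<rho>: "0 < \<rho>" "\<rho> \<le> 1"
    and M: "4 * near_bound * exp (real n * \<gamma> ^ 2) \<le> real (card balanced)"
  shows "\<exists>E\<in>balanced. separation \<rho> / 2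
           \<le> graphon_expectation n \<rho> (hard_graphon E) (\<lambda>A. cut_distance (f A) (\<lambda>x y. \<rho> * hard_graphon E x y))"
proof (rule ccontr)
  let ?Z = "PiE {1..n} (\<lambda>_. {1..K+m})"
  let ?N = "real (card balanced)"
  let ?s = "separation \<rho>"
  let ?d = "\<lambda>E A. cut_distance (f A) (\<lambda>x y. \<rho> * hard_graphon E x y)"
  let ?R = "\<lambda>E. graphon_expectation n \<rho> (hard_graphon E) (?d E)"
  define B where "B = near_bound"
  note M = M[folded B_def]
  \<comment> \<open>Given the labels, the graph has the same law under every hypothesis:
    \<open>E\<close> enters through \<open>label_law\<close> alone.\<close>
  define \<mu> where "\<mu> z = edge_pmf n (block_probs \<rho> code_matrix z)" for z
  let ?E = "\<lambda>z. measure_pmf.expectation (\<mu> z)"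
  define ind :: "nat set \<Rightarrow> (nat \<times> nat \<Rightarrow> bool) \<Rightarrow> real"
    where "ind E e = of_bool (E \<in> near \<rho> (f (edge_adjacency e)))" for E e
  have int: "integrable (measure_pmf (\<mu> z)) (g :: _ \<Rightarrow> real)" for z g by (simp add: \<mu>_def)
  have s0: "?s > 0" using \<rho> \<gamma>_pos m_pos by simp
  have nb: "B > 0" unfolding B_def
    by (intro mult_pos_pos zero_less_power add_pos_pos) auto
  have N0: "?N > 0"
  proof -
    have "0 < 4 * B * exp (real n * \<gamma> ^ 2)" by (intro mult_pos_pos nb) auto
    then show ?thesis using M by linarith
  qed
  have supp: "f (edge_adjacency e) \<in> graphons" if "e \<in> set_pmf (\<mu> z)" for e z
    using f edge_adjacency_in_adjacency_matrices set_edge_pmf_subset that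
    unfolding estimators_def \<mu>_def by blast
  have R: "?s * (1 - (\<Sum>z\<in>?Z. label_law n E z * ?E z (ind E))) \<le> ?R E" if E: "E \<in> balanced" for E
  proof -
    note \<phi> = has_block_masses_labels[OF E]
    have one: "(\<Sum>z\<in>?Z. label_law n E z) = 1"
      unfolding label_law_def using sum_PiE_prod[where n = n and k = "K+m" and w = "mass E"] sum_mass E balancedD by simp
    have "?s * (1 - (\<Sum>z\<in>?Z. label_law n E z * ?E z (ind E)))
        = ?s * ((\<Sum>z\<in>?Z. label_law n E z) - (\<Sum>z\<in>?Z. label_law n E z * ?E z (ind E)))"
      by (simp only: one)
    also have "\<dots> = (\<Sum>z\<in>?Z. label_law n E z * ?E z (\<lambda>e. ?s * (1 - ind E e)))"
    proof -
      have "s * ((\<Sum>z\<in>?Z. label_law n E z) - (\<Sum>z\<in>?Z. label_law n E z * ?E z (ind E)))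
          = (\<Sum>z\<in>?Z. label_law n E z * ?E z (\<lambda>e. s * (1 - ind E e)))" for s
        by (simp add: int sum_subtractf sum_distrib_left algebra_simps)
      then show ?thesis .
    qed
    also have "\<dots> \<le> (\<Sum>z\<in>?Z. label_law n E z * ?E z (\<lambda>e. ?d E (edge_adjacency e)))"
    proof (intro sum_mono mult_left_mono label_law_nonneg integral_mono_AE int AE_pmfI)
      fix z e assume "e \<in> set_pmf (\<mu> z)"
      then have "0 \<le> ?d E (edge_adjacency e)"
        using cut_distance_block_nonneg[OF supp less_imp_le[OF \<rho>(1)] \<rho>(2) \<phi> block_matrix_code_matrix]
        unfolding hard_graphon_def by blast
      then show "?s * (1 - ind E e) \<le> ?d E (edge_adjacency e)"
        using E by (auto simp: ind_def near_def)
    qed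
    also have "\<dots> = ?R E"
      unfolding hard_graphon_def graphon_expectation_block[OF \<phi>] label_law_def \<mu>_def ..
    finally show ?thesis .
  qed
  \<comment> \<open>This weight makes the term counting near hypotheses equal to a quarter of their
    total number \<open>?N\<close>; the chi-square term becomes
    \<open>B * exp (n * \<gamma>^2)\<close>, at most another quarter by \<open>M\<close>.\<close>
  define l where "l = ?N / (2 * B)"
  have l: "l > 0" using N0 nb by (simp add: l_def)
  have amgm: "label_law n E z * ind E e \<le> base_law n z * (l / 2) * ind E e + label_law n E z ^ 2 / base_law n z / (2 * l)"
    for E z e
  proof -
    define p q where "p = label_law n E z" and "q = base_law n z"
    have q: "q > 0" unfolding q_def by (rule base_law_pos)
    have "0 \<le> (p - q * l) ^ 2" by simp
    then have "2 * p * (q * l) \<le> p ^ 2 + (q * l) ^ 2" by (simp add: power2_eq_square algebra_simps)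
    then have "p \<le> q * (l / 2) + p ^ 2 / q / (2 * l)"
      using q l by (simp add: field_simps power2_eq_square)
    moreover have "0 \<le> p ^ 2 / q / (2 * l)" using q l by simp
    ultimately show ?thesis unfolding p_def[symmetric] q_def[symmetric] by (simp add: ind_def)
  qed
  have "(\<Sum>E\<in>balanced. \<Sum>z\<in>?Z. label_law n E z * ?E z (ind E))
      = (\<Sum>z\<in>?Z. ?E z (\<lambda>e. \<Sum>E\<in>balanced. label_law n E z * ind E e))"
    by (subst sum.swap) (simp add: Bochner_Integration.integral_sum int)
  also have "\<dots> \<le> (\<Sum>z\<in>?Z. ?E z (\<lambda>e. base_law n z * (l / 2) * B
                      + (\<Sum>E\<in>balanced. label_law n E z ^ 2 / base_law n z / (2 * l))))"
  proof (intro sum_mono integral_mono_AE int AE_pmfI)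
    fix z e assume e: "e \<in> set_pmf (\<mu> z)"
    have "(\<Sum>E\<in>balanced. ind E e) = real (card (near \<rho> (f (edge_adjacency e))))"
    proof -
      have "near \<rho> (f (edge_adjacency e)) \<subseteq> balanced" by (auto simp: near_def)
      then show ?thesis
        using finite_balanced by (simp add: ind_def of_bool_def sum.If_cases Int_absorb1)
    qed
    also have "\<dots> \<le> B" unfolding B_def by (rule card_near[OF supp[OF e] \<rho>])
    finally have count: "(\<Sum>E\<in>balanced. ind E e) \<le> B" .
    have "(\<Sum>E\<in>balanced. label_law n E z * ind E e)
        \<le> (\<Sum>E\<in>balanced. base_law n z * (l / 2) * ind E e + label_law n E z ^ 2 / base_law n z / (2 * l))"
      by (intro sum_mono amgm)
    also have "\<dots> = base_law n z * (l / 2) * (\<Sum>E\<in>balanced. ind E e)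
                    + (\<Sum>E\<in>balanced. label_law n E z ^ 2 / base_law n z / (2 * l))"
      by (simp add: sum.distrib sum_distrib_left)
    also have "\<dots> \<le> base_law n z * (l / 2) * B
                    + (\<Sum>E\<in>balanced. label_law n E z ^ 2 / base_law n z / (2 * l))"
      using count base_law_pos[of n z] l by (intro add_right_mono mult_left_mono) auto
    finally show "(\<Sum>E\<in>balanced. label_law n E z * ind E e)
        \<le> base_law n z * (l / 2) * B + (\<Sum>E\<in>balanced. label_law n E z ^ 2 / base_law n z / (2 * l))" .
  qed
  also have "\<dots> = (\<Sum>z\<in>?Z. base_law n z) * ((l / 2) * B)
                   + (\<Sum>E\<in>balanced. (\<Sum>z\<in>?Z. label_law n E z ^ 2 / base_law n z) / (2 * l))"
    by (simp only: measure_pmf.prob_space lebesgue_integral_const sum.distrib sum.swap[of _ balanced ?Z]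
        sum_divide_distrib sum_distrib_right real_scaleR_def mult_1 mult.assoc)
  also have "(\<Sum>z\<in>?Z. base_law n z) = 1"
    unfolding base_law_def using sum_PiE_prod[where n = n and k = "K+m" and w = base_mass] sum_base_mass by simp
  also have "(\<Sum>E\<in>balanced. (\<Sum>z\<in>?Z. label_law n E z ^ 2 / base_law n z) / (2 * l))
      \<le> (\<Sum>E\<in>balanced. exp (real n * \<gamma> ^ 2) / (2 * l))"
    using l by (intro sum_mono divide_right_mono label_law_chi_square) auto
  also have "\<dots> = B * exp (real n * \<gamma> ^ 2)"
    using N0 nb by (simp add: l_def)
  also have "1 * ((l / 2) * B) = ?N / 4"
    using nb by (simp add: l_def)
  finally have success: "(\<Sum>E\<in>balanced. \<Sum>z\<in>?Z. label_law n E z * ?E z (ind E)) \<le> ?N / 2"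
    using M by simp
  assume "\<not> ?thesis"
  then have small: "?R E < ?s / 2" if "E \<in> balanced" for E using that by force
  have "(\<Sum>E\<in>balanced. ?R E) < (\<Sum>E\<in>balanced. ?s / 2)"
  proof (rule sum_strict_mono[OF finite_balanced _ small])
    show "balanced \<noteq> {}" using N0 by auto
  qed
  moreover have "(\<Sum>E\<in>balanced. ?s * (1 - (\<Sum>z\<in>?Z. label_law n E z * ?E z (ind E)))) \<le> (\<Sum>E\<in>balanced. ?R E)"
    by (intro sum_mono R)
  moreover have "(\<Sum>E\<in>balanced. ?s * (1 - (\<Sum>z\<in>?Z. label_law n E z * ?E z (ind E))))
      = ?s * (?N - (\<Sum>E\<in>balanced. \<Sum>z\<in>?Z. label_law n E z * ?E z (ind E)))"
    by (simp only: sum_distrib_left[symmetric] sum_subtractf sum_constant mult_1_right)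
  moreover have "?s * (?N / 2) \<le> ?s * (?N - (\<Sum>E\<in>balanced. \<Sum>z\<in>?Z. label_law n E z * ?E z (ind E)))"
    using success s0 by (intro mult_left_mono) auto
  moreover have "(\<Sum>E\<in>balanced. ?s / 2) = ?s * (?N / 2)" by simp
  ultimately show False by linarith
qed

end

subsection \<open>The lower bound\<close>

text \<open>Hence a Hamming ball of radius \<open>j / 10\<close> in a set of size \<open>j\<close>
  has proportion at most \<open>exp (- j / 5)\<close>. This serves for the code as well as for the
  hypotheses.\<close>

lemma Hamming_rate: "exp (1 / 10) * (1 + exp (-1)) \<le> 2 * exp (- 1 / 5 :: real)"
proof -
  have "exp (1 / 2 :: real) \<ge> 13 / 8"
    using exp_lower_Taylor_quadratic[of "1 / 2 :: real"] by (simp add: power2_eq_square)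
  then have "exp (1 / 2 :: real) ^ 2 \<ge> (13 / 8) ^ 2" by (intro power_mono) auto
  also have "exp (1 / 2 :: real) ^ 2 = exp 1" by (simp flip: exp_double)
  finally have "exp (1 :: real) \<ge> 13 / 5" by (simp add: power2_eq_square)
  then have e1: "exp (-1 :: real) \<le> 5 / 13" by (simp add: exp_minus field_simps)
  have "exp (- 3 / 10 :: real) \<ge> 7 / 10" using exp_ge_add_one_self[of "- 3 / 10 :: real"] by simp
  then have e2: "2 * (7 / 10) \<le> 2 * exp (- 3 / 10 :: real)" by simp
  have "exp (1 / 10) * (1 + exp (-1 :: real)) \<le> exp (1 / 10) * (2 * exp (- 3 / 10))"
    using e1 e2 by (intro mult_left_mono) auto
  also have "\<dots> = 2 * exp (- 1 / 5)" by (simp flip: exp_add)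
  finally show ?thesis .
qed

text \<open>Here \<open>x\<close> stands for \<open>K\<close> and \<open>5 * ln (x + 1) + 1\<close>
  bounds \<open>m\<close>. The second part bounds the logarithm of \<open>4 * K\<close> times the
  number of rounded letter couplings.\<close>

lemma eventually_parameters:
  "eventually (\<lambda>x::real. 4 * (5 * ln (x + 1) + 1) \<le> x \<and>
     ln (4 * x) + (5 * ln (x + 1) + 1) ^ 2 * ln (208 * (5 * ln (x + 1) + 1) ^ 3 + 1) \<le> x / 10) at_top"
  by (intro eventually_conj; real_asymp)

lemma code_lower_bound:
  "\<exists>k0::nat. \<forall>k\<ge>k0. \<forall>n \<rho> f. k \<le> n \<longrightarrow> 0 < \<rho> \<longrightarrow> \<rho> \<le> 1 \<longrightarrow> f \<in> estimators n \<longrightarrow>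
     (\<exists>W\<in>step_graphons k. \<rho> * sqrt (real k / (real n * ln (real k))) / 7200000
        \<le> graphon_expectation n \<rho> W (\<lambda>A. cut_distance (f A) (\<lambda>x y. \<rho> * W x y)))"
proof -
  from eventually_parameters obtain X :: real where X: "\<And>x. X \<le> x \<Longrightarrow> 4 * (5 * ln (x + 1) + 1) \<le> x"
    "\<And>x. X \<le> x \<Longrightarrow> ln (4 * x) + (5 * ln (x + 1) + 1) ^ 2 * ln (208 * (5 * ln (x + 1) + 1) ^ 3 + 1) \<le> x / 10"
    unfolding eventually_at_top_linorder by blast
  have "\<exists>W\<in>step_graphons k. \<rho> * sqrt (real k / (real n * ln (real k))) / 7200000
        \<le> graphon_expectation n \<rho> W (\<lambda>A. cut_distance (f A) (\<lambda>x y. \<rho> * W x y))"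
    if k0: "max 8 (nat \<lceil>4 * X\<rceil>) \<le> k" and n: "k \<le> n" and \<rho>: "0 < \<rho>" "\<rho> \<le> 1" and f: "f \<in> estimators n"
    for k n \<rho> f
  proof -
    have k8: "8 \<le> k" and kX: "4 * X \<le> real k" using k0 by linarith+
    \<comment> \<open>Even, and at most half of \<open>k\<close>, which leaves room for the letter
      blocks.\<close>
    define K where "K = 2 * (k div 4)"
    have K: "even K" "4 \<le> K" "2 * K \<le> k" "k \<le> 4 * K" using k8 by (auto simp: K_def)
    have KX: "X \<le> real K" using kX K(4) by linarith
    have K0: "0 < real K" using K by simp
    define l where "l = 5 * ln (real K + 1) + 1"
    \<comment> \<open>The factor 5 offsets the rate 1/5: \<open>exp (- m / 5)\<close> is at most
      \<open>1 / (K + 1)\<close>, so \<open>K\<close> Hamming balls do not exhaust the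
      words.\<close>
    define m where "m = nat \<lceil>5 * ln (real K + 1)\<rceil>"
    have lnK: "0 < ln (real K + 1)" using K by simp
    have m: "5 * ln (real K + 1) \<le> real m" "real m \<le> l" "1 \<le> m"
      using lnK unfolding m_def l_def by linarith+
    have l: "4 * l \<le> real K" "ln (4 * real K) + l ^ 2 * ln (208 * l ^ 3 + 1) \<le> real K / 10"
      using X[OF KX] by (simp_all add: l_def)
    have mK: "4 * m \<le> K" using m(2) l(1) by linarith
    have rate: "(exp (1 / 10) * (1 + exp (-1))) ^ j \<le> 2 ^ j * exp (- real j / 5)" for j :: nat
    proof -
      have "(exp (1 / 10) * (1 + exp (-1))) ^ j \<le> (2 * exp (- 1 / 5 :: real)) ^ j"
        by (intro power_mono Hamming_rate mult_nonneg_nonneg add_nonneg_nonneg) auto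
      then show ?thesis by (simp add: power_mult_distrib flip: exp_of_nat_mult)
    qed
    have exp_split: "exp (real j / 10) * (1 + exp (-1)) ^ j = (exp (1 / 10) * (1 + exp (-1 :: real))) ^ j" for j
      by (simp add: power_mult_distrib flip: exp_of_nat_mult)
    have code: "real K * (exp (real m / 10) * (1 + exp (-1)) ^ card {K+1..K+m}) < 2 ^ card {K+1..K+m}"
    proof -
      have "exp (- real m / 5) \<le> exp (- ln (real K + 1))" using m(1) by simp
      also have "\<dots> = 1 / (real K + 1)" using K0 by (simp add: exp_minus field_simps)
      finally have "real K * exp (- real m / 5) \<le> real K * (1 / (real K + 1))" by (intro mult_left_mono) auto
      also have "\<dots> < 1" using K0 by simp
      finally have lt: "real K * exp (- real m / 5) < 1" .
      have "real K * (exp (real m / 10) * (1 + exp (-1)) ^ m) \<le> real K * (2 ^ m * exp (- real m / 5))"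
        unfolding exp_split by (intro mult_left_mono rate) auto
      also have "\<dots> = 2 ^ m * (real K * exp (- real m / 5))" by simp
      also have "\<dots> < 2 ^ m * 1" using lt by (intro mult_strict_left_mono) auto
      finally show ?thesis by simp
    qed
    from separated_subsets_exist[OF _ code] obtain cw :: "nat \<Rightarrow> nat set" where cw: "cw 0 = {}"
      "\<forall>a\<le>K. cw a \<subseteq> {K+1..K+m}"
      "\<forall>a\<le>K. \<forall>b\<le>K. a \<noteq> b \<longrightarrow> real m / 10 < real (card (sym_diff (cw a) (cw b)))" by auto
    \<comment> \<open>The denominator 6 gives \<open>\<gamma> \<le> 1 / 6\<close>, as
      \<open>K \<le> n\<close>, and \<open>n * \<gamma>^2 = K / 36\<close>, which fits into the
      remaining \<open>K / 5 - K / 10\<close>.\<close>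
    define \<gamma> where "\<gamma> = sqrt (real K / real n) / 6"
    have n0: "0 < real n" using n k8 by simp
    have \<gamma>: "0 < \<gamma>" "\<gamma> \<le> 1 / 6" using K0 n0 K(3) n by (auto simp: \<gamma>_def)
    interpret code_blocks K m cw \<gamma>
      using m(3) mK K(1) cw \<gamma> by unfold_locales auto
    have n\<gamma>: "real n * \<gamma> ^ 2 = real K / 36" using n0 by (simp add: \<gamma>_def power_divide)
    have "4 * near_bound * exp (real n * \<gamma> ^ 2) \<le> real (card balanced)"
    proof -
      have "real ((resolution + 1) ^ (m * m)) = (208 * real m ^ 3 + 1) ^ (m * m)"
        by (simp add: resolution_def add.commute)
      also have "\<dots> = exp (real m ^ 2 * ln (208 * real m ^ 3 + 1))"
      proof -
        have "0 < 208 * real m ^ 3 + 1" by (intro add_nonneg_pos) auto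
        then show ?thesis
          using exp_of_nat_mult[of "m * m" "ln (208 * real m ^ 3 + 1)"] by (simp add: power2_eq_square)
      qed
      also have "\<dots> \<le> exp (l ^ 2 * ln (208 * l ^ 3 + 1))"
      proof -
        have "real m ^ 2 \<le> l ^ 2" "real m ^ 3 \<le> l ^ 3" using m by (auto intro!: power_mono)
        moreover have "0 < 208 * real m ^ 3 + 1" by (intro add_nonneg_pos) auto
        ultimately show ?thesis by (intro iffD2[OF exp_le_cancel_iff] mult_mono) auto
      qed
      finally have grid: "real ((resolution + 1) ^ (m * m)) \<le> exp (l ^ 2 * ln (208 * l ^ 3 + 1))" .
      have "4 * near_bound * exp (real n * \<gamma> ^ 2)
          \<le> 4 * (exp (l ^ 2 * ln (208 * l ^ 3 + 1)) * (2 ^ K * exp (- real K / 5))) * exp (real K / 36)"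
        unfolding n\<gamma> exp_split
        by (intro mult_right_mono mult_left_mono mult_mono grid rate)
           (auto intro!: mult_nonneg_nonneg add_nonneg_nonneg zero_le_power)
      also have "\<dots> = 2 ^ K / real K * (4 * real K * exp (l ^ 2 * ln (208 * l ^ 3 + 1)) * exp (- real K / 5) * exp (real K / 36))"
        using K0 by simp
      also have "4 * real K * exp (l ^ 2 * ln (208 * l ^ 3 + 1)) * exp (- real K / 5) * exp (real K / 36)
          = exp (ln (4 * real K) + l ^ 2 * ln (208 * l ^ 3 + 1) - real K / 5 + real K / 36)"
      proof -
        have "exp (x + y - r + s) = exp x * exp y * exp (- r) * exp s" for x y r s :: real
          by (simp add: exp_add exp_diff exp_minus divide_inverse)
        from this[of "ln (4 * real K)"] show ?thesis using K0 by (simp only:) simp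
      qed
      also have "2 ^ K / real K * \<dots> \<le> 2 ^ K / real K * 1"
      proof (intro mult_left_mono)
        have "ln (4 * real K) + l ^ 2 * ln (208 * l ^ 3 + 1) - real K / 5 + real K / 36 \<le> 0"
          using l(2) K0 by simp
        then show "exp (ln (4 * real K) + l ^ 2 * ln (208 * l ^ 3 + 1) - real K / 5 + real K / 36) \<le> 1" by simp
      qed simp
      also have "\<dots> \<le> real (card balanced)" using card_balanced by simp
      finally show ?thesis .
    qed
    from hard_graphon_exists[OF f \<rho> this] obtain E where E: "E \<in> balanced"
      "separation \<rho> / 2 \<le> graphon_expectation n \<rho> (hard_graphon E) (\<lambda>A. cut_distance (f A) (\<lambda>x y. \<rho> * hard_graphon E x y))"
      by blast
    have "hard_graphon E \<in> step_graphons k"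
      unfolding hard_graphon_def using mK K(3)
      by (intro block_graphon_in_step_graphons[OF has_block_masses_labels[OF E(1)] block_matrix_code_matrix]) auto
    \<comment> \<open>The constant is \<open>36 * 2 * 100000\<close>: passing from \<open>k\<close>
      and \<open>ln k\<close> to \<open>K\<close> and \<open>m\<close> costs 6, the denominator of
      \<open>\<gamma>\<close> another 6, and the rest stems from
      \<open>separation \<rho> / 2\<close>.\<close>
    moreover have "\<rho> * sqrt (real k / (real n * ln (real k))) / 7200000 \<le> separation \<rho> / 2"
    proof -
      have lnk: "1 \<le> ln (real k)"
        using exp_le k8 by (subst ln_ge_iff) auto
      have "ln (real K + 1) \<le> ln (real k)" using K k8 by simp
      then have "real m \<le> 9 * ln (real k)" using m(2) lnk unfolding l_def by linarith
      then have "real k * real m \<le> (4 * real K) * (9 * ln (real k))"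
        using K(4) by (intro mult_mono) auto
      then have "real k / (real n * ln (real k)) \<le> 6 ^ 2 * (real K / real n / real m)"
        using n0 lnk m(3) by (simp add: field_simps)
      then have "sqrt (real k / (real n * ln (real k))) \<le> sqrt (6 ^ 2 * (real K / real n / real m))"
        by (rule real_sqrt_le_mono)
      also have "\<dots> = 6 * (sqrt (real K / real n) / sqrt (real m))"
        by (simp add: real_sqrt_mult real_sqrt_divide)
      also have "\<dots> = 36 * \<gamma> / sqrt (real m)" by (simp add: \<gamma>_def)
      finally have "\<rho> * sqrt (real k / (real n * ln (real k))) \<le> \<rho> * (36 * \<gamma> / sqrt (real m))"
        using \<rho> by (intro mult_left_mono) auto
      then show ?thesis by (simp add: field_simps)
    qed
    ultimately show ?thesis using E(2) by (meson order_trans)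
  qed
  then show ?thesis by blast
qed

theorem theorem2:
  "\<exists>C::real. C > 0 \<and>
     (\<forall>(k::nat) (n::nat) (\<rho>::real). 2 \<le> k \<longrightarrow> k \<le> n \<longrightarrow> 0 < \<rho> \<longrightarrow> \<rho> \<le> 1 \<longrightarrow>
        (INF f \<in> estimators n. SUP W \<in> step_graphons k.
           ereal (graphon_expectation n \<rho> W (\<lambda>A. cut_distance (f A) (\<lambda>x y. \<rho> * W x y))))
        \<ge> ereal (C * min (\<rho> * sqrt (real k / (real n * ln (real k))) + sqrt (\<rho> / real n)) \<rho>))"
proof -
  obtain k0 :: nat where k0: "\<And>k n \<rho> f. \<lbrakk>k0 \<le> k; k \<le> n; 0 < \<rho>; \<rho> \<le> 1; f \<in> estimators n\<rbrakk> \<Longrightarrow>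
     \<exists>W\<in>step_graphons k. \<rho> * sqrt (real k / (real n * ln (real k))) / 7200000
        \<le> graphon_expectation n \<rho> W (\<lambda>A. cut_distance (f A) (\<lambda>x y. \<rho> * W x y))"
    using code_lower_bound by blast
  \<comment> \<open>For \<open>k < k0\<close> the first rate is at most \<open>D - 1\<close> times
    \<open>sqrt (\<rho> / n)\<close>, since \<open>k / ln k \<le> k0 / ln 2\<close>; the two-block
    bound then suffices.\<close>
  define D where "D = sqrt (real k0 / ln 2) + 1"
  define C where "C = 1 / (14400000 * D)"
  have D: "1 \<le> D" by (simp add: D_def)
  have C: "0 < C" using D by (simp add: C_def)
  have "\<exists>W\<in>step_graphons k. C * min (\<rho> * sqrt (real k / (real n * ln (real k))) + sqrt (\<rho> / real n)) \<rho>
          \<le> graphon_expectation n \<rho> W (\<lambda>A. cut_distance (f A) (\<lambda>x y. \<rho> * W x y))"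
    if k: "2 \<le> k" and n: "k \<le> n" and \<rho>: "0 < \<rho>" "\<rho> \<le> 1" and f: "f \<in> estimators n" for k n \<rho> f
  proof -
    define a b where "a = \<rho> * sqrt (real k / (real n * ln (real k)))" and "b = sqrt (\<rho> / real n)"
    have n1: "1 \<le> n" using k n by simp
    have ab: "0 \<le> a" "0 \<le> b" using \<rho> k by (auto simp: a_def b_def)
    have mb: "0 \<le> min b \<rho>" using ab \<rho> by simp
    obtain V where V: "V \<in> step_graphons k"
      "min b \<rho> / 128 \<le> graphon_expectation n \<rho> V (\<lambda>A. cut_distance (f A) (\<lambda>x y. \<rho> * V x y))"
      using two_block_lower_bound[OF k n1 \<rho> f] unfolding b_def by blast
    show ?thesis
    \<comment> \<open>In the first case the minimum to be bounded is at most \<open>2 * a\<close>,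
      in the second at most \<open>2 * D * min b \<rho>\<close>.\<close>
    proof (cases "k0 \<le> k \<and> min b \<rho> \<le> a")
      case True
      then obtain W where W: "W \<in> step_graphons k"
        "a / 7200000 \<le> graphon_expectation n \<rho> W (\<lambda>A. cut_distance (f A) (\<lambda>x y. \<rho> * W x y))"
        using k0[OF _ n \<rho> f] unfolding a_def by blast
      have "C * min (a + b) \<rho> \<le> (1 / 14400000) * min (a + b) \<rho>"
        using D ab \<rho> by (intro mult_right_mono) (auto simp: C_def field_simps)
      also have "\<dots> \<le> (1 / 14400000) * (2 * a)" using True ab by (intro mult_left_mono) auto
      also have "\<dots> = a / 7200000" by simp
      finally show ?thesis using W unfolding a_def b_def by (meson order_trans)
    next
      case False
      have "min (a + b) \<rho> \<le> 2 * D * min b \<rho>"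
      proof (cases "k0 \<le> k")
        case True
        then have "\<not> min b \<rho> \<le> a" using False by blast
        then have "a < min b \<rho>" by (simp only: not_le)
        then have "min (a + b) \<rho> \<le> 2 * min b \<rho>" using ab \<rho> by auto
        also have "\<dots> \<le> 2 * D * min b \<rho>" using D mb by (intro mult_right_mono) auto
        finally show ?thesis .
      next
        case small: False
        have ln2: "0 < ln (2 :: real)" "ln 2 \<le> ln (real k)" using k by auto
        have "real k / (real n * ln (real k)) \<le> real k0 / (real n * ln 2)"
          using small ln2 n1 by (intro frac_le mult_left_mono) auto
        then have "sqrt (real k / (real n * ln (real k))) \<le> sqrt (real k0 / (real n * ln 2))"
          by (rule real_sqrt_le_mono)
        also have "\<dots> = sqrt (real k0 / ln 2) / sqrt (real n)"
          by (simp add: real_sqrt_divide real_sqrt_mult)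
        finally have "a \<le> \<rho> * (sqrt (real k0 / ln 2) / sqrt (real n))"
          unfolding a_def using \<rho> by (intro mult_left_mono) auto
        also have "\<dots> \<le> sqrt \<rho> * (sqrt (real k0 / ln 2) / sqrt (real n))"
          using \<rho> ln2 by (intro mult_right_mono) (auto intro!: real_le_rsqrt simp: power2_eq_square mult_left_le)
        also have "\<dots> = (D - 1) * b" by (simp add: D_def b_def real_sqrt_divide)
        finally have "a + b \<le> D * b" by (simp add: algebra_simps)
        then have "min (a + b) \<rho> \<le> min (D * b) (D * \<rho>)" using D \<rho> by (intro min.mono) auto
        also have "\<dots> = D * min b \<rho>" using D by (simp add: min_mult_distrib_left)
        also have "\<dots> \<le> 2 * D * min b \<rho>" using D mb by (intro mult_right_mono) auto
        finally show ?thesis .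
      qed
      then have "C * min (a + b) \<rho> \<le> C * (2 * D * min b \<rho>)" using C by (intro mult_left_mono) auto
      also have "\<dots> = min b \<rho> / 7200000" using D by (simp add: C_def)
      also have "\<dots> \<le> min b \<rho> / 128" using mb by (intro divide_left_mono) auto
      finally show ?thesis using V unfolding a_def b_def by (meson order_trans)
    qed
  qed
  then have "ereal (C * min (\<rho> * sqrt (real k / (real n * ln (real k))) + sqrt (\<rho> / real n)) \<rho>)
     \<le> (INF f \<in> estimators n. SUP W \<in> step_graphons k.
           ereal (graphon_expectation n \<rho> W (\<lambda>A. cut_distance (f A) (\<lambda>x y. \<rho> * W x y))))"
    if "2 \<le> k" "k \<le> n" "0 < \<rho>" "\<rho> \<le> 1" for k n \<rho>
    using that by (intro INF_greatest) (meson SUP_upper2 ereal_less_eq(3))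
  then show ?thesis using C by blast
qed

end
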